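(* Let $f(n):=R(C_4,K_{1,n})$. Then $f(27)=33$, $f(28)=35$, $f(29)=36$, $f(30)=37$, $f(31)=38$, $f(32)=39$, $f(33)=40$, $f(37)=44$, and $f(67)=76$.
   Context: Graphs are finite, simple and undirected. $G\supseteq H$ means that $H$ is isomorphic to a (not necessarily induced) subgraph of $G$; $\overline{G}$ is the complement of $G$. $C_4$ is the cycle on $4$ vertices and $K_{1,n}$ is the star on $n+1$ vertices (one center joined to $n$ leaves). The Ramsey number $R(H_1,H_2)$ is the smallest integer $N$ such that for every graph $G$ with $N$ vertices, either $G\supseteq H_1$ or $\overline{G}\supseteq H_2$. For a positive integer $n$, $f(n):=R(C_4,K_{1,n})$. *)

theory Defs
  imports "Graph_Theory.Graph_Theory" "HOL-Library.Ramsey"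
begin

text \<open>A finite simple undirected graph is a \<^locale>\<open>pair_graph\<close>: a finite, loop-free, symmetric
  digraph whose arcs are ordered pairs of vertices, so that an edge \<open>uv\<close> is the two arcs
  \<open>(u, v)\<close> and \<open>(v, u)\<close>.\<close>

definition complement_graph :: "'a pair_pre_digraph \<Rightarrow> 'a pair_pre_digraph" where
  "complement_graph G =
     \<lparr>pverts = pverts G,
      parcs = {(u, v). u \<in> pverts G \<and> v \<in> pverts G \<and> u \<noteq> v \<and> (u, v) \<notin> parcs G}\<rparr>"

text \<open>The host graph comes first: \<open>contains_graph G H\<close> is \<open>G \<supseteq> H\<close>.\<close>

definition contains_graph :: "'a pair_pre_digraph \<Rightarrow> 'b pair_pre_digraph \<Rightarrow> bool" where
  "contains_graph G H \<longleftrightarrow>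
     (\<exists>H'. subgraph H' (with_proj G) \<and> digraph_iso (with_proj H) H')"

text \<open>A simple graph only for \<open>n \<ge> 3\<close>.\<close>

definition cycle_graph :: "nat \<Rightarrow> nat pair_pre_digraph" where
  "cycle_graph n =
     \<lparr>pverts = {..<n},
      parcs = {(i, j). i < n \<and> j < n \<and> (j = Suc i mod n \<or> i = Suc j mod n)}\<rparr>"

definition star_graph :: "nat \<Rightarrow> nat pair_pre_digraph" where
  "star_graph n = \<lparr>pverts = {0..n}, parcs = {0} \<times> {1..n} \<union> {1..n} \<times> {0}\<rparr>"

text \<open>Containment is invariant under isomorphism of the host, so graphs with vertices in
  \<^typ>\<open>nat\<close> represent all finite graphs.\<close>

definition ramsey_property :: "'a pair_pre_digraph \<Rightarrow> 'b pair_pre_digraph \<Rightarrow> nat \<Rightarrow> bool" where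
  "ramsey_property H1 H2 N \<longleftrightarrow>
     (\<forall>G :: nat pair_pre_digraph. pair_graph G \<and> card (pverts G) = N \<longrightarrow>
        contains_graph G H1 \<or> contains_graph (complement_graph G) H2)"

definition ramsey_number :: "'a pair_pre_digraph \<Rightarrow> 'b pair_pre_digraph \<Rightarrow> nat" where
  "ramsey_number H1 H2 = (LEAST N. ramsey_property H1 H2 N)"

definition C4_star_ramsey :: "nat \<Rightarrow> nat" where
  "C4_star_ramsey n = ramsey_number (cycle_graph 4) (star_graph n)"


lemma pair_graph_iff:
  "pair_graph G \<longleftrightarrow> finite (pverts G) \<and> parcs G \<subseteq> pverts G \<times> pverts G \<and>
     sym (parcs G) \<and> irrefl (parcs G)"
proof
  assume "pair_graph G"
  then interpret pair_graph G .
  show "finite (pverts G) \<and> parcs G \<subseteq> pverts G \<times> pverts G \<and> sym (parcs G) \<and> irrefl (parcs G)"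
    using pair_finite_verts pair_sym_arcs no_loops' in_arcsD1 in_arcsD2
    by (auto simp: symmetric_def irrefl_def)
next
  assume A: "finite (pverts G) \<and> parcs G \<subseteq> pverts G \<times> pverts G \<and> sym (parcs G) \<and> irrefl (parcs G)"
  moreover from this have "finite (parcs G)"
    by (meson finite_SigmaI finite_subset)
  ultimately show "pair_graph G"
    by unfold_locales (auto simp: symmetric_def irrefl_def)
qed

lemma pair_graph_cycle: "n \<ge> 3 \<Longrightarrow> pair_graph (cycle_graph n)"
  by (auto simp: pair_graph_iff cycle_graph_def sym_def irrefl_def mod_Suc)

lemma pair_graph_star: "pair_graph (star_graph n)"
  by (auto simp: pair_graph_iff star_graph_def sym_def irrefl_def)

lemma star_graph_complete_bipartite: "K\<^bsub>1,n\<^esub> (with_proj (star_graph n))"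
  unfolding complete_bipartite_digraph_pair_def
proof (intro conjI)
  show "finite (pverts (star_graph n))"
    by (simp add: star_graph_def)
  have "pverts (star_graph n) = {0} \<union> {1..n}" "{0} \<inter> {1..n} = {}"
    by (auto simp: star_graph_def)
  then show "\<exists>U V. pverts (star_graph n) = U \<union> V \<and> U \<inter> V = {} \<and> card U = 1 \<and> card V = n \<and>
      parcs (star_graph n) = U \<times> V \<union> V \<times> U"
    by (intro exI[of _ "{0}"] exI[of _ "{1..n}"]) (simp add: star_graph_def)
qed

lemma pair_graph_complement: "pair_graph G \<Longrightarrow> pair_graph (complement_graph G)"
  by (auto simp: pair_graph_iff complement_graph_def sym_def irrefl_def)

lemma contains_graph_iff:
  assumes G: "pair_graph G" and H: "pair_graph H"
  shows "contains_graph G H \<longleftrightarrow>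
    (\<exists>f. inj_on f (pverts H) \<and> f ` pverts H \<subseteq> pverts G \<and>
       (\<forall>(u, v) \<in> parcs H. (f u, f v) \<in> parcs G))"
proof
  assume "contains_graph G H"
  then obtain H' h where sub: "subgraph H' (with_proj G)"
    and h: "pre_digraph.digraph_isomorphism (with_proj H) h" and H': "H' = app_iso h (with_proj H)"
    by (auto simp: contains_graph_def digraph_iso_def)
  have t: "iso_tail h = fst" "iso_head h = snd"
    using sub by (auto simp: H' subgraph_def compatible_def)
  have "(iso_verts h u, iso_verts h v) \<in> parcs G" if "(u, v) \<in> parcs H" for u v
  proof -
    have "iso_arcs h (u, v) = (iso_verts h u, iso_verts h v)"
      using h that t by (auto simp: pre_digraph.digraph_isomorphism_def prod_eq_iff)
    moreover have "iso_arcs h (u, v) \<in> parcs G"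
      using sub that by (auto simp: H' subgraph_def)
    ultimately show ?thesis by simp
  qed
  then show "\<exists>f. inj_on f (pverts H) \<and> f ` pverts H \<subseteq> pverts G \<and>
       (\<forall>(u, v) \<in> parcs H. (f u, f v) \<in> parcs G)"
    using h sub by (auto simp: H' subgraph_def pre_digraph.digraph_isomorphism_def
        intro!: exI[of _ "iso_verts h"])
next
  assume "\<exists>f. inj_on f (pverts H) \<and> f ` pverts H \<subseteq> pverts G \<and>
       (\<forall>(u, v) \<in> parcs H. (f u, f v) \<in> parcs G)"
  then obtain f where f: "inj_on f (pverts H)" "f ` pverts H \<subseteq> pverts G"
    "\<forall>(u, v) \<in> parcs H. (f u, f v) \<in> parcs G"
    by (elim exE conjE)
  define h where "h = \<lparr>iso_verts = f, iso_arcs = map_prod f f, iso_head = snd, iso_tail = fst\<rparr>"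
  interpret G: pair_graph G by fact
  interpret H: pair_graph H by fact
  have "inj_on (map_prod f f) (parcs H)"
    using map_prod_inj_on[OF f(1) f(1)] H.wellformed' by (rule_tac inj_on_subset) auto
  then have iso: "pre_digraph.digraph_isomorphism (with_proj H) h"
    using f by (auto simp: pre_digraph.digraph_isomorphism_def h_def H.wf_digraph)
  have "wf_digraph (app_iso h (with_proj H))"
    by unfold_locales (auto simp: h_def dest: H.wellformed')
  then have "subgraph (app_iso h (with_proj H)) (with_proj G)"
    using f by (auto simp: subgraph_def compatible_def h_def G.wf_digraph)
  with iso show "contains_graph G H"
    by (auto simp: contains_graph_def digraph_iso_def)
qed

text \<open>The minimum in \<^const>\<open>ramsey_number\<close> is attained.\<close>

lemma contains_graph_complete:
  assumes G: "pair_graph G" and H: "pair_graph H"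
    and R: "R \<subseteq> pverts G" "card R = card (pverts H)"
    and complete: "\<And>u v. u \<in> R \<Longrightarrow> v \<in> R \<Longrightarrow> u \<noteq> v \<Longrightarrow> (u, v) \<in> parcs G"
  shows "contains_graph G H"
proof -
  have "finite R" "finite (pverts H)"
    using G H R by (auto simp: pair_graph_iff intro: finite_subset)
  then obtain f where f: "bij_betw f (pverts H) R"
    using R(2) finite_same_card_bij by metis
  have "(f u, f v) \<in> parcs G" if "(u, v) \<in> parcs H" for u v
  proof (rule complete)
    have "u \<in> pverts H" "v \<in> pverts H" "u \<noteq> v"
      using H that by (auto simp: pair_graph_iff irrefl_def)
    then show "f u \<in> R" "f v \<in> R" "f u \<noteq> f v"
      using f by (auto simp: bij_betw_def inj_on_def)
  qed
  then show ?thesis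
    using f R(1) by (auto simp: contains_graph_iff[OF G H] bij_betw_def)
qed

lemma ramsey_property_ramsey_number:
  assumes H1: "pair_graph H1" and H2: "pair_graph H2"
  shows "ramsey_property H1 H2 (ramsey_number H1 H2)"
proof -
  obtain r where r: "\<forall>(V :: nat set) E. finite V \<and> card V \<ge> r \<longrightarrow>
      (\<exists>R \<subseteq> V. card R = card (pverts H1) \<and> clique R E \<or> card R = card (pverts H2) \<and> indep R E)"
    using ramsey2[where 'a = nat, of "card (pverts H1)" "card (pverts H2)"] by (elim exE conjE)
  have "ramsey_property H1 H2 r"
    unfolding ramsey_property_def
  proof (intro allI impI)
    fix G :: "nat pair_pre_digraph"
    assume G: "pair_graph G \<and> card (pverts G) = r"
    then have fin: "finite (pverts G)" and symG: "sym (parcs G)"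
      by (auto simp: pair_graph_iff)
    define E where "E = {{u, v} | u v. (u, v) \<in> parcs G}"
    have E: "{u, v} \<in> E \<longleftrightarrow> (u, v) \<in> parcs G" for u v
      using symG by (auto simp: E_def doubleton_eq_iff dest: symD)
    obtain R where R: "R \<subseteq> pverts G"
      and *: "card R = card (pverts H1) \<and> clique R E \<or> card R = card (pverts H2) \<and> indep R E"
      using r[rule_format, of "pverts G" E] fin G by auto
    from * show "contains_graph G H1 \<or> contains_graph (complement_graph G) H2"
    proof
      assume "card R = card (pverts H1) \<and> clique R E"
      then have "contains_graph G H1"
        using G H1 R by (intro contains_graph_complete[where R = R]) (auto simp: clique_def E)
      then show ?thesis ..
    next
      assume "card R = card (pverts H2) \<and> indep R E"
      then have "contains_graph (complement_graph G) H2"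
        using pair_graph_complement[of G] G H2 R
        by (intro contains_graph_complete[where R = R])
          (auto simp: complement_graph_def indep_def E)
      then show ?thesis ..
    qed
  qed
  then show ?thesis
    unfolding ramsey_number_def by (rule LeastI)
qed

end

theory Submission
  imports Defs "HOL-Computational_Algebra.Primes"
begin

text \<open>
  A graph on \<open>N\<close> vertices witnesses \<open>f(n) > N\<close> exactly if it has no four-cycle and every degree is at
  least \<open>N - n\<close> (lemma \<open>ramsey_property_C4_star_iff\<close>), so everything is about the minimum degree of
  graphs without four-cycles.

  The lower bounds are nine explicit graphs, on 32, 34, ..., 39, 43 and 75 vertices. For the upper
  bounds, the paths of length two that leave a vertex of a \<open>C\<^sub>4\<close>-free graph end in different
  vertices; minimum degree \<open>d\<close> therefore forces \<open>d (d - 1) < N\<close>. This is Parsons' bound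
  (\<open>Parsons_bound\<close>) and settles \<open>n = 28, ..., 33\<close>. In the remaining three cases
  \<open>(N, d) = (44, 7), (76, 9), (33, 6)\<close> the count leaves a slack of only \<open>e = 1, 3, 2\<close>: the graph is
  \<open>d\<close>-regular, and each vertex is \<^emph>\<open>far\<close> from precisely \<open>e\<close> others, in the sense that it has no
  common neighbour with them. In matrix form \<open>A\<^sup>2 = (d - 1) I + J - B\<close>, where \<open>B\<close> is the matrix of
  farness. So \<open>A\<close> commutes with \<open>B\<close> (\<open>exchange\<close>), and the traces of the odd prime powers of \<open>A\<close> can
  be evaluated modulo that prime, because rotation acts freely on closed walks of prime length.

  A neighbour that is not far lies on a triangle, and these neighbours pair up; hence the number of
  far neighbours has the parity of \<open>d\<close>. If \<open>d\<close> is odd, commutation forbids a vertex all of whose far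
  vertices are neighbours (\<open>odd_degree_far_not_subset\<close>). For \<open>e = 1\<close> parity demands such vertices;
  for \<open>e = 3\<close> every vertex is left with one far neighbour, and the number \<open>76 \<cdot> 8\<close> of closed walks of
  length three is not divisible by three.

  For \<open>e = 2\<close> farness decomposes the 33 vertices into cycles. Commutation makes the partition into
  these cycles equitable, and the matrix of its degrees satisfies a quotient of the equation for
  \<open>A\<^sup>2\<close>. Closed walks of length five show that the number of vertices whose two far vertices are
  adjacent is 4 modulo 5 (\<open>card_chord_centres_mod_5\<close>); such vertices fill whole cycles, in which each
  vertex is adjacent to those two steps away. If all these cycles are hexagons, there are four of
  them, and each is attached to one triangle of farness; nine remaining vertices cannot supply
  enough triangles (\<open>not_all_hexagons\<close>). Otherwise a longer cycle \<open>C\<close> of this kind has a companion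
  cycle \<open>U\<close> of the same length formed by the apices of the triangles over its chords. Then only a
  handful of cycle lengths and degrees satisfy the quotient equations, and all of them fail
  (\<open>no_long_chord_walk\<close>).
\<close>

section \<open>Counting tools\<close>

text \<open>
  The orbits of a permutation of prime order \<open>p\<close> without fixed points all have size \<open>p\<close>.
  It is used for the rotation of closed walks and, with \<open>p = 2\<close>, for parity arguments.
\<close>
lemma prime_dvd_card_free_action:
  fixes p :: nat
  assumes p: "prime p" and "finite S"
    and "\<And>x. x \<in> S \<Longrightarrow> r x \<in> S"
    and "\<And>x. x \<in> S \<Longrightarrow> (r ^^ p) x = x"
    and "\<And>x. x \<in> S \<Longrightarrow> r x \<noteq> x"
  shows "p dvd card S"
  using assms(2-)
proof (induction S rule: finite_psubset_induct)
  case (psubset S)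
  show ?case
  proof (cases "S = {}")
    case False
    then obtain x where x: "x \<in> S" by blast
    define Orb where "Orb = (\<lambda>i. (r ^^ i) x) ` {..<p}"
    have pow_S: "(r ^^ i) y \<in> S" if "y \<in> S" for i y
      using that by (induction i) (auto intro: psubset.prems(1))
    have in_Orb: "(r ^^ i) x \<in> Orb" for i
    proof -
      have "(r ^^ i) x = (r ^^ (i mod p)) x"
        using funpow_mod_eq[OF psubset.prems(2)[OF x]] by simp
      then show ?thesis
        using prime_gt_0_nat[OF p] by (auto simp: Orb_def)
    qed
    have no_period: "(r ^^ d) x \<noteq> x" if d_bounds: "0 < d" "d < p" for d
    proof
      assume d: "(r ^^ d) x = x"
      have "coprime d p"
        using prime_imp_coprime[OF p, of d] d_bounds nat_dvd_not_less[of d p] by (simp add: coprime_commute)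
      then have "gcd d p = 1" by simp
      then obtain a b where ab: "d * a = p * b + 1"
        using bezout_nat[of d p] d_bounds by auto
      have "(r ^^ (d * a)) x = x"
        using funpow_mod_eq[OF d, of "d * a"] by simp
      moreover have "(r ^^ (p * b + 1)) x = r x"
      proof -
        have "(r ^^ (p * b + 1)) x = (r ^^ ((p * b + 1) mod p)) x"
          using funpow_mod_eq[OF psubset.prems(2)[OF x]] by simp
        also have "(p * b + 1) mod p = 1"
          using prime_gt_1_nat[OF p] by (simp add: mod_Suc)
        finally show ?thesis by simp
      qed
      ultimately show False
        using psubset.prems(3)[OF x] ab by simp
    qed
    have "inj_on (\<lambda>i. (r ^^ i) x) {..<p}"
    proof (rule linorder_inj_onI)
      fix i j assume ij: "i < j" "i \<in> {..<p}" "j \<in> {..<p}"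
      show "(r ^^ i) x \<noteq> (r ^^ j) x"
      proof
        assume "(r ^^ i) x = (r ^^ j) x"
        then have "(r ^^ (p - j)) ((r ^^ i) x) = (r ^^ (p - j)) ((r ^^ j) x)" by simp
        then have "(r ^^ (p - j + i)) x = (r ^^ (p - j + j)) x"
          by (simp only: funpow_add o_apply)
        also have "p - j + j = p" using ij by simp
        also note psubset.prems(2)[OF x]
        finally have "(r ^^ (p - j + i)) x = x" .
        moreover have "(r ^^ (p - j + i)) x \<noteq> x"
        proof (rule no_period)
          show "0 < p - j + i" using ij(3) by simp
          show "p - j + i < p" using ij by simp
        qed
        ultimately show False by contradiction
      qed
    qed auto
    then have card_Orb: "card Orb = p"
      by (simp add: Orb_def card_image)
    have Orb_S: "Orb \<subseteq> S"
      using pow_S[OF x] by (auto simp: Orb_def)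
    have "p dvd card (S - Orb)"
    proof (rule psubset.IH)
      show "S - Orb \<subset> S" using x in_Orb[of 0] by auto
      fix y assume y: "y \<in> S - Orb"
      show "(r ^^ p) y = y" "r y \<noteq> y" using y psubset.prems by auto
      show "r y \<in> S - Orb"
      proof (rule ccontr)
        assume "r y \<notin> S - Orb"
        then have "r y \<in> Orb" using y psubset.prems(1) by auto
        then obtain i where i: "r y = (r ^^ i) x" by (auto simp: Orb_def)
        have "y = (r ^^ p) y" using y psubset.prems(2) by simp
        also have "\<dots> = (r ^^ (p - 1)) (r y)"
          using prime_gt_0_nat[OF p] by (metis One_nat_def Suc_pred funpow_simps_right(2) o_apply)
        also have "\<dots> = (r ^^ (p - 1 + i)) x" by (simp only: i funpow_add o_apply)
        finally show False using in_Orb y by auto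
      qed
    qed
    moreover have "card S = card (S - Orb) + p"
      using card_Orb Orb_S psubset.hyps by (metis card_Diff_subset card_mono finite_subset le_add_diff_inverse2)
    ultimately show ?thesis by simp
  qed simp
qed

lemma sum_of_bool_card: "finite S \<Longrightarrow> (\<Sum>z\<in>S. of_bool (P z) :: int) = int (card {z\<in>S. P z})"
  by (simp add: of_bool_def sum.If_cases Int_def)

lemma int_const:
  fixes Q :: "int \<Rightarrow> 'b"
  assumes "\<And>k. Q k = Q (k - 1)"
  shows "Q k = Q j"
proof (induction k rule: int_induct[of _ j])
  case (step1 k)
  then show ?case using assms[of "k + 1"] by simp
next
  case (step2 k)
  then show ?case using assms[of k] by simp
qed simp

lemma card_range_periodic:
  fixes c :: "int \<Rightarrow> 'a"
  assumes "0 < l" "\<And>i j. c i = c j \<longleftrightarrow> l dvd (i - j)"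
  shows "card (range c) = nat l" and "range c = c ` {0..<l}"
proof -
  show eq: "range c = c ` {0..<l}"
  proof (intro antisym subsetI)
    fix x assume "x \<in> range c"
    then obtain k where "x = c k" by blast
    moreover have "c k = c (k mod l)" using assms(2) by (simp add: minus_mod_eq_mult_div)
    ultimately show "x \<in> c ` {0..<l}" using assms(1) by auto
  qed auto
  have "inj_on c {0..<l}"
  proof (rule inj_onI)
    fix i j assume "i \<in> {0..<l}" "j \<in> {0..<l}" "c i = c j"
    then have "l dvd i - j" "\<bar>i - j\<bar> < l" using assms by auto
    then show "i = j" using dvd_imp_le_int[of "i - j" l] by force
  qed
  then show "card (range c) = nat l" unfolding eq by (simp add: card_image)
qed

lemma sum_3: "S = {a, b, c} \<Longrightarrow> a \<noteq> b \<Longrightarrow> c \<noteq> a \<Longrightarrow> c \<noteq> b \<Longrightarrow> sum f S = f a + f b + f c"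
  for f :: "'b \<Rightarrow> nat"
  by simp

lemma sum_4: "S = {a, b, c, d} \<Longrightarrow> distinct [a, b, c, d] \<Longrightarrow> sum f S = f a + f b + f c + f d"
  for f :: "'b \<Rightarrow> nat"
  by simp

lemma sum_5: "S = {a, b, c, d, e} \<Longrightarrow> distinct [a, b, c, d, e] \<Longrightarrow> sum f S = f a + f b + f c + f d + f e"
  for f :: "'b \<Rightarrow> nat"
  by simp

lemma sum_nat_1:
  fixes f :: "'b \<Rightarrow> nat"
  assumes "finite A" "sum f A = 1"
  obtains a where "a \<in> A" "f a = 1" "\<And>b. b \<in> A \<Longrightarrow> b \<noteq> a \<Longrightarrow> f b = 0"
  using iffD1[OF sum_eq_1_iff[OF assms(1)] assms(2)] by metis

lemma remove_1: "Q = {a, b} \<union> R \<Longrightarrow> p \<in> R \<Longrightarrow> R - {p} = {} \<Longrightarrow> Q = {a, b, p}"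
  by auto

lemma remove_2:
  assumes "Q = {a, b} \<union> R" "p \<in> R" "R - {p} = {t}"
  shows "Q = {a, b, p, t}" "t \<in> R" "t \<noteq> p"
  using assms by auto

lemma remove_3:
  assumes "Q = {a, b} \<union> R" "p \<in> R" "R - {p} = {s, t}"
  shows "Q = {a, b, p, s, t}" "s \<in> R" "t \<in> R" "s \<noteq> p" "t \<noteq> p"
  using assms by auto

lemma remove_4:
  assumes "Q = {a, b} \<union> R" "p \<in> R" "p' \<in> R" "R - {p} - {p'} = {t}"
  shows "Q = {a, b, p, p', t}" "Q = {a, b, p', p, t}" "t \<in> R" "t \<noteq> p" "t \<noteq> p'"
  using assms by auto

lemma last_in: "Q = {a, b, p, z} \<Longrightarrow> z \<in> Q" "Q = {a, b, p, p', z} \<Longrightarrow> z \<in> Q"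
  by auto

lemma not_last: "Q = {a, b, p, z} \<Longrightarrow> x \<in> Q \<Longrightarrow> x \<noteq> z \<Longrightarrow> x = a \<or> x = b \<or> x = p"
  "Q = {a, b, p, p', z} \<Longrightarrow> x \<in> Q \<Longrightarrow> x \<noteq> z \<Longrightarrow> x = a \<or> x = b \<or> x = p \<or> x = p'"
  by auto

lemma distinct_5: "\<lbrakk>a \<noteq> b; p \<noteq> a; p \<noteq> b; s \<noteq> a; s \<noteq> b; t \<noteq> a; t \<noteq> b; s \<noteq> p; t \<noteq> p; s \<noteq> t\<rbrakk> \<Longrightarrow>
    distinct [a, b, p, s, t]"
  by auto

text \<open>
  The arithmetic that pins down the length \<open>n\<close> of the long cycle \<open>C\<close> and the sizes \<open>m\<close>, \<open>m'\<close> of the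
  other cycles that meet its neighbourhoods, where \<open>h\<close>, \<open>h'\<close> are the degrees from these cycles back
  to \<open>C\<close> and \<open>s\<close> is the number of vertices not accounted for.
\<close>
lemma sizes_if_degree_3:
  fixes n m h s :: nat
  assumes "n = 10 + h" "n = m * h" "2 * n + m + s = 33" "h \<le> 6"
  shows "(n = 11 \<and> m = 11) \<or> (n = 12 \<and> m = 6) \<or> (n = 15 \<and> m = 3)"
proof -
  have "h = 0 \<or> h = 1 \<or> h = 2 \<or> h = 3 \<or> h = 4 \<or> h = 5 \<or> h = 6" using assms(4) by linarith
  then show ?thesis using assms(1-3) by (auto; presburger)
qed

lemma sizes_if_degree_2_one_orbit:
  fixes n m h s :: nat
  assumes "n = 5 + 2 * h" "2 * n = m * h" "2 * n + m + s = 33" "h \<le> 6" "7 \<le> n"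
  shows "(n = 7 \<and> m = 14) \<or> (n = 9 \<and> m = 9)"
proof -
  have "h = 0 \<or> h = 1 \<or> h = 2 \<or> h = 3 \<or> h = 4 \<or> h = 5 \<or> h = 6" using assms(4) by linarith
  then show ?thesis using assms(1-3,5) by (auto; presburger)
qed

lemma sizes_if_degree_2_two_orbits:
  fixes n m m' h h' s :: nat
  assumes "n = 5 + h + h'" "n = m * h" "n = m' * h'" "2 * n + m + m' + s = 33"
    "h \<le> 6" "h' \<le> 6" "7 \<le> n" "n \<noteq> 8" "3 \<le> m" "3 \<le> m'"
  shows "(n = 7 \<and> m = 7 \<and> m' = 7) \<or> (n = 9 \<and> m = 9 \<and> m' = 3) \<or> (n = 9 \<and> m = 3 \<and> m' = 9) \<or>
    (n = 12 \<and> m + m' = 7)"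
proof -
  have h: "h = 0 \<or> h = 1 \<or> h = 2 \<or> h = 3 \<or> h = 4 \<or> h = 5 \<or> h = 6" using assms(5) by linarith
  have h': "h' = 0 \<or> h' = 1 \<or> h' = 2 \<or> h' = 3 \<or> h' = 4 \<or> h' = 5 \<or> h' = 6" using assms(6) by linarith
  show ?thesis using h
    by (elim disjE) (use h' in \<open>elim disjE; use assms in \<open>simp; presburger\<close>\<close>)+
qed

text \<open>
  Each square is at least its base, and the two sums agree, so all entries are 0 or 1. The shape is
  that of a row of the quotient matrix for a cycle of three vertices.
\<close>
lemma small_triangle_row:
  fixes x y z e t :: nat
  assumes "3 * (x + y + z) + e + t = 6" "3 * (x * x + y * y + z * z) + e * e + t * t = 6" "even t"
  shows "t = 0 \<and> e = 0 \<and> x \<le> 1 \<and> y \<le> 1 \<and> z \<le> 1 \<and> x + y + z = 2"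
proof -
  have sq: "a \<le> a * a" for a :: nat by simp
  have small: "a \<le> 1" if "a * a = a" for a :: nat using that by auto
  have tight: "x' = x \<and> y' = y \<and> z' = z \<and> e' = e \<and> t' = t"
    if le: "x \<le> x'" "y \<le> y'" "z \<le> z'" "e \<le> e'" "t \<le> t'" and six: "3 * (x' + y' + z') + e' + t' = 6"
    for x' y' z' e' t' :: nat
  proof -
    obtain i j k m n where "x' = x + i" "y' = y + j" "z' = z + k" "e' = e + m" "t' = t + n"
      using le by (metis le_Suc_ex)
    then show ?thesis using six assms(1) by simp
  qed
  have "x * x = x" "y * y = y" "z * z = z" "e * e = e" "t * t = t"
    using tight[OF sq sq sq sq sq assms(2)] by auto
  then have "x \<le> 1" "y \<le> 1" "z \<le> 1" "e \<le> 1" "t \<le> 1" by (blast intro: small)+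
  moreover from this have "t = 0" using assms(3) by (auto simp: le_Suc_eq)
  moreover from this calculation have "e = 0" using assms(1) by presburger
  ultimately show ?thesis using assms(1) by simp
qed

section \<open>Graphs without four-cycles\<close>

locale simple_graph =
  fixes V :: "'a set" and \<Gamma> :: "'a \<Rightarrow> 'a set"
  assumes finite_V: "finite V"
    and nbrs_V: "\<Gamma> x \<subseteq> V"
    and irrefl: "x \<notin> \<Gamma> x"
    and sym: "y \<in> \<Gamma> x \<Longrightarrow> x \<in> \<Gamma> y"
begin

lemma sym_iff: "y \<in> \<Gamma> x \<longleftrightarrow> x \<in> \<Gamma> y"
  using sym by blast

lemma nbr_in_V: "y \<in> \<Gamma> x \<Longrightarrow> y \<in> V" "y \<in> \<Gamma> x \<Longrightarrow> x \<in> V"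
  using nbrs_V sym by blast+

lemma finite_nbrs [simp]: "finite (\<Gamma> x)"
  using finite_V nbrs_V finite_subset by blast

end

locale C4_free_graph = simple_graph +
  assumes C4_free: "\<lbrakk>x \<noteq> y; u \<in> \<Gamma> x; u \<in> \<Gamma> y; v \<in> \<Gamma> x; v \<in> \<Gamma> y\<rbrakk> \<Longrightarrow> u = v"
begin

text \<open>
  Two different neighbours of \<open>x\<close> share only \<open>x\<close>, so the sets of second steps are disjoint.
\<close>
lemma card_two_step:
  "card (\<Union>u\<in>\<Gamma> x. \<Gamma> u - {x}) = (\<Sum>u\<in>\<Gamma> x. card (\<Gamma> u) - 1)"
proof -
  have "card (\<Union>u\<in>\<Gamma> x. \<Gamma> u - {x}) = (\<Sum>u\<in>\<Gamma> x. card (\<Gamma> u - {x}))"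
  proof (intro card_UN_disjoint ballI impI)
    fix u v assume uv: "u \<in> \<Gamma> x" "v \<in> \<Gamma> x" "u \<noteq> v"
    have False if "w \<noteq> x" "w \<in> \<Gamma> u" "w \<in> \<Gamma> v" for w
      using C4_free[of x w u v] uv that sym[of w u] sym[of w v] by simp
    then show "(\<Gamma> u - {x}) \<inter> (\<Gamma> v - {x}) = {}" by blast
  qed auto
  also have "\<dots> = (\<Sum>u\<in>\<Gamma> x. card (\<Gamma> u) - 1)"
    by (intro sum.cong refl card_Diff_singleton) (rule sym)
  finally show ?thesis .
qed

lemma degree_bound:
  assumes "x \<in> V" and "\<And>u. u \<in> V \<Longrightarrow> d \<le> card (\<Gamma> u)"
  shows "card (\<Gamma> x) * (d - 1) < card V"
proof -
  have "card (\<Gamma> x) * (d - 1) \<le> (\<Sum>u\<in>\<Gamma> x. card (\<Gamma> u) - 1)"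
    using sum_bounded_below[of "\<Gamma> x" "d - 1" "\<lambda>u. card (\<Gamma> u) - 1"] assms(2) nbr_in_V
    by (simp add: diff_le_mono)
  also have "\<dots> = card (\<Union>u\<in>\<Gamma> x. \<Gamma> u - {x})" by (rule card_two_step[symmetric])
  also have "\<dots> \<le> card (V - {x})"
    using nbrs_V finite_V by (intro card_mono) auto
  also have "\<dots> < card V"
    using assms(1) finite_V by (intro psubset_card_mono) auto
  finally show ?thesis .
qed

end

section \<open>Regular graphs with few pairs of vertices lacking a common neighbour\<close>

text \<open>
  The parameter \<open>e\<close> measures the slack in \<open>degree_bound\<close>; for \<open>e = 0\<close> any two vertices would have a
  common neighbour.
\<close>
locale regular_C4_free_graph = C4_free_graph +
  fixes d e :: nat
  assumes regular: "x \<in> V \<Longrightarrow> card (\<Gamma> x) = d"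
    and card_V: "card V = d * (d - 1) + 1 + e"
begin

definition far :: "'a \<Rightarrow> 'a set" where
  "far x = {y \<in> V. x \<in> V \<and> y \<noteq> x \<and> \<Gamma> x \<inter> \<Gamma> y = {}}"

lemma far_V: "far x \<subseteq> V"
  and far_in_V: "y \<in> far x \<Longrightarrow> y \<in> V" "y \<in> far x \<Longrightarrow> x \<in> V"
  and far_irrefl: "x \<notin> far x"
  and far_sym: "y \<in> far x \<Longrightarrow> x \<in> far y"
  and farD: "y \<in> far x \<Longrightarrow> z \<in> \<Gamma> x \<Longrightarrow> z \<in> \<Gamma> y \<Longrightarrow> False"
  by (auto simp: far_def)

lemma far_sym_iff: "y \<in> far x \<longleftrightarrow> x \<in> far y"
  using far_sym by blast

lemma finite_far [simp]: "finite (far x)"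
  using finite_V far_V finite_subset by blast

lemma common_nbr:
  assumes "x \<in> V" "y \<in> V" "x \<noteq> y" "y \<notin> far x"
  obtains z where "z \<in> \<Gamma> x" "z \<in> \<Gamma> y"
  using assms by (auto simp: far_def)

lemma card_far:
  assumes x: "x \<in> V"
  shows "card (far x) = e"
proof -
  let ?U = "\<Union>u\<in>\<Gamma> x. \<Gamma> u - {x}"
  have V: "V = insert x (?U \<union> far x)"
    using x nbrs_V by (auto simp: far_def sym_iff)
  have "?U \<inter> far x = {}" by (auto simp: far_def sym_iff)
  moreover have "card ?U = d * (d - 1)"
    using x regular nbr_in_V(1) unfolding card_two_step by simp
  moreover have "x \<notin> ?U \<union> far x" by (auto simp: far_irrefl)
  moreover have "finite ?U" by auto
  ultimately have "card V = 1 + (d * (d - 1) + card (far x))"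
    by (subst V) (simp add: card_Un_disjoint)
  then show ?thesis using card_V by simp
qed

text \<open>
  The matrix equation \<open>A\<^sup>2 = (d - 1) I + J - B\<close>, entry by entry.
\<close>
lemma card_common:
  assumes "x \<in> V" "y \<in> V"
  shows "int (card (\<Gamma> x \<inter> \<Gamma> y)) =
    1 + (int d - 1) * of_bool (x = y) - of_bool (y \<in> far x)"
proof (cases "x = y")
  case True
  then show ?thesis using assms regular by (simp add: far_irrefl)
next
  case xy: False
  show ?thesis
  proof (cases "y \<in> far x")
    case True
    then show ?thesis using xy by (simp add: far_def)
  next
    case False
    then obtain z where z: "z \<in> \<Gamma> x" "z \<in> \<Gamma> y" using common_nbr assms xy by metis
    then have "\<Gamma> x \<inter> \<Gamma> y = {z}" using C4_free xy by blast
    then show ?thesis using xy False by simp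
  qed
qed

lemma sum_common:
  assumes "x \<in> V" "y \<in> V"
  shows "(\<Sum>z\<in>\<Gamma> x. int (card (\<Gamma> z \<inter> \<Gamma> y))) =
    int d + (int d - 1) * of_bool (y \<in> \<Gamma> x) - int (card (\<Gamma> x \<inter> far y))"
proof -
  have "(\<Sum>z\<in>\<Gamma> x. int (card (\<Gamma> z \<inter> \<Gamma> y))) =
      (\<Sum>z\<in>\<Gamma> x. 1 + (int d - 1) * of_bool (z = y) - of_bool (z \<in> far y))"
    using assms by (intro sum.cong refl) (simp add: card_common nbr_in_V far_sym_iff)
  also have "\<dots> = int (card (\<Gamma> x)) + (int d - 1) * (\<Sum>z\<in>\<Gamma> x. of_bool (z = y))
      - (\<Sum>z\<in>\<Gamma> x. of_bool (z \<in> far y))"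
    by (simp add: sum.distrib sum_subtractf sum_distrib_left)
  also have "(\<Sum>z\<in>\<Gamma> x. of_bool (z = y) :: int) = of_bool (y \<in> \<Gamma> x)"
    by (simp add: of_bool_def)
  also have "(\<Sum>z\<in>\<Gamma> x. of_bool (z \<in> far y) :: int) = int (card (\<Gamma> x \<inter> far y))"
    by (simp add: sum_of_bool_card Int_def)
  finally show ?thesis using assms regular by simp
qed

text \<open>
  The matrices \<open>A\<close> and \<open>B\<close> commute, because \<open>B\<close> is a polynomial in \<open>A\<close> and \<open>J\<close> and the graph is
  regular. Concretely, both sides count walks of length three between \<open>x\<close> and \<open>y\<close>, by the
  position of the step that is not covered by \<open>card_common\<close>. Nearly all local arguments below
  are instances of this identity.
\<close>
lemma exchange:
  assumes "x \<in> V" "y \<in> V"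
  shows "card (\<Gamma> x \<inter> far y) = card (far x \<inter> \<Gamma> y)"
proof -
  have "(\<Sum>z\<in>\<Gamma> x. card (\<Gamma> z \<inter> \<Gamma> y)) = card (SIGMA z:\<Gamma> x. \<Gamma> z \<inter> \<Gamma> y)"
    by simp
  also have "\<dots> = card (SIGMA z:\<Gamma> y. \<Gamma> z \<inter> \<Gamma> x)"
    by (rule bij_betw_same_card[of "\<lambda>(a, b). (b, a)"])
      (rule bij_betw_byWitness[of _ "\<lambda>(a, b). (b, a)"], auto intro: sym)
  also have "\<dots> = (\<Sum>z\<in>\<Gamma> y. card (\<Gamma> z \<inter> \<Gamma> x))"
    by simp
  finally have "(\<Sum>z\<in>\<Gamma> x. int (card (\<Gamma> z \<inter> \<Gamma> y))) = (\<Sum>z\<in>\<Gamma> y. int (card (\<Gamma> z \<inter> \<Gamma> x)))"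
    unfolding of_nat_sum[symmetric] by simp
  then show ?thesis
    using assms by (simp add: sum_common sym_iff[of x y] Int_commute)
qed

lemma exchange_nonempty:
  assumes "x \<in> V" "y \<in> V" "z \<in> \<Gamma> x" "z \<in> far y"
  obtains w where "w \<in> far x" "w \<in> \<Gamma> y"
proof -
  have "card (\<Gamma> x \<inter> far y) \<noteq> 0" using assms by auto
  then have "card (far x \<inter> \<Gamma> y) \<noteq> 0" using exchange assms by simp
  then show ?thesis using that by (metis Int_iff card.empty all_not_in_conv)
qed

text \<open>
  An edge that joins vertices with a common neighbour lies on exactly one triangle, so these
  neighbours of \<open>x\<close> are matched by the triangles at \<open>x\<close>.
\<close>
lemma even_triangle_nbrs:
  "even (card (\<Gamma> x - far x))"
proof (rule prime_dvd_card_free_action[OF two_is_prime_nat])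
  let ?r = "\<lambda>y. SOME z. z \<in> \<Gamma> x \<and> z \<in> \<Gamma> y"
  have r: "?r y \<in> \<Gamma> x \<and> ?r y \<in> \<Gamma> y" if "y \<in> \<Gamma> x - far x" for y
  proof -
    have "\<exists>z. z \<in> \<Gamma> x \<and> z \<in> \<Gamma> y"
      using that irrefl nbr_in_V by (metis DiffE common_nbr)
    then show ?thesis by (rule someI_ex)
  qed
  fix y assume y: "y \<in> \<Gamma> x - far x"
  then have y': "y \<in> \<Gamma> x" by simp
  show *: "?r y \<in> \<Gamma> x - far x"
    using r[OF y] y' by (auto dest: farD sym)
  have "?r (?r y) = y"
    using r[OF *] r[OF y] y' C4_free[of x "?r y" "?r (?r y)" y] by (metis irrefl sym)
  then show "(?r ^^ 2) y = y" by (simp add: numeral_2_eq_2)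
  show "?r y \<noteq> y" using r[OF y] irrefl by metis
qed simp

lemma parity_far_nbrs:
  assumes "x \<in> V"
  shows "even (card (\<Gamma> x \<inter> far x)) \<longleftrightarrow> even d"
proof -
  have "d = card (\<Gamma> x \<inter> far x) + card (\<Gamma> x - far x)"
    using regular[OF assms] card_Int_Diff[OF finite_nbrs, of x "far x"] by simp
  then show ?thesis using even_triangle_nbrs[of x] by presburger
qed

text \<open>
  If \<open>z\<close> were adjacent to and far from \<open>w\<close>, exchange would give a vertex \<open>u\<close> far from \<open>x\<close> and adjacent
  to \<open>z\<close>. As \<open>u\<close> is also a neighbour of \<open>x\<close>, the vertices \<open>x\<close>, \<open>u\<close>, \<open>z\<close>, \<open>w\<close> form a four-cycle.
\<close>
lemma far_subset_nbrsD:
  assumes x: "x \<in> V" and sub: "far x \<subseteq> \<Gamma> x" and w: "w \<in> \<Gamma> x - far x"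
  shows "\<Gamma> w \<inter> far w = {}"
proof (rule ccontr)
  assume "\<Gamma> w \<inter> far w \<noteq> {}"
  then obtain z where z: "z \<in> \<Gamma> w" "z \<in> far w" by blast
  have "w \<in> V" "z \<in> V" using w z far_in_V nbr_in_V by auto
  then obtain u where u: "u \<in> far x" "u \<in> \<Gamma> z"
    using exchange_nonempty[OF x, of z w] w far_sym[OF z(2)] by auto
  have "z \<noteq> x" using w z far_sym by auto
  then have "u = w" using C4_free[of z x u w] u sub w z sym by auto
  then show False using u w by simp
qed

lemma odd_degree_far_not_subset:
  assumes "odd d" "e < d" and x: "x \<in> V"
  shows "\<not> far x \<subseteq> \<Gamma> x"
proof
  assume sub: "far x \<subseteq> \<Gamma> x"
  have "card (far x) < card (\<Gamma> x)" using assms card_far regular by simp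
  then obtain w where w: "w \<in> \<Gamma> x - far x"
    using card_mono[OF finite_far, of "\<Gamma> x" x] by fastforce
  then have "\<Gamma> w \<inter> far w = {}" using far_subset_nbrsD x sub by blast
  moreover have "odd (card (\<Gamma> w \<inter> far w))"
    using parity_far_nbrs[of w] w assms nbr_in_V by auto
  ultimately show False by simp
qed

text \<open>
  The sum is the trace of \<open>A\<^sup>3\<close>, the number of closed walks of length three.
\<close>
lemma closed_3_walks_dvd: "3 dvd (\<Sum>x\<in>V. d - card (\<Gamma> x \<inter> far x))"
proof -
  define S where "S = (SIGMA x:V. SIGMA y:\<Gamma> x. \<Gamma> x \<inter> \<Gamma> y)"
  have fin: "finite S" unfolding S_def using finite_V by auto
  let ?r = "\<lambda>(x, y, z). (y, z, x)"
  have "3 dvd card S"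
  proof (rule prime_dvd_card_free_action[of 3 S ?r])
    fix t assume "t \<in> S"
    then obtain x y z where t: "t = (x, y, z)" "x \<in> V" "y \<in> \<Gamma> x" "z \<in> \<Gamma> x" "z \<in> \<Gamma> y"
      by (auto simp: S_def)
    then show "?r t \<in> S" "(?r ^^ 3) t = t" "?r t \<noteq> t"
      using nbr_in_V irrefl by (auto simp: S_def sym eval_nat_numeral)
  qed (use fin in auto)
  moreover have "card S = (\<Sum>x\<in>V. \<Sum>y\<in>\<Gamma> x. card (\<Gamma> x \<inter> \<Gamma> y))"
    using finite_V by (simp add: S_def)
  moreover have "(\<Sum>y\<in>\<Gamma> x. card (\<Gamma> x \<inter> \<Gamma> y)) = d - card (\<Gamma> x \<inter> far x)" if "x \<in> V" for x
  proof -
    have "int (\<Sum>y\<in>\<Gamma> x. card (\<Gamma> x \<inter> \<Gamma> y)) = int d - int (card (\<Gamma> x \<inter> far x))"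
      using sum_common[OF that that] irrefl by (simp add: Int_commute)
    then show ?thesis by linarith
  qed
  ultimately show ?thesis by simp
qed

end

lemma no_7_regular_graph_on_44: assumes "regular_C4_free_graph V \<Gamma> 7 1" shows False
proof -
  interpret regular_C4_free_graph V \<Gamma> 7 1 by fact
  have "V \<noteq> {}" using card_V by auto
  then obtain x where x: "x \<in> V" by blast
  have "card (\<Gamma> x \<inter> far x) \<noteq> 0" using parity_far_nbrs[OF x] by (metis even_zero odd_numeral)
  moreover obtain y where y: "far x = {y}" using card_far[OF x] by (auto simp: card_1_singleton_iff)
  ultimately have "far x \<subseteq> \<Gamma> x" by (cases "y \<in> \<Gamma> x") auto
  then show False using odd_degree_far_not_subset[OF _ _ x] by simp
qed

lemma no_9_regular_graph_on_76: assumes "regular_C4_free_graph V \<Gamma> 9 3" shows False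
proof -
  interpret regular_C4_free_graph V \<Gamma> 9 3 by fact
  have one: "card (\<Gamma> x \<inter> far x) = 1" if x: "x \<in> V" for x
  proof -
    have "odd (card (\<Gamma> x \<inter> far x))" using parity_far_nbrs[OF x] by simp
    moreover have "card (\<Gamma> x \<inter> far x) \<le> 3"
      using card_mono[OF finite_far Int_lower2] card_far[OF x] by metis
    moreover have "card (\<Gamma> x \<inter> far x) \<noteq> 3"
    proof
      assume "card (\<Gamma> x \<inter> far x) = 3"
      then have "\<Gamma> x \<inter> far x = far x"
        using card_far[OF x] by (intro card_subset_eq) auto
      then have "far x \<subseteq> \<Gamma> x" by blast
      then show False using odd_degree_far_not_subset[OF _ _ x] by simp
    qed
    ultimately show ?thesis by (auto simp: numeral_3_eq_3 le_Suc_eq)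
  qed
  show False using closed_3_walks_dvd one card_V by simp
qed

section \<open>Degree six on 33 vertices: the cycles of far vertices\<close>

text \<open>
  Here \<open>far\<close> is a 2-regular relation, that is, a disjoint union of cycles of length at least three.
\<close>
locale hexavalent_graph = regular_C4_free_graph V \<Gamma> 6 2 for V :: "'a set" and \<Gamma>
begin

definition chord_centres :: "'a set" where
  "chord_centres = {z \<in> V. \<exists>p q. far z = {p, q} \<and> q \<in> \<Gamma> p}"

lemma card_V_33: "card V = 33"
  using card_V by simp

lemma far_pair:
  assumes "y \<in> far x"
  obtains z where "far x = {y, z}" "y \<noteq> z"
proof -
  have "card (far x) = 2" using card_far assms far_in_V by auto
  then obtain a b where "far x = {a, b}" "a \<noteq> b" by (auto simp: card_2_iff)
  then show ?thesis using that assms by (cases "y = a") auto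
qed

text \<open>
  By parity a vertex is adjacent to none or both of its far vertices.
\<close>
lemma far_nbrs_subset:
  assumes "y \<in> far x" "y \<in> \<Gamma> x"
  shows "far x \<subseteq> \<Gamma> x"
proof -
  have x: "x \<in> V" using assms far_in_V by blast
  obtain z where z: "far x = {y, z}" "y \<noteq> z" using far_pair assms by blast
  have "even (card (\<Gamma> x \<inter> far x))" using parity_far_nbrs[OF x] by simp
  moreover have "\<Gamma> x \<inter> far x = (if z \<in> \<Gamma> x then {y, z} else {y})" using z assms by auto
  ultimately have "z \<in> \<Gamma> x" by (auto split: if_splits)
  then show ?thesis using z assms by simp
qed

text \<open>
  An entry of \<open>A\<^sup>4 = (5 I + J - B)\<^sup>2 = 25 I + 39 J - 10 B + B\<^sup>2\<close> off the diagonal.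
\<close>
lemma sum_common_sq:
  assumes "x \<in> V" "y \<in> V" "x \<noteq> y"
  shows "(\<Sum>z\<in>V. int (card (\<Gamma> x \<inter> \<Gamma> z)) * int (card (\<Gamma> z \<inter> \<Gamma> y))) =
    39 - 10 * of_bool (y \<in> far x) + int (card (far x \<inter> far y))"
proof -
  have "(\<Sum>z\<in>V. int (card (\<Gamma> x \<inter> \<Gamma> z)) * int (card (\<Gamma> z \<inter> \<Gamma> y))) =
    (\<Sum>z\<in>V. 1 + 5 * of_bool (z = x) + 5 * of_bool (z = y) - of_bool (z \<in> far x) - of_bool (z \<in> far y)
      - 5 * of_bool (z = x \<and> y \<in> far x) - 5 * of_bool (z = y \<and> y \<in> far x)
      + of_bool (z \<in> far x \<and> z \<in> far y))"
  proof (intro sum.cong refl)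
    fix z assume z: "z \<in> V"
    show "int (card (\<Gamma> x \<inter> \<Gamma> z)) * int (card (\<Gamma> z \<inter> \<Gamma> y)) =
      1 + 5 * of_bool (z = x) + 5 * of_bool (z = y) - of_bool (z \<in> far x) - of_bool (z \<in> far y)
      - 5 * of_bool (z = x \<and> y \<in> far x) - 5 * of_bool (z = y \<and> y \<in> far x)
      + of_bool (z \<in> far x \<and> z \<in> far y)"
      using z assms far_irrefl far_sym_iff[of x y] far_sym_iff[of y z]
      by (auto simp: card_common)
  qed
  also have "\<dots> = 33 + 5 + 5 - 2 - 2 - 10 * of_bool (y \<in> far x) + int (card (far x \<inter> far y))"
  proof -
    have "(\<Sum>z\<in>V. of_bool (z = x) :: int) = 1" "(\<Sum>z\<in>V. of_bool (z = y) :: int) = 1"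
      using assms finite_V by (auto simp: of_bool_def)
    moreover have "(\<Sum>z\<in>V. of_bool (z = x \<and> y \<in> far x) :: int) = of_bool (y \<in> far x)"
      "(\<Sum>z\<in>V. of_bool (z = y \<and> y \<in> far x) :: int) = of_bool (y \<in> far x)"
      using assms finite_V by (auto simp: of_bool_def)
    moreover have "(\<Sum>z\<in>V. of_bool (z \<in> far v) :: int) = 2" if "v \<in> V" for v
    proof -
      have "V \<inter> far v = far v" using far_V by auto
      then show ?thesis using card_far[OF that] finite_V by (simp add: sum_of_bool_card Int_def[symmetric])
    qed
    moreover have "(\<Sum>z\<in>V. of_bool (z \<in> far x \<and> z \<in> far y) :: int) = int (card (far x \<inter> far y))"
    proof -
      have "{z \<in> V. z \<in> far x \<and> z \<in> far y} = far x \<inter> far y" using far_V by auto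
      then show ?thesis using sum_of_bool_card[OF finite_V] by metis
    qed
    ultimately show ?thesis
      using assms card_V_33
      by (simp add: sum.distrib sum_subtractf sum_distrib_left[symmetric])
  qed
  finally show ?thesis by simp
qed

text \<open>
  The trace of \<open>A B\<^sup>2\<close>: a vertex contributes the ordered adjacent pairs among its far vertices.
\<close>
lemma card_far_far_adjacent:
  "(\<Sum>x\<in>V. \<Sum>y\<in>\<Gamma> x. card (far x \<inter> far y)) = 2 * card chord_centres"
proof -
  have "(\<Sum>x\<in>V. \<Sum>y\<in>\<Gamma> x. card (far x \<inter> far y)) =
      card (SIGMA x:V. SIGMA y:\<Gamma> x. far x \<inter> far y)"
    using finite_V by simp
  also have "\<dots> = card (SIGMA z:V. SIGMA x:far z. far z \<inter> \<Gamma> x)"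
    by (rule bij_betw_same_card[of "\<lambda>(x, y, z). (z, x, y)"],
        rule bij_betw_byWitness[of _ "\<lambda>(z, x, y). (x, y, z)"])
      (auto dest: far_in_V far_sym)
  also have "\<dots> = (\<Sum>z\<in>V. \<Sum>x\<in>far z. card (far z \<inter> \<Gamma> x))"
    using finite_V by simp
  also have "\<dots> = (\<Sum>z\<in>V. if z \<in> chord_centres then 2 else 0)"
  proof (intro sum.cong refl)
    fix z assume z: "z \<in> V"
    then obtain p q where pq: "far z = {p, q}" "p \<noteq> q"
      using card_far[OF z] by (auto simp: card_2_iff)
    have "z \<in> chord_centres \<longleftrightarrow> q \<in> \<Gamma> p"
      using z pq sym by (auto simp: chord_centres_def doubleton_eq_iff)
    moreover have "{p, q} \<inter> \<Gamma> p = (if q \<in> \<Gamma> p then {q} else {})"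
      "{p, q} \<inter> \<Gamma> q = (if q \<in> \<Gamma> p then {p} else {})"
      using irrefl sym by auto
    ultimately show "(\<Sum>x\<in>far z. card (far z \<inter> \<Gamma> x)) = (if z \<in> chord_centres then 2 else 0)"
      using pq by simp
  qed
  also have "\<dots> = 2 * card chord_centres"
  proof -
    have "V \<inter> chord_centres = chord_centres" by (auto simp: chord_centres_def)
    then show ?thesis using finite_V by (simp add: sum.If_cases)
  qed
  finally show ?thesis .
qed

text \<open>
  The number of closed walks of length five is \<open>tr (A \<cdot> A\<^sup>4) = 39 \<cdot> 198 - 10 tr (A B) + tr (A B\<^sup>2)\<close>,
  and it is divisible by five.
\<close>
lemma card_chord_centres_mod_5: "card chord_centres mod 5 = 4"
proof -
  define S where "S = (SIGMA x:V. SIGMA y:\<Gamma> x. SIGMA z:V. (\<Gamma> x \<inter> \<Gamma> z) \<times> (\<Gamma> z \<inter> \<Gamma> y))"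
  have fin: "finite S" unfolding S_def using finite_V by auto
  let ?r = "\<lambda>(x, y, z, a, b). (y, b, a, x, z)"
  have "5 dvd card S"
  proof (rule prime_dvd_card_free_action[of 5 S ?r])
    fix t assume "t \<in> S"
    then obtain x y z a b where t: "t = (x, y, z, a, b)" "x \<in> V" "y \<in> \<Gamma> x" "z \<in> V"
      "a \<in> \<Gamma> x" "a \<in> \<Gamma> z" "b \<in> \<Gamma> z" "b \<in> \<Gamma> y"
      by (auto simp: S_def)
    then show "?r t \<in> S" "(?r ^^ 5) t = t" "?r t \<noteq> t"
      using nbr_in_V irrefl by (auto simp: S_def sym eval_nat_numeral)
  qed (use fin in auto)
  moreover have "card S = (\<Sum>x\<in>V. \<Sum>y\<in>\<Gamma> x. \<Sum>z\<in>V. card (\<Gamma> x \<inter> \<Gamma> z) * card (\<Gamma> z \<inter> \<Gamma> y))"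
    using finite_V by (simp add: S_def card_cartesian_product)
  moreover have "int (\<Sum>x\<in>V. \<Sum>y\<in>\<Gamma> x. \<Sum>z\<in>V. card (\<Gamma> x \<inter> \<Gamma> z) * card (\<Gamma> z \<inter> \<Gamma> y)) =
      (\<Sum>x\<in>V. \<Sum>y\<in>\<Gamma> x. 39 - 10 * of_bool (y \<in> far x) + int (card (far x \<inter> far y)))"
    unfolding of_nat_sum of_nat_mult
  proof (intro sum.cong refl)
    fix x y assume "x \<in> V" "y \<in> \<Gamma> x"
    then show "(\<Sum>z\<in>V. int (card (\<Gamma> x \<inter> \<Gamma> z)) * int (card (\<Gamma> z \<inter> \<Gamma> y))) =
        39 - 10 * of_bool (y \<in> far x) + int (card (far x \<inter> far y))"
      using irrefl nbr_in_V by (intro sum_common_sq) auto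
  qed
  moreover have "\<dots> = 7722 - 10 * (\<Sum>x\<in>V. \<Sum>y\<in>\<Gamma> x. of_bool (y \<in> far x)) + int (2 * card chord_centres)"
    unfolding card_far_far_adjacent[symmetric]
    using regular card_V_33
    by (simp add: sum.distrib sum_subtractf sum_distrib_left[symmetric])
  ultimately have "int (card S) = 7722 - 10 * (\<Sum>x\<in>V. \<Sum>y\<in>\<Gamma> x. of_bool (y \<in> far x)) + int (2 * card chord_centres)"
    by (simp only:)
  with \<open>5 dvd card S\<close> show ?thesis by presburger
qed

text \<open>
  A cycle of farness is unrolled to a sequence indexed by all integers, which makes shifts and
  reflections total.
\<close>
definition far_walk :: "(int \<Rightarrow> 'a) \<Rightarrow> bool" where
  "far_walk c \<longleftrightarrow> (\<forall>k. far (c k) = {c (k - 1), c (k + 1)})"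

lemma far_walkD: "far_walk c \<Longrightarrow> far (c k) = {c (k - 1), c (k + 1)}"
  by (simp add: far_walk_def)

lemma far_walk_V: "far_walk c \<Longrightarrow> c k \<in> V"
  using far_walkD[of c k] far_in_V by blast

lemma far_walk_neq: "far_walk c \<Longrightarrow> c (k - 1) \<noteq> c (k + 1)"
  using far_walkD[of c k] card_far[OF far_walk_V, of c k] by (auto simp: card_insert_if)

lemma far_walk_shift: "far_walk c \<Longrightarrow> far_walk (\<lambda>k. c (k + a))"
  by (simp add: far_walk_def algebra_simps)

lemma far_walk_rev: "far_walk c \<Longrightarrow> far_walk (\<lambda>k. c (a - k))"
  unfolding far_walk_def by (simp add: algebra_simps insert_commute)

lemma far_walk_unique:
  assumes c: "far_walk c" and c': "far_walk c'" and eq: "c i = c' i" "c (i + 1) = c' (i + 1)"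
  shows "c k = c' k"
proof -
  have "c k = c' k \<and> c (k + 1) = c' (k + 1)"
  proof (induction k rule: int_induct[of _ i])
    case base
    then show ?case using eq by simp
  next
    case (step1 k)
    have "{c k, c (k + 2)} = {c' k, c' (k + 2)}"
      using step1 far_walkD[OF c, of "k + 1"] far_walkD[OF c', of "k + 1"] by (simp add: algebra_simps)
    moreover have "c k \<noteq> c (k + 2)" using far_walk_neq[OF c, of "k + 1"] by (simp add: algebra_simps)
    ultimately show ?case using step1 by (auto simp: doubleton_eq_iff algebra_simps)
  next
    case (step2 k)
    have "{c (k - 1), c (k + 1)} = {c' (k - 1), c' (k + 1)}"
      using step2 far_walkD[OF c, of "k"] far_walkD[OF c', of "k"] by simp
    moreover have "c (k - 1) \<noteq> c (k + 1)" using far_walk_neq[OF c, of k] by simp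
    ultimately show ?case using step2 by (auto simp: doubleton_eq_iff)
  qed
  then show ?thesis by simp
qed

lemma far_ray:
  assumes "y \<in> far x"
  shows "\<exists>g::nat \<Rightarrow> 'a. g 0 = x \<and> g 1 = y \<and> (\<forall>n. far (g (Suc n)) = {g n, g (Suc (Suc n))})"
proof -
  have "\<exists>f::nat \<Rightarrow> 'a \<times> 'a. \<forall>n. (snd (f n) \<in> far (fst (f n)) \<and> (n = 0 \<longrightarrow> f n = (x, y))) \<and>
      (fst (f (Suc n)) = snd (f n) \<and> far (snd (f n)) = {fst (f n), snd (f (Suc n))})"
  proof (rule dependent_nat_choice)
    show "\<exists>s. snd s \<in> far (fst s) \<and> (0 = 0 \<longrightarrow> s = (x, y))" using assms by auto
    fix s :: "'a \<times> 'a" and n :: nat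
    assume "snd s \<in> far (fst s) \<and> (n = 0 \<longrightarrow> s = (x, y))"
    then obtain z where "far (snd s) = {fst s, z}" using far_pair far_sym by metis
    then show "\<exists>t. (snd t \<in> far (fst t) \<and> (Suc n = 0 \<longrightarrow> t = (x, y))) \<and>
        fst t = snd s \<and> far (snd s) = {fst s, snd t}"
      by (intro exI[of _ "(snd s, z)"]) auto
  qed
  then obtain f :: "nat \<Rightarrow> 'a \<times> 'a" where f: "f 0 = (x, y)" "\<And>n. fst (f (Suc n)) = snd (f n)"
    "\<And>n. far (snd (f n)) = {fst (f n), snd (f (Suc n))}" by blast
  show ?thesis
    by (intro exI[of _ "fst \<circ> f"]) (simp add: f)
qed

lemma far_walk_exists:
  assumes "x \<in> V"
  obtains c where "far_walk c" "c 0 = x"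
proof -
  obtain p q where pq: "far x = {p, q}" using card_far[OF assms] by (auto simp: card_2_iff)
  obtain g where g: "g 0 = x" "g 1 = p" "\<And>n. far (g (Suc n)) = {g n, g (Suc (Suc n))}"
    using far_ray[of p x] pq by auto
  obtain h where h: "h 0 = x" "h 1 = q" "\<And>n. far (h (Suc n)) = {h n, h (Suc (Suc n))}"
    using far_ray[of q x] pq by auto
  define c where "c k = (if 0 \<le> k then g (nat k) else h (nat (- k)))" for k
  have "far (c k) = {c (k - 1), c (k + 1)}" for k
  proof -
    consider "k = 0" | n where "k = int (Suc n)" | n where "k = - int (Suc n)"
      by (metis int_cases3 not0_implies_Suc of_nat_0_less_iff less_numeral_extra(3))
    then show ?thesis
    proof cases
      case 1
      then show ?thesis using pq g h by (auto simp: c_def)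
    next
      case 2
      then have "c k = g (Suc n)" "c (k - 1) = g n" "c (k + 1) = g (Suc (Suc n))"
        by (auto simp: c_def nat_add_distrib)
      then show ?thesis using g by simp
    next
      case 3
      then have "c k = h (Suc n)" "c (k - 1) = h (Suc (Suc n))"
        by (auto simp: c_def nat_add_distrib)
      moreover have "c (k + 1) = h n"
        using 3 g h by (cases "n = 0") (auto simp: c_def)
      ultimately show ?thesis using h by auto
    qed
  qed
  then have "far_walk c" by (simp add: far_walk_def)
  moreover have "c 0 = x" using g by (simp add: c_def)
  ultimately show ?thesis by (rule that)
qed

lemma far_walk_translate:
  assumes c: "far_walk c" and eq: "c i = c j" "c (i + 1) = c (j + 1)"
  shows "c (k + (j - i)) = c k"
  using far_walk_unique[OF c far_walk_shift[OF c, of "j - i"], of i k] eq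
  by (simp add: algebra_simps)

text \<open>
  The reflection would fix a vertex of the walk or an edge; but the steps on either side of a vertex
  differ, and no vertex is far from itself.
\<close>
lemma far_walk_no_reflection:
  assumes c: "far_walk c" and eq: "c i = c j" "c (i + 1) = c (j - 1)"
  shows False
proof -
  have refl: "c k = c (i + j - k)" for k
    using far_walk_unique[OF c far_walk_rev[OF c, of "i + j"], of i k] eq
    by (simp add: algebra_simps)
  show False
  proof (cases "even (i + j)")
    case True
    then obtain m where m: "i + j = 2 * m" by blast
    then show False using refl[of "m + 1"] far_walk_neq[OF c, of m] by simp
  next
    case False
    then obtain m where m: "i + j = 2 * m + 1" by (metis oddE)
    then have "c (m + 1) = c m" using refl[of "m + 1"] by simp
    then show False using far_walkD[OF c, of m] far_irrefl[of "c m"] by auto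
  qed
qed

lemma far_walk_period:
  assumes c: "far_walk c"
  shows "\<exists>l\<ge>3. \<forall>i j. c i = c j \<longleftrightarrow> l dvd (i - j)"
proof -
  define per where "per m \<longleftrightarrow> 0 < m \<and> (\<forall>k. c (k + m) = c k)" for m
  have "\<not> inj_on (\<lambda>k. (c k, c (k + 1))) UNIV"
  proof
    assume "inj_on (\<lambda>k. (c k, c (k + 1))) UNIV"
    moreover have "range (\<lambda>k. (c k, c (k + 1))) \<subseteq> V \<times> V" using far_walk_V[OF c] by auto
    ultimately have "finite (UNIV :: int set)"
      using finite_V by (meson finite_SigmaI finite_imageD finite_subset)
    then show False by (simp add: infinite_UNIV_int)
  qed
  then obtain i j where ij: "i \<noteq> j" "c i = c j" "c (i + 1) = c (j + 1)"
    by (auto simp: inj_on_def)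
  have "\<exists>m. per (int m)"
  proof (cases "i < j")
    case True
    then have "per (j - i)" using far_walk_translate[OF c] ij by (auto simp: per_def)
    then show ?thesis using True by (intro exI[of _ "nat (j - i)"]) auto
  next
    case False
    then have "per (i - j)" using far_walk_translate[OF c, of j i] ij by (auto simp: per_def)
    then show ?thesis using False ij by (intro exI[of _ "nat (i - j)"]) auto
  qed
  define n where "n = (LEAST m. per (int m))"
  have n: "per (int n)" "\<And>m. per (int m) \<Longrightarrow> n \<le> m"
    using LeastI_ex[OF \<open>\<exists>m. per (int m)\<close>] Least_le[of "\<lambda>m. per (int m)"]
    by (simp_all add: n_def)
  define l where "l = int n"
  have l: "0 < l" "\<And>k. c (k + l) = c k" using n by (auto simp: l_def per_def)
  have mult: "c (k + l * m) = c k" for k m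
  proof (induction m rule: int_induct[of _ 0])
    case (step1 m)
    then show ?case using l(2)[of "k + l * m"] by (simp add: algebra_simps)
  next
    case (step2 m)
    then show ?case using l(2)[of "k + l * (m - 1)"] by (simp add: algebra_simps)
  qed simp
  have iff: "c i = c j \<longleftrightarrow> l dvd (i - j)" for i j
  proof
    assume "l dvd (i - j)"
    then obtain m where "i = j + l * m" by (metis dvdE add_diff_cancel_left' diff_add_cancel add.commute)
    then show "c i = c j" using mult by simp
  next
    assume eq: "c i = c j"
    then have "{c (i - 1), c (i + 1)} = {c (j - 1), c (j + 1)}"
      using far_walkD[OF c] by metis
    then have "c (i + 1) = c (j + 1)"
      using far_walk_no_reflection[OF c eq] by (auto simp: doubleton_eq_iff)
    then have tr: "c (k + (j - i)) = c k" for k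
      using far_walk_translate[OF c eq] by simp
    define r where "r = (j - i) mod l"
    have "j - i = r + l * ((j - i) div l)" by (simp add: r_def)
    then have r: "c (k + r) = c k" for k
      using tr[of k] mult[of "k + r" "(j - i) div l"] by (metis add.assoc)
    moreover have "0 \<le> r" "r < l" using l by (auto simp: r_def)
    moreover have "\<not> 0 < r"
    proof
      assume "0 < r"
      then have "per (int (nat r))" using r by (simp add: per_def)
      then show False using n(2)[of "nat r"] \<open>0 < r\<close> \<open>r < l\<close> by (simp add: l_def)
    qed
    ultimately have "l dvd j - i" by (simp add: r_def dvd_eq_mod_eq_0)
    then show "l dvd i - j" by (simp add: dvd_diff_commute)
  qed
  have "l \<noteq> 1"
  proof
    assume "l = 1"
    then have "c 0 = c 1" using iff[of 0 1] by simp
    then show False using far_walkD[OF c, of 0] far_irrefl[of "c 0"] by simp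
  qed
  moreover have "l \<noteq> 2"
  proof
    assume "l = 2"
    then have "c (0 - 1) = c (0 + 1)" using iff[of "0 - 1" "0 + 1"] by simp
    then show False using far_walk_neq[OF c, of 0] by simp
  qed
  ultimately have "3 \<le> l" using l by simp
  then show ?thesis using iff by blast
qed

text \<open>
  Commutation applied to the indicator vector of a union \<open>Z\<close> of cycles, which is an eigenvector of
  \<open>B\<close> for the eigenvalue 2.
\<close>
lemma sum_far_degree:
  assumes x: "x \<in> V" and Z: "Z \<subseteq> V" "\<And>z. z \<in> Z \<Longrightarrow> far z \<subseteq> Z"
  shows "(\<Sum>w\<in>far x. card (\<Gamma> w \<inter> Z)) = 2 * card (\<Gamma> x \<inter> Z)"
proof -
  have fin: "finite Z" using Z finite_V finite_subset by blast
  have "(\<Sum>w\<in>far x. card (\<Gamma> w \<inter> Z)) = card (SIGMA w:far x. \<Gamma> w \<inter> Z)"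
    by simp
  also have "\<dots> = card (SIGMA z:Z. far x \<inter> \<Gamma> z)"
    by (rule bij_betw_same_card[of "\<lambda>(a, b). (b, a)"],
        rule bij_betw_byWitness[of _ "\<lambda>(a, b). (b, a)"]) (auto intro: sym)
  also have "\<dots> = (\<Sum>z\<in>Z. card (far x \<inter> \<Gamma> z))" using fin by simp
  also have "\<dots> = (\<Sum>z\<in>Z. card (\<Gamma> x \<inter> far z))" using exchange x Z by (intro sum.cong) auto
  also have "\<dots> = card (SIGMA z:Z. \<Gamma> x \<inter> far z)" using fin by simp
  also have "\<dots> = card (SIGMA y:\<Gamma> x \<inter> Z. far y)"
    using Z by (intro bij_betw_same_card[of "\<lambda>(a, b). (b, a)"],
        intro bij_betw_byWitness[of _ "\<lambda>(a, b). (b, a)"]) (auto intro: far_sym)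
  also have "\<dots> = (\<Sum>y\<in>\<Gamma> x \<inter> Z. card (far y))" by simp
  also have "\<dots> = (\<Sum>y\<in>\<Gamma> x \<inter> Z. 2)" using card_far Z(1) by (intro sum.cong) auto
  also have "\<dots> = 2 * card (\<Gamma> x \<inter> Z)" by simp
  finally show ?thesis .
qed

text \<open>
  Along a walk the degree into \<open>Z\<close> is an arithmetic progression by \<open>sum_far_degree\<close>, and it is bounded.
  So the partition into the cycles of farness is equitable.
\<close>
lemma degree_constant:
  assumes c: "far_walk c" and Z: "Z \<subseteq> V" "\<And>z. z \<in> Z \<Longrightarrow> far z \<subseteq> Z"
  shows "card (\<Gamma> (c j) \<inter> Z) = card (\<Gamma> (c k) \<inter> Z)"
proof -
  define f where "f k = int (card (\<Gamma> (c k) \<inter> Z))" for k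
  have rec: "f (k - 1) + f (k + 1) = 2 * f k" for k
    using sum_far_degree[OF far_walk_V[OF c] Z, of k] far_walk_neq[OF c, of k]
    unfolding far_walkD[OF c] f_def by simp
  have lin: "f k = f 0 + k * (f 1 - f 0) \<and> f (k + 1) = f 0 + (k + 1) * (f 1 - f 0)" for k
  proof (induction k rule: int_induct[of _ 0])
    case (step1 k)
    then show ?case using rec[of "k + 1"] by (simp add: algebra_simps)
  next
    case (step2 k)
    then show ?case using rec[of k] by (simp add: algebra_simps)
  qed simp
  have bound: "0 \<le> f k \<and> f k \<le> 6" for k
    using card_mono[OF finite_nbrs, of "\<Gamma> (c k) \<inter> Z" "c k"] regular[OF far_walk_V[OF c], of k]
    by (simp add: f_def)
  (* Degrees lie between 0 and 6, so seven steps in both directions rule out a nonzero slope. *)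
  have "f 7 = f 0 + 7 * (f 1 - f 0)" "f (- 7) = f 0 - 7 * (f 1 - f 0)"
    using lin[of 7] lin[of "-7"] by simp_all
  then have "7 * (f 1 - f 0) \<le> 6" "7 * (f 1 - f 0) \<ge> - 6"
    using bound[of 7] bound[of "-7"] bound[of 0] by linarith+
  then have "f 1 = f 0" by presburger
  then have "f k = f 0" for k using lin[of k] by simp
  then have "f j = f k" by metis
  then show ?thesis by (simp add: f_def)
qed

end

section \<open>Chords of a cycle of far vertices\<close>

context hexavalent_graph begin

text \<open>
  The cycles that are filled by the vertices counted in \<open>card_chord_centres_mod_5\<close>.
\<close>
definition chord_walk :: "(int \<Rightarrow> 'a) \<Rightarrow> bool" where
  "chord_walk c \<longleftrightarrow> far_walk c \<and> (\<forall>k. c (k + 1) \<in> \<Gamma> (c (k - 1)))"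

lemma chord_walk_far_walk: "chord_walk c \<Longrightarrow> far_walk c"
  by (simp add: chord_walk_def)

lemma chord_walkD: "chord_walk c \<Longrightarrow> c (k + 2) \<in> \<Gamma> (c k)" "chord_walk c \<Longrightarrow> c (k - 2) \<in> \<Gamma> (c k)"
proof -
  assume "chord_walk c"
  then have "c (k + 1 + 1) \<in> \<Gamma> (c (k + 1 - 1))" "c (k - 1 + 1) \<in> \<Gamma> (c (k - 1 - 1))"
    unfolding chord_walk_def by blast+
  moreover have "k + 1 + 1 = k + 2" "k + 1 - 1 = k" "k - 1 + 1 = k" "k - 1 - 1 = k - 2" by simp_all
  ultimately show "c (k + 2) \<in> \<Gamma> (c k)" "c (k - 2) \<in> \<Gamma> (c k)"
    using sym by metis+
qed

text \<open>
  One chord forces the next one, so that a single adjacency between the two far vertices of a vertex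
  propagates around the whole cycle.
\<close>
lemma chord_step:
  assumes c: "far_walk c" and chord: "c (k + 1) \<in> \<Gamma> (c (k - 1))"
  shows "c (k + 2) \<in> \<Gamma> (c k)"
proof -
  have "c (k - 1) \<in> \<Gamma> (c (k + 1))" "c (k - 1) \<in> far (c k)"
    using sym[OF chord] far_walkD[OF c] by auto
  then obtain w where "w \<in> far (c (k + 1))" "w \<in> \<Gamma> (c k)"
    using exchange_nonempty far_walk_V[OF c] by metis
  moreover have "far (c (k + 1)) = {c k, c (k + 2)}"
    using far_walkD[OF c, of "k + 1"] by (simp add: algebra_simps)
  ultimately show ?thesis using irrefl by auto
qed

lemma chord_walkI:
  assumes c: "far_walk c" and chord: "c 1 \<in> \<Gamma> (c (- 1))"
  shows "chord_walk c"
proof -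
  have "c (k + 1) \<in> \<Gamma> (c (k - 1))" for k
  proof (induction k rule: int_induct[of _ 0])
    case base
    then show ?case using chord by simp
  next
    case (step1 k)
    then show ?case using chord_step[OF c, of k] by (simp add: algebra_simps)
  next
    case (step2 k)
    have "c (- (- k + 1)) \<in> \<Gamma> (c (- (- k - 1)))"
      using sym[OF step2(2)] by (simp add: algebra_simps)
    then have "c (- (- k + 2)) \<in> \<Gamma> (c (- (- k)))"
      using chord_step[OF far_walk_rev[OF c, of 0], of "- k"] by simp
    from sym[OF this] show ?case by (simp add: algebra_simps)
  qed
  then show ?thesis using c by (simp add: chord_walk_def)
qed

text \<open>
  Exchange for two vertices of the same cycle is a discrete wave equation for the adjacencies inside
  the cycle.
\<close>
lemma chords_wave:
  assumes c: "far_walk c"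
  shows "(of_bool (c (k + (t - 1)) \<in> \<Gamma> (c k)) + of_bool (c (k + (t + 1)) \<in> \<Gamma> (c k)) :: nat) =
    of_bool (c (k - 1 + (t + 1)) \<in> \<Gamma> (c (k - 1))) + of_bool (c (k + 1 + (t - 1)) \<in> \<Gamma> (c (k + 1)))"
proof -
  have two: "card (\<Gamma> x \<inter> {p, q}) = of_bool (p \<in> \<Gamma> x) + of_bool (q \<in> \<Gamma> x)" if "p \<noteq> q" for x p q
    using that by auto
  have "card (\<Gamma> (c k) \<inter> far (c (k + t))) = card (far (c k) \<inter> \<Gamma> (c (k + t)))"
    using exchange far_walk_V[OF c] by blast
  moreover have "card (\<Gamma> (c k) \<inter> far (c (k + t))) =
      of_bool (c (k + t - 1) \<in> \<Gamma> (c k)) + of_bool (c (k + t + 1) \<in> \<Gamma> (c k))"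
    unfolding far_walkD[OF c] by (rule two[OF far_walk_neq[OF c]])
  moreover have "card (far (c k) \<inter> \<Gamma> (c (k + t))) =
      of_bool (c (k - 1) \<in> \<Gamma> (c (k + t))) + of_bool (c (k + 1) \<in> \<Gamma> (c (k + t)))"
    unfolding far_walkD[OF c] Int_commute[of "{_, _}"] by (rule two[OF far_walk_neq[OF c]])
  ultimately show ?thesis
    using sym_iff[of "c (k - 1)" "c (k + t)"] sym_iff[of "c (k + 1)" "c (k + t)"]
    by (simp add: algebra_simps)
qed

text \<open>
  Adjacency inside a cycle is invariant under rotation. The wave equation carries this from distance
  \<open>t - 1\<close> to \<open>t + 1\<close>; distance 0 is trivial, and distance 1 is \<open>far_nbrs_subset\<close>.
\<close>
lemma chords_rotate_nat:
  assumes c: "far_walk c"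
  shows "c (k + int t) \<in> \<Gamma> (c k) \<longleftrightarrow> c (j + int t) \<in> \<Gamma> (c j)"
proof (induction t arbitrary: k j rule: nat_less_induct)
  case (1 t)
  consider "t = 0" | "t = 1" | s where "t = Suc (Suc s)"
    by (metis One_nat_def not0_implies_Suc)
  then show ?case
  proof cases
    case 1
    then show ?thesis using irrefl by simp
  next
    case 2
    have "c (k + 1) \<in> \<Gamma> (c k) \<longleftrightarrow> c (k - 1 + 1) \<in> \<Gamma> (c (k - 1))" for k
      using far_nbrs_subset[of "c (k - 1)" "c k"] far_nbrs_subset[of "c (k + 1)" "c k"]
        far_walkD[OF c, of k] sym_iff[of "c k" "c (k - 1)"] by auto
    then show ?thesis
      using int_const[of "\<lambda>k. c (k + 1) \<in> \<Gamma> (c k)" k j] 2 by simp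
  next
    case 3
    have IH: "c (k + int s) \<in> \<Gamma> (c k) \<longleftrightarrow> c (j + int s) \<in> \<Gamma> (c j)" for k j
      using 1 3 by simp
    have "c (k + int t) \<in> \<Gamma> (c k) \<longleftrightarrow> c (k - 1 + int t) \<in> \<Gamma> (c (k - 1))" for k
    proof -
      have t: "int s + 1 - 1 = int s" "int s + 1 + 1 = int t" using 3 by auto
      show ?thesis
        using chords_wave[OF c, of k "int s + 1"] IH[of k "k + 1"] unfolding t
        by (auto simp: of_bool_def split: if_splits)
    qed
    then show ?thesis
      using int_const[of "\<lambda>k. c (k + int t) \<in> \<Gamma> (c k)" k j] by simp
  qed
qed

lemma chords_rotate:
  assumes c: "far_walk c" and "c (k + t) \<in> \<Gamma> (c k)"
  shows "c (j + t) \<in> \<Gamma> (c j)"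
proof (cases "0 \<le> t")
  case True
  then show ?thesis using chords_rotate_nat[OF c, of k "nat t" j] assms by simp
next
  case False
  then have "c (k + t + int (nat (- t))) \<in> \<Gamma> (c (k + t))" using sym[OF assms(2)] by simp
  then have "c (j + t + int (nat (- t))) \<in> \<Gamma> (c (j + t))" using chords_rotate_nat[OF c] by blast
  from sym[OF this] show ?thesis using False by simp
qed

text \<open>
  A further chord, of length \<open>s\<close>, would close the four-cycle \<open>k\<close>, \<open>k + 2\<close>, \<open>k + s + 2\<close>, \<open>k + s\<close>.
\<close>
lemma chord_walk_nbrs:
  assumes c: "chord_walk c" and t: "c t \<in> \<Gamma> (c k)"
  shows "c t = c (k + 2) \<or> c t = c (k - 2)"
proof -
  note c' = chord_walk_far_walk[OF c]
  obtain l where l: "\<And>i j. c i = c j \<longleftrightarrow> l dvd (i - j)"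
    using far_walk_period[OF c'] by metis
  have "c (k + 2 + (t - k)) \<in> \<Gamma> (c (k + 2))"
    by (rule chords_rotate[OF c', of k "t - k"]) (use t in simp)
  moreover have "k + 2 + (t - k) = t + 2" by simp
  ultimately have "c (k + 2) \<in> \<Gamma> (c (t + 2))" using sym by metis
  moreover have "c t \<in> \<Gamma> (c (t + 2))" "c (k + 2) \<in> \<Gamma> (c k)"
    using sym[OF chord_walkD(1)[OF c, of t]] chord_walkD(1)[OF c] by auto
  ultimately have "c k = c (t + 2) \<or> c t = c (k + 2)"
    using C4_free[of "c k" "c (t + 2)" "c t" "c (k + 2)"] t by auto
  moreover have "c t = c (k - 2)" if "c k = c (t + 2)"
    using that unfolding l by (simp add: dvd_diff_commute algebra_simps)
  ultimately show ?thesis by blast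
qed

text \<open>
  For lengths 3 and 5 the chords give two far vertices a common neighbour, and in length 8 four chords
  form a four-cycle. In length 4 both far vertices of the apex over \<open>c 0\<close>, \<open>c 2\<close> would be
  common neighbours of \<open>c 1\<close> and \<open>c 3\<close>.
\<close>
lemma chord_walk_period_cases:
  assumes c: "chord_walk c" and l: "3 \<le> l" "\<And>i j. c i = c j \<longleftrightarrow> l dvd (i - j)"
  shows "6 \<le> l \<and> l \<noteq> 8"
proof -
  note c' = chord_walk_far_walk[OF c]
  have far: "c (k + 1) \<in> far (c k)" "c (k - 1) \<in> far (c k)" for k using far_walkD[OF c'] by auto
  note chord = chord_walkD[OF c]
  have "l \<noteq> 3"
  proof
    assume "l = 3"
    then have "c 2 = c (- 1)" using l(2)[of 2 "-1"] by simp
    then have "c 2 \<in> \<Gamma> (c 1)" using chord(2)[of 1] by simp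
    then show False using farD[OF far(1)[of 0], of "c 2"] chord(1)[of 0] by simp
  qed
  moreover have "l \<noteq> 4"
  proof
    assume l4: "l = 4"
    have c4: "c 4 = c 0" using l(2)[of 4 0] l4 by simp
    have "c 2 \<noteq> c 0" "c 2 \<noteq> c 1" "c 2 \<noteq> c (- 1)" using l(2) l4 by auto
    then have "c 2 \<notin> far (c 0)" using far_walkD[OF c', of 0] by simp
    then obtain u where u: "u \<in> \<Gamma> (c 0)" "u \<in> \<Gamma> (c 2)"
      using common_nbr[of "c 0" "c 2"] far_walk_V[OF c'] \<open>c 2 \<noteq> c 0\<close> by metis
    have u_V: "u \<in> V" using u nbr_in_V by blast
    have "far u \<subseteq> \<Gamma> (c k)" if "k = 1 \<or> k = 3" for k
    proof -
      have "far (c 1) = {c 0, c 2}" "far (c 3) = {c 2, c 4}"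
        using far_walkD[OF c', of 1] far_walkD[OF c', of 3] by simp_all
      then have "far (c k) = {c 0, c 2}" using that c4 by auto
      then have "\<Gamma> u \<inter> far (c k) = {c 0, c 2}" using sym[OF u(1)] sym[OF u(2)] by auto
      then have "card (far u \<inter> \<Gamma> (c k)) = 2"
        using exchange[OF u_V far_walk_V[OF c', of k]] \<open>c 2 \<noteq> c 0\<close> by simp
      then have "far u \<inter> \<Gamma> (c k) = far u"
        using card_far[OF u_V] by (intro card_subset_eq) auto
      then show ?thesis by blast
    qed
    moreover obtain p q where "far u = {p, q}" "p \<noteq> q"
      using card_far[OF u_V] by (auto simp: card_2_iff)
    moreover have "c 1 \<noteq> c 3" using l(2) l4 by auto
    ultimately show False using C4_free[of "c 1" "c 3" p q] by auto
  qed
  moreover have "l \<noteq> 5"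
  proof
    assume "l = 5"
    then have "c 4 = c (- 1)" using l(2)[of 4 "-1"] by simp
    then have "c 2 \<in> \<Gamma> (c (- 1))" using chord(2)[of 4] by simp
    then show False using farD[OF far(2)[of 0], of "c 2"] chord(1)[of 0] by simp
  qed
  moreover have "l \<noteq> 8"
  proof
    assume l8: "l = 8"
    then have "c 8 = c 0" "c 0 \<noteq> c 4" "c 2 \<noteq> c 6" using l(2) by auto
    then show False
      using C4_free[of "c 0" "c 4" "c 2" "c 6"] chord(1)[of 0] chord(2)[of 4] chord(1)[of 4] chord(2)[of 8]
      by simp
  qed
  ultimately show ?thesis using l(1) by auto
qed

end

section \<open>The quotient by the cycles of far vertices\<close>

context hexavalent_graph begin

definition orbits :: "'a set set" where
  "orbits = {range c | c. far_walk c}"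

text \<open>
  The matrix of the quotient graph; by \<open>degree_constant\<close> any vertex of \<open>Q\<close> may represent it.
\<close>
definition deg :: "'a set \<Rightarrow> 'a set \<Rightarrow> nat" where
  "deg Q P = card (\<Gamma> (SOME x. x \<in> Q) \<inter> P)"

lemma range_orbit: "far_walk c \<Longrightarrow> range c \<in> orbits"
  by (auto simp: orbits_def)

lemma orbit_V: "Q \<in> orbits \<Longrightarrow> Q \<subseteq> V"
  using far_walk_V by (auto simp: orbits_def)

lemma orbit_closed: "Q \<in> orbits \<Longrightarrow> z \<in> Q \<Longrightarrow> far z \<subseteq> Q"
  using far_walkD by (auto simp: orbits_def)

lemma finite_orbit: "Q \<in> orbits \<Longrightarrow> finite Q"
  using orbit_V finite_V finite_subset by blast

lemma finite_orbits [simp]: "finite orbits"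
  using orbit_V finite_V by (intro finite_subset[of orbits "Pow V"]) auto

lemma orbit_nonempty: "Q \<in> orbits \<Longrightarrow> Q \<noteq> {}"
  by (auto simp: orbits_def)

lemma card_orbit: "Q \<in> orbits \<Longrightarrow> 3 \<le> card Q"
proof -
  assume "Q \<in> orbits"
  then obtain c where c: "Q = range c" "far_walk c" by (auto simp: orbits_def)
  obtain l where "3 \<le> l" "\<And>i j. c i = c j \<longleftrightarrow> l dvd (i - j)" using far_walk_period[OF c(2)] by metis
  then show ?thesis using card_range_periodic(1)[of l c] c by simp
qed

lemma walk_in_orbit:
  assumes P: "P \<in> orbits" and c: "far_walk c" and i: "c i \<in> P"
  shows "range c \<subseteq> P"
proof -
  have "c k \<in> P" for k
  proof (induction k rule: int_induct[of _ i])
    case (step1 k)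
    then show ?case using orbit_closed[OF P] far_walkD[OF c, of k] by blast
  next
    case (step2 k)
    then show ?case using orbit_closed[OF P] far_walkD[OF c, of k] by blast
  qed (rule i)
  then show ?thesis by auto
qed

lemma orbit_unique: "Q \<in> orbits \<Longrightarrow> P \<in> orbits \<Longrightarrow> x \<in> Q \<Longrightarrow> x \<in> P \<Longrightarrow> Q = P"
proof -
  have "Q \<subseteq> P" if Q: "Q \<in> orbits" and P: "P \<in> orbits" and x: "x \<in> Q" "x \<in> P" for Q P x
  proof -
    obtain c where c: "Q = range c" "far_walk c" using Q by (auto simp: orbits_def)
    then obtain i where "c i = x" using x by auto
    then show ?thesis using walk_in_orbit[OF P c(2), of i] x c by simp
  qed
  then show "Q \<in> orbits \<Longrightarrow> P \<in> orbits \<Longrightarrow> x \<in> Q \<Longrightarrow> x \<in> P \<Longrightarrow> Q = P" by blast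
qed

lemma orbit_disjoint: "Q \<in> orbits \<Longrightarrow> P \<in> orbits \<Longrightarrow> Q \<noteq> P \<Longrightarrow> Q \<inter> P = {}"
  using orbit_unique by blast

lemma Union_orbits: "\<Union>orbits = V"
proof
  show "V \<subseteq> \<Union>orbits"
  proof
    fix x assume "x \<in> V"
    then obtain c where "far_walk c" "c 0 = x" using far_walk_exists by blast
    then show "x \<in> \<Union>orbits" using range_orbit[of c] by auto
  qed
qed (use orbit_V in auto)

lemma card_Union_orbits:
  assumes "\<O> \<subseteq> orbits"
  shows "card (\<Union>\<O>) = (\<Sum>Q\<in>\<O>. card Q)"
proof (rule card_Union_disjoint)
  show "pairwise disjnt \<O>"
    using assms orbit_disjoint unfolding pairwise_def disjnt_def by blast
qed (use assms finite_orbit in blast)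

lemma sum_card_orbits: "(\<Sum>Q\<in>orbits. card Q) = 33"
  using card_Union_orbits[of orbits] Union_orbits card_V_33 by simp

lemma deg_eq:
  assumes "Q \<in> orbits" "P \<in> orbits" "x \<in> Q"
  shows "card (\<Gamma> x \<inter> P) = deg Q P"
proof -
  obtain c where c: "Q = range c" "far_walk c" using assms by (auto simp: orbits_def)
  have "(SOME x. x \<in> Q) \<in> Q" using assms(3) by (rule someI)
  then obtain i j where "x = c i" "(SOME x. x \<in> Q) = c j" using assms(3) c by auto
  then show ?thesis
    using degree_constant[OF c(2) orbit_V orbit_closed] assms(2) by (simp add: deg_def)
qed

lemma sum_nbrs_orbits:
  "(\<Sum>y\<in>\<Gamma> x. f y) = (\<Sum>P\<in>orbits. \<Sum>y\<in>\<Gamma> x \<inter> P. f y)"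
proof -
  have "\<Gamma> x = (\<Union>P\<in>orbits. \<Gamma> x \<inter> P)" using Union_orbits nbrs_V by blast
  then have "(\<Sum>y\<in>\<Gamma> x. f y) = (\<Sum>y\<in>(\<Union>P\<in>orbits. \<Gamma> x \<inter> P). f y)" by simp
  also have "\<dots> = (\<Sum>P\<in>orbits. \<Sum>y\<in>\<Gamma> x \<inter> P. f y)"
    using orbit_disjoint by (intro sum.UNION_disjoint) auto
  finally show ?thesis .
qed

lemma deg_row:
  assumes Q: "Q \<in> orbits"
  shows "(\<Sum>P\<in>orbits. deg Q P) = 6"
proof -
  obtain x where x: "x \<in> Q" using orbit_nonempty Q by blast
  have "6 = (\<Sum>y\<in>\<Gamma> x. 1 :: nat)" using regular[of x] x orbit_V[OF Q] by auto
  also have "\<dots> = (\<Sum>P\<in>orbits. card (\<Gamma> x \<inter> P))" unfolding sum_nbrs_orbits by simp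
  also have "\<dots> = (\<Sum>P\<in>orbits. deg Q P)" using deg_eq Q x by (intro sum.cong) auto
  finally show ?thesis by simp
qed

lemma deg_double_count:
  assumes Q: "Q \<in> orbits" and P: "P \<in> orbits"
  shows "card Q * deg Q P = card P * deg P Q"
proof -
  have "card Q * deg Q P = (\<Sum>x\<in>Q. card (\<Gamma> x \<inter> P))" using deg_eq Q P by simp
  also have "\<dots> = card (SIGMA x:Q. \<Gamma> x \<inter> P)" using finite_orbit[OF Q] by simp
  also have "\<dots> = card (SIGMA y:P. \<Gamma> y \<inter> Q)"
    by (rule bij_betw_same_card[of "\<lambda>(a, b). (b, a)"],
        rule bij_betw_byWitness[of _ "\<lambda>(a, b). (b, a)"]) (auto intro: sym)
  also have "\<dots> = (\<Sum>y\<in>P. card (\<Gamma> y \<inter> Q))" using finite_orbit[OF P] by simp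
  also have "\<dots> = card P * deg P Q" using deg_eq Q P by simp
  finally show ?thesis .
qed

text \<open>
  The quotient of \<open>A\<^sup>2 = 5 I + J - B\<close>, since \<open>B\<close> becomes twice the identity.
\<close>
lemma deg_square:
  assumes Q: "Q \<in> orbits" and R: "R \<in> orbits"
  shows "(\<Sum>P\<in>orbits. deg Q P * deg P R) = card R + (if Q = R then 3 else 0)"
proof -
  obtain x where x: "x \<in> Q" using orbit_nonempty Q by blast
  then have xV: "x \<in> V" using orbit_V Q by auto
  have "(\<Sum>P\<in>orbits. deg Q P * deg P R) = (\<Sum>P\<in>orbits. \<Sum>y\<in>\<Gamma> x \<inter> P. card (\<Gamma> y \<inter> R))"
  proof (intro sum.cong refl)
    fix P assume P: "P \<in> orbits"
    have "(\<Sum>y\<in>\<Gamma> x \<inter> P. card (\<Gamma> y \<inter> R)) = (\<Sum>y\<in>\<Gamma> x \<inter> P. deg P R)"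
      using deg_eq P R by (intro sum.cong) auto
    then show "deg Q P * deg P R = (\<Sum>y\<in>\<Gamma> x \<inter> P. card (\<Gamma> y \<inter> R))"
      using deg_eq[OF Q P x] by simp
  qed
  also have "\<dots> = (\<Sum>y\<in>\<Gamma> x. card (\<Gamma> y \<inter> R))" by (rule sum_nbrs_orbits[symmetric])
  also have "\<dots> = card (SIGMA y:\<Gamma> x. \<Gamma> y \<inter> R)" by simp
  also have "\<dots> = card (SIGMA z:R. \<Gamma> x \<inter> \<Gamma> z)"
    by (rule bij_betw_same_card[of "\<lambda>(a, b). (b, a)"],
        rule bij_betw_byWitness[of _ "\<lambda>(a, b). (b, a)"]) (auto intro: sym)
  also have "\<dots> = (\<Sum>z\<in>R. card (\<Gamma> x \<inter> \<Gamma> z))" using finite_orbit[OF R] by simp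
  finally have "int (\<Sum>P\<in>orbits. deg Q P * deg P R) = (\<Sum>z\<in>R. int (card (\<Gamma> x \<inter> \<Gamma> z)))" by simp
  also have "\<dots> = (\<Sum>z\<in>R. 1 + 5 * of_bool (z = x) - of_bool (z \<in> far x))"
  proof (intro sum.cong refl)
    fix z assume "z \<in> R"
    then have "z \<in> V" using orbit_V[OF R] by auto
    then show "int (card (\<Gamma> x \<inter> \<Gamma> z)) = 1 + 5 * of_bool (z = x) - of_bool (z \<in> far x)"
      unfolding card_common[OF xV \<open>z \<in> V\<close>] by auto
  qed
  also have "\<dots> = int (card R) + 5 * (\<Sum>z\<in>R. of_bool (z = x)) - (\<Sum>z\<in>R. of_bool (z \<in> far x))"
    by (simp add: sum.distrib sum_subtractf sum_distrib_left)
  also have "(\<Sum>z\<in>R. of_bool (z = x)) = (of_bool (x \<in> R) :: int)"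
    using finite_orbit[OF R] by (simp add: of_bool_def)
  also have "(\<Sum>z\<in>R. of_bool (z \<in> far x)) = int (card (R \<inter> far x))"
    using finite_orbit[OF R] by (simp add: sum_of_bool_card Int_def)
  also have "R \<inter> far x = (if x \<in> R then far x else {})"
    using orbit_closed[OF R] far_sym by auto
  also have "x \<in> R \<longleftrightarrow> Q = R" using x orbit_unique[OF Q R x] by auto
  finally have count: "int (\<Sum>P\<in>orbits. deg Q P * deg P R) =
      int (card R) + 5 * of_bool (Q = R) - int (card (if Q = R then far x else {}))" .
  define S where "S = (\<Sum>P\<in>orbits. deg Q P * deg P R)"
  show ?thesis
    using count card_far[OF xV] unfolding S_def[symmetric] by (cases "Q = R") auto
qed

lemma even_deg_self:
  assumes Q: "Q \<in> orbits" and odd: "odd (card Q)"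
  shows "even (deg Q Q)"
proof -
  have "2 dvd card (SIGMA x:Q. \<Gamma> x \<inter> Q)"
    by (rule prime_dvd_card_free_action[OF two_is_prime_nat, where r = "\<lambda>(a, b). (b, a)"])
      (use finite_orbit[OF Q] irrefl in \<open>auto simp: numeral_2_eq_2 intro: sym\<close>)
  also have "card (SIGMA x:Q. \<Gamma> x \<inter> Q) = card Q * deg Q Q"
    using finite_orbit[OF Q] deg_eq Q by simp
  finally show ?thesis using odd by simp
qed

lemma deg_le_6: "Q \<in> orbits \<Longrightarrow> P \<in> orbits \<Longrightarrow> deg Q P \<le> 6"
  using member_le_sum[of P orbits "deg Q"] deg_row[of Q] by simp

lemma orbits_sum_0:
  assumes "L \<subseteq> orbits" "(\<Sum>P\<in>L. card P) < 3"
  shows "L = {}"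
proof (rule ccontr)
  assume "L \<noteq> {}"
  then obtain P where P: "P \<in> L" by blast
  have "finite L" using assms(1) finite_orbits finite_subset by blast
  then have "card P \<le> (\<Sum>P\<in>L. card P)" using P by (intro member_le_sum) auto
  then show False using card_orbit[of P] P assms by auto
qed

lemma orbits_sum_1:
  assumes L: "L \<subseteq> orbits" and s: "(\<Sum>P\<in>L. card P) = s" "3 \<le> s" "s < 6"
  shows "\<exists>Z. L = {Z} \<and> card Z = s"
proof -
  have fin: "finite L" using L finite_orbits finite_subset by blast
  have "L \<noteq> {}" using s by auto
  then obtain Z where Z: "Z \<in> L" by blast
  then have *: "(\<Sum>P\<in>L. card P) = card Z + (\<Sum>P\<in>L - {Z}. card P)" using fin by (simp add: sum.remove)
  moreover have "3 \<le> card Z" using Z L card_orbit by auto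
  ultimately have "L - {Z} = {}" using L s by (intro orbits_sum_0) auto
  then have "L = {Z}" using Z by auto
  then show ?thesis using s by auto
qed

lemma orbits_sum_6:
  assumes L: "L \<subseteq> orbits" and s: "(\<Sum>P\<in>L. card P) = 6"
  obtains (hexagon) Z where "L = {Z}" "card Z = 6"
    | (triangles) S T where "S \<noteq> T" "L = {S, T}" "card S = 3" "card T = 3"
proof -
  have fin: "finite L" using L finite_orbits finite_subset by blast
  have "L \<noteq> {}" using s by auto
  then obtain Z where Z: "Z \<in> L" by blast
  then have *: "(\<Sum>P\<in>L. card P) = card Z + (\<Sum>P\<in>L - {Z}. card P)" using fin by (simp add: sum.remove)
  have Z3: "3 \<le> card Z" using Z L card_orbit by auto
  show ?thesis
  proof (cases "card Z = 3")
    case True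
    then have "(\<Sum>P\<in>L - {Z}. card P) = 3" using * s by simp
    then have "\<exists>T. L - {Z} = {T} \<and> card T = 3" using L by (intro orbits_sum_1) auto
    then obtain T where "L - {Z} = {T}" "card T = 3" by blast
    then have "Z \<noteq> T" "L = {Z, T}" using Z by auto
    then show ?thesis using True \<open>card T = 3\<close> by (rule triangles)
  next
    case False
    then have "L - {Z} = {}" using * s Z3 L by (intro orbits_sum_0) auto
    then have "L = {Z}" using Z by auto
    moreover from this have "card Z = 6" using s by simp
    ultimately show ?thesis by (rule hexagon)
  qed
qed

text \<open>
  Counting edges between cycles of coprime lengths 5 and 7 (or 14) would need degrees of at least
  seven, so the five vertices would have all their neighbours among themselves.
\<close>
lemma no_isolated_pentagon:
  assumes Z: "Z \<in> orbits" "card Z = 5"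
    and others: "\<And>P. P \<in> orbits \<Longrightarrow> P \<noteq> Z \<Longrightarrow> card P = 7 \<or> card P = 14"
  shows False
proof -
  have zero: "deg Z P = 0" if P: "P \<in> orbits" "P \<noteq> Z" for P
  proof -
    have "5 * deg Z P = 7 * deg P Z \<or> 5 * deg Z P = 7 * (2 * deg P Z)"
      using deg_double_count[OF Z(1) P(1)] others[OF P] Z(2) by auto
    then have "7 dvd 5 * deg Z P" by (metis dvd_triv_left)
    then have "7 dvd deg Z P" by presburger
    then show ?thesis using deg_le_6[OF Z(1) P(1)] by (auto dest: dvd_imp_le)
  qed
  have sum: "(\<Sum>P\<in>orbits. f (deg Z P) P) = f (deg Z Z) Z" if "\<And>P. f 0 P = 0" for f :: "nat \<Rightarrow> 'a set \<Rightarrow> nat"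
  proof -
    have "(\<Sum>P\<in>orbits - {Z}. f (deg Z P) P) = 0" using zero that by (intro sum.neutral) auto
    then show ?thesis using Z(1) by (simp add: sum.remove)
  qed
  have "deg Z Z = 6" using sum[of "\<lambda>a P. a"] deg_row[OF Z(1)] by simp
  then show False using sum[of "\<lambda>a P. a * deg P Z"] deg_square[OF Z(1) Z(1)] Z(2) by simp
qed

end

section \<open>Hexagons alone are impossible\<close>

context hexavalent_graph begin

text \<open>
  In a hexagon with chords a vertex outside can be adjacent to two vertices only if these are
  opposite: even and odd positions form triangles, and consecutive vertices are far. The common
  neighbours of the three opposite pairs are permuted by farness, so they form a cycle \<open>w\<close> of length
  three. Conversely the same two restrictions make any neighbour of \<open>c 0\<close> on a 3-cycle of farness
  adjacent to \<open>c 3\<close>.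
\<close>
lemma hexagon_apex:
  assumes c: "chord_walk c" and l: "\<And>i j. c i = c j \<longleftrightarrow> 6 dvd (i - j)"
  shows "\<exists>w. far_walk w \<and> card (range w) = 3 \<and> w 0 \<in> \<Gamma> (c 0) \<and>
    (\<forall>T\<in>orbits. \<forall>y\<in>T. card T = 3 \<longrightarrow> y \<in> \<Gamma> (c 0) \<longrightarrow> y = w 0)"
proof -
  note c' = chord_walk_far_walk[OF c]
  have far: "c (k + 1) \<in> far (c k)" "c (k - 1) \<in> far (c k)" for k using far_walkD[OF c'] by auto
  have far': "c k \<in> far (c (k + 1))" "c k \<in> far (c (k - 1))" for k using far far_sym by auto
  have per: "c (k + 6) = c k" for k using l by simp
  have N1: False if "y \<in> \<Gamma> (c k)" "y \<in> \<Gamma> (c (k + 1))" for y k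
    using farD[OF far(1)] that by blast
  have N2: False if "y \<in> \<Gamma> (c k)" "y \<in> \<Gamma> (c (k + 2))" "y \<notin> range c" for y k
  proof -
    have "c (k + 4) \<in> \<Gamma> (c (k + 2))"
      using chord_walkD(1)[OF c, of "k + 2"] by (simp add: algebra_simps)
    moreover have "c (k + 4) \<in> \<Gamma> (c k)"
      using chord_walkD(2)[OF c, of "k + 6"] per[of k] by (simp add: algebra_simps)
    moreover have "c k \<noteq> c (k + 2)" using l by simp
    ultimately have "y = c (k + 4)" using C4_free[of "c k" "c (k + 2)" y "c (k + 4)"] that by simp
    then show False using that by simp
  qed
  have "\<exists>z. z \<in> \<Gamma> (c k) \<and> z \<in> \<Gamma> (c (k + 3))" for k
  proof -
    have "c (k + 3) \<noteq> c k" "c (k + 3) \<noteq> c (k - 1)" "c (k + 3) \<noteq> c (k + 1)" using l by auto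
    then have "c (k + 3) \<notin> far (c k)" using far_walkD[OF c', of k] by simp
    then show ?thesis using common_nbr far_walk_V[OF c'] \<open>c (k + 3) \<noteq> c k\<close> by metis
  qed
  then obtain w where w: "\<And>k. w k \<in> \<Gamma> (c k)" "\<And>k. w k \<in> \<Gamma> (c (k + 3))" by metis
  have c3: "c k \<noteq> c (k + 3)" for k using l by simp
  have w_unique: "y = w k" if "y \<in> \<Gamma> (c k)" "y \<in> \<Gamma> (c (k + 3))" for y k
    using C4_free[OF c3 that w] .
  have w_per: "w (k + 3) = w k" for k
    using w_unique[of "w (k + 3)" k] w[of "k + 3"] per[of k] by (simp add: algebra_simps)
  have w_nbr: "c k \<in> \<Gamma> (w k)" "c (k + 3) \<in> \<Gamma> (w k)" for k using w sym by auto
  have w_V: "w k \<in> V" for k using w nbr_in_V by blast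
  have w_not_c: "w k \<noteq> c j" for k j
  proof
    assume eq: "w k = c j"
    have "c j \<in> \<Gamma> (c k)" "c j \<in> \<Gamma> (c (k + 3))" using w[of k] eq by simp_all
    then have "c j = c (k + 2) \<or> c j = c (k - 2)" "c j = c (k + 3 + 2) \<or> c j = c (k + 3 - 2)"
      using chord_walk_nbrs[OF c] by blast+
    then show False unfolding l by presburger
  qed
  have far_w_not_c: "y \<notin> range c" if "y \<in> far (w k)" for y k
    using orbit_closed[OF range_orbit[OF c'], of y] far_sym[OF that] w_not_c by auto
  have far_w: "far (w k) = {w (k + 1), w (k + 2)}" for k
  proof -
    have ex: "\<exists>y. y \<in> far (w k) \<and> y \<in> \<Gamma> (c i)" if "c j \<in> \<Gamma> (w k)" "c j \<in> far (c i)" for i j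
      using exchange_nonempty[OF w_V far_walk_V[OF c'] that] by blast
    obtain y1 where y1: "y1 \<in> far (w k)" "y1 \<in> \<Gamma> (c (k + 1))"
      using ex[OF w_nbr(1) far'(1)] by blast
    obtain y5 where y5: "y5 \<in> far (w k)" "y5 \<in> \<Gamma> (c (k - 1))"
      using ex[OF w_nbr(1) far'(2)] by blast
    obtain y4 where y4: "y4 \<in> far (w k)" "y4 \<in> \<Gamma> (c (k + 3 + 1))"
      using ex[OF w_nbr(2) far'(1)] by blast
    obtain y2 where y2: "y2 \<in> far (w k)" "y2 \<in> \<Gamma> (c (k + 3 - 1))"
      using ex[OF w_nbr(2) far'(2)] by blast
    have eqs: "k - 1 + 2 = k + 1" "k + 3 + 1 = k + 4" "k + 3 - 1 = k + 2" "k + 4 + 1 = k - 1 + 6"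
      "k + 1 + 1 = k + 2" "k + 1 + 3 = k + 4" "k + 2 + 3 = k - 1 + 6" by simp_all
    have "y1 \<noteq> y5" using N2[of y1 "k - 1"] far_w_not_c y1 y5 unfolding eqs by blast
    then have far_eq: "far (w k) = {y1, y5}"
      using y1 y5 card_far[OF w_V, of k] by (intro card_subset_eq[symmetric]) auto
    have "y4 \<noteq> y5" using N1[of y4 "k + 4"] y4 y5 unfolding eqs per by blast
    then have "y4 = y1" using y4 far_eq by auto
    then have "y1 = w (k + 1)" using w_unique[of y1 "k + 1"] y1 y4 unfolding eqs by blast
    moreover have "y2 \<noteq> y1" using N1[of y2 "k + 1"] y1 y2 unfolding eqs by blast
    then have "y2 = y5" using y2 far_eq by auto
    then have "y5 = w (k + 2)" using w_unique[of y5 "k + 2"] y5 y2 unfolding eqs per by blast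
    ultimately show ?thesis using far_eq by simp
  qed
  have walk_w: "far_walk w"
    unfolding far_walk_def
  proof
    fix k
    have "w (k + 2) = w (k - 1)" using w_per[of "k - 1"] by (simp add: add.commute)
    then show "far (w k) = {w (k - 1), w (k + 1)}" using far_w[of k] by auto
  qed
  have card_w: "card (range w) = 3"
  proof -
    obtain m where m: "3 \<le> m" "\<And>i j. w i = w j \<longleftrightarrow> m dvd (i - j)"
      using far_walk_period[OF walk_w] by metis
    have "m dvd 3" using m(2)[of 3 0] w_per[of 0] by simp
    then have "m = 3" using m(1) zdvd_imp_le[of m 3] by simp
    then show ?thesis using card_range_periodic(1)[of m w] m by simp
  qed
  have unique: "y = w 0" if T: "T \<in> orbits" "y \<in> T" "card T = 3" and y: "y \<in> \<Gamma> (c 0)" for y T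
  proof -
    have cC: "card (range c) = 6" using card_range_periodic(1)[of 6 c] l by simp
    have not_c: "z \<notin> range c" if "z \<in> T" for z
      using orbit_unique[OF T(1) range_orbit[OF c'] that] cC T(3) by auto
    have TV: "z \<in> V" if "z \<in> T" for z using orbit_V T that by auto
    have far_T: "far z \<subseteq> T - {z}" if "z \<in> T" for z
      using orbit_closed[OF T(1) that] far_irrefl by auto
    have ex: "\<exists>r. r \<in> far z \<and> r \<in> \<Gamma> (c i)" if "z \<in> T" "z \<in> \<Gamma> (c j)" "c j \<in> far (c i)" for z i j
      using exchange_nonempty[OF TV[OF that(1)] far_walk_V[OF c'] sym[OF that(2)] that(3)] by blast
    obtain p where p: "p \<in> far y" "p \<in> \<Gamma> (c 1)"
      using ex[OF T(2) y far'(1)] by auto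
    obtain r where r: "r \<in> far y" "r \<in> \<Gamma> (c (- 1))"
      using ex[OF T(2) y far'(2)] by auto
    have pT: "p \<in> T" "r \<in> T" "p \<noteq> y" "r \<noteq> y" using p r far_T[OF T(2)] by auto
    have "p \<noteq> r" using N2[of p "- 1"] p r not_c[OF pT(1)] by auto
    then have T_eq: "T = {y, p, r}"
      using pT T finite_orbit[OF T(1)] by (intro card_subset_eq[symmetric]) auto
    obtain z where z: "z \<in> far p" "z \<in> \<Gamma> (c 2)"
      using ex[OF pT(1) p(2) far'(1)] by auto
    have "z \<noteq> y" using N2[of y 0] y z not_c[OF T(2)] by auto
    then have "z = r" using far_T[OF pT(1)] z T_eq by auto
    then have r2: "r \<in> \<Gamma> (c 2)" using z by simp
    obtain z' where z': "z' \<in> far r" "z' \<in> \<Gamma> (c 3)"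
      using ex[OF pT(2) r2 far'(1)] by auto
    have "z' \<noteq> p" using N2[of p 1] p z' not_c[OF pT(1)] by auto
    then have "z' = y" using far_T[OF pT(2)] z' T_eq by auto
    then show ?thesis using w_unique[of y 0] y z' by simp
  qed
  show ?thesis using walk_w card_w w(1) unique by blast
qed

text \<open>
  The number of chord centres is six times the number of hexagons, at most 33, and 4 modulo 5; so
  there are four hexagons. Each of their 24 vertices has one neighbour on the 3-cycles. As degrees
  are six there are at least two 3-cycles, and since nine vertices are left there are exactly three.
  But a 3-cycle has no inner edges and sends at most one edge per vertex to another one, hence at least
  four to the hexagons, which makes 36 edges instead of 24.
\<close>
lemma not_all_hexagons:
  assumes hex: "\<And>c l. chord_walk c \<Longrightarrow> 3 \<le> l \<Longrightarrow> \<forall>i j. c i = c j \<longleftrightarrow> l dvd (i - j) \<Longrightarrow> l = 6"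
  shows False
proof -
  define \<H> where "\<H> = {range c | c. chord_walk c}"
  define \<T> where "\<T> = {T \<in> orbits. card T = 3}"
  have \<H>_orbits: "\<H> \<subseteq> orbits" using range_orbit chord_walk_far_walk by (auto simp: \<H>_def)
  have period: "\<forall>i j. c i = c j \<longleftrightarrow> 6 dvd (i - j)" if "chord_walk c" for c
    using far_walk_period[OF chord_walk_far_walk[OF that]] hex[OF that] by metis
  have card_\<H>: "card H = 6" if H: "H \<in> \<H>" for H
  proof -
    obtain c where "H = range c" "chord_walk c" using H by (auto simp: \<H>_def)
    then show ?thesis using card_range_periodic(1)[of 6 c] period[of c] by simp
  qed
  have "chord_centres = \<Union>\<H>"
  proof (intro antisym subsetI)
    fix z assume z: "z \<in> chord_centres"
    then obtain p r where pr: "far z = {p, r}" "r \<in> \<Gamma> p" "z \<in> V" by (auto simp: chord_centres_def)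
    obtain c where c: "far_walk c" "c 0 = z" using far_walk_exists pr by blast
    have "{c (- 1), c 1} = {p, r}" using far_walkD[OF c(1), of 0] c pr by simp
    then have "c 1 \<in> \<Gamma> (c (- 1))" using pr(2) sym by (auto simp: doubleton_eq_iff)
    then have "chord_walk c" using chord_walkI c by blast
    then show "z \<in> \<Union>\<H>" using c by (auto simp: \<H>_def)
  next
    fix z assume "z \<in> \<Union>\<H>"
    then obtain c k where c: "chord_walk c" "z = c k" by (auto simp: \<H>_def)
    then have "far z = {c (k - 1), c (k + 1)}" "c (k + 1) \<in> \<Gamma> (c (k - 1))" "z \<in> V"
      using far_walkD[OF chord_walk_far_walk[OF c(1)], of k] far_walk_V[OF chord_walk_far_walk[OF c(1)]]
      by (auto simp: chord_walk_def)
    then show "z \<in> chord_centres" unfolding chord_centres_def by blast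
  qed
  then have "card chord_centres = 6 * card \<H>"
    using card_Union_orbits[OF \<H>_orbits] card_\<H> by simp
  moreover have fin: "finite \<H>" using \<H>_orbits finite_orbits finite_subset by blast
  moreover have "card chord_centres \<le> 33"
    using card_mono[OF finite_V, of chord_centres] card_V_33 by (auto simp: chord_centres_def)
  ultimately have card4: "card \<H> = 4" using card_chord_centres_mod_5 by presburger
  have finT: "finite \<T>" by (simp add: \<T>_def)
  have disj: "\<H> \<inter> \<T> = {}" using card_\<H> by (auto simp: \<T>_def)
  have \<T>_orbits: "\<T> \<subseteq> orbits" by (auto simp: \<T>_def)
  have row_\<H>: "(\<Sum>T\<in>\<T>. deg H T) = 1" if H: "H \<in> \<H>" for H
  proof -
    obtain c where c: "H = range c" "chord_walk c" using H by (auto simp: \<H>_def)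
    obtain w where w: "far_walk w" "card (range w) = 3" "w 0 \<in> \<Gamma> (c 0)"
      "\<And>T y. T \<in> orbits \<Longrightarrow> y \<in> T \<Longrightarrow> card T = 3 \<Longrightarrow> y \<in> \<Gamma> (c 0) \<Longrightarrow> y = w 0"
      using hexagon_apex[OF c(2)] period[OF c(2)] by blast
    have w_T: "range w \<in> \<T>" using w range_orbit by (auto simp: \<T>_def)
    have "deg H T = (if T = range w then 1 else 0)" if T: "T \<in> \<T>" for T
    proof -
      have "\<Gamma> (c 0) \<inter> T \<subseteq> {w 0}" using w(4) T by (auto simp: \<T>_def)
      moreover have "w 0 \<in> T \<longleftrightarrow> T = range w"
        using orbit_unique[of T "range w" "w 0"] T w_T \<T>_orbits by auto
      ultimately have "\<Gamma> (c 0) \<inter> T = (if T = range w then {w 0} else {})" using w(3) by auto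
      then have "card (\<Gamma> (c 0) \<inter> T) = (if T = range w then 1 else 0)" by simp
      moreover have "H \<in> orbits" "T \<in> orbits" "c 0 \<in> H" using T \<T>_orbits H \<H>_orbits c by auto
      ultimately show ?thesis using deg_eq[of H T "c 0"] by simp
    qed
    then have "(\<Sum>T\<in>\<T>. deg H T) = (\<Sum>T\<in>\<T>. if T = range w then 1 else 0)" by (intro sum.cong) auto
    also have "\<dots> = 1" using w_T finT by simp
    finally show ?thesis .
  qed
  have "(\<Sum>T\<in>\<T>. 3 * (\<Sum>H\<in>\<H>. deg T H)) = (\<Sum>T\<in>\<T>. \<Sum>H\<in>\<H>. card T * deg T H)"
    by (simp add: sum_distrib_left \<T>_def)
  also have "\<dots> = (\<Sum>T\<in>\<T>. \<Sum>H\<in>\<H>. card H * deg H T)"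
    using \<T>_orbits \<H>_orbits deg_double_count by (intro sum.cong refl) blast
  also have "\<dots> = (\<Sum>H\<in>\<H>. \<Sum>T\<in>\<T>. card H * deg H T)" by (rule sum.swap)
  also have "\<dots> = (\<Sum>H\<in>\<H>. 6)"
    using row_\<H> card_\<H> by (intro sum.cong refl) (simp add: sum_distrib_left[symmetric])
  finally have incidences: "(\<Sum>T\<in>\<T>. 3 * (\<Sum>H\<in>\<H>. deg T H)) = 24" using card4 by simp
  (* The other cycles have at least four vertices each; with the 3-cycles they comprise nine vertices. *)
  define \<R> where "\<R> = orbits - \<H> - \<T>"
  have split: "(\<Sum>P\<in>orbits. f P) = (\<Sum>H\<in>\<H>. f H) + (\<Sum>T\<in>\<T>. f T) + (\<Sum>P\<in>\<R>. f P)" for f :: "'a set \<Rightarrow> nat"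
  proof -
    have "orbits = (\<H> \<union> \<T>) \<union> \<R>" using \<H>_orbits \<T>_orbits by (auto simp: \<R>_def)
    then have "(\<Sum>P\<in>orbits. f P) = (\<Sum>P\<in>(\<H> \<union> \<T>) \<union> \<R>. f P)" by simp
    also have "\<dots> = (\<Sum>P\<in>\<H> \<union> \<T>. f P) + (\<Sum>P\<in>\<R>. f P)"
      using fin finT by (intro sum.union_disjoint) (auto simp: \<R>_def)
    also have "(\<Sum>P\<in>\<H> \<union> \<T>. f P) = (\<Sum>H\<in>\<H>. f H) + (\<Sum>T\<in>\<T>. f T)"
      using fin finT disj by (intro sum.union_disjoint) auto
    finally show ?thesis .
  qed
  have sizes: "24 + 3 * card \<T> + (\<Sum>P\<in>\<R>. card P) = 33"
    using split[of card] sum_card_orbits card_\<H> card4 by (simp add: \<T>_def)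
  have row_T: "(\<Sum>H\<in>\<H>. deg T H) \<le> 6" if "T \<in> \<T>" for T
    using split[of "deg T"] deg_row[of T] that \<T>_orbits by auto
  have "(\<Sum>T\<in>\<T>. 3 * (\<Sum>H\<in>\<H>. deg T H)) \<le> (\<Sum>T\<in>\<T>. 18)"
    using row_T by (intro sum_mono) fastforce
  then have "2 \<le> card \<T>" using incidences by simp
  have \<R>_big: "4 \<le> card P" if "P \<in> \<R>" for P
    using that card_orbit[of P] by (force simp: \<R>_def \<T>_def)
  have "\<R> = {}"
  proof (rule ccontr)
    assume "\<R> \<noteq> {}"
    then obtain P where P: "P \<in> \<R>" by blast
    have "card P \<le> (\<Sum>P\<in>\<R>. card P)" using P by (intro member_le_sum) (auto simp: \<R>_def)
    then show False using \<R>_big[OF P] sizes \<open>2 \<le> card \<T>\<close> by linarith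
  qed
  then have card3: "card \<T> = 3" using sizes by simp
  have row_T': "4 \<le> (\<Sum>H\<in>\<H>. deg T H)" if T: "T \<in> \<T>" for T
  proof -
    have T': "T \<in> orbits" "card T = 3" using T by (auto simp: \<T>_def)
    obtain y where y: "y \<in> T" using orbit_nonempty T' by blast
    have tri: "a \<in> far b" if S: "S \<in> \<T>" "a \<in> S" "b \<in> S" "a \<noteq> b" for S a b
    proof -
      have SO: "S \<in> orbits" "card S = 3" using S by (auto simp: \<T>_def)
      then have "b \<in> V" using orbit_V S by auto
      then have "far b \<subseteq> S - {b}" "card (S - {b}) = 2" "card (far b) = 2" "finite S"
        using orbit_closed[OF SO(1)] SO S far_irrefl finite_orbit[OF SO(1)] card_far by auto
      then have "far b = S - {b}" by (intro card_subset_eq) auto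
      then show ?thesis using S by simp
    qed
    have le1: "deg T S \<le> 1" if S: "S \<in> \<T>" for S
    proof (rule ccontr)
      assume "\<not> deg T S \<le> 1"
      then have "\<not> card (\<Gamma> y \<inter> S) \<le> 1" using deg_eq[OF T'(1) _ y] S \<T>_orbits by auto
      then obtain a b where "a \<in> \<Gamma> y \<inter> S" "b \<in> \<Gamma> y \<inter> S" "a \<noteq> b"
        by (auto simp: card_le_Suc0_iff_eq)
      then show False using farD[OF tri[OF S, of a b], of y] sym by auto
    qed
    moreover have "deg T T = 0"
      using even_deg_self[OF T'(1)] T'(2) le1[OF T] by (auto simp: le_Suc_eq)
    ultimately have "(\<Sum>S\<in>\<T>. deg T S) \<le> (\<Sum>S\<in>\<T>. if S = T then 0 else 1)"
      by (intro sum_mono) auto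
    also have "\<dots> = card (\<T> - {T})"
      using finT by (simp add: sum.If_cases Diff_eq Compl_eq)
    also have "\<dots> = 2" using card3 T finT by simp
    finally show ?thesis using split[of "deg T"] deg_row[OF T'(1)] \<open>\<R> = {}\<close> by simp
  qed
  have "(\<Sum>T\<in>\<T>. 12) \<le> (\<Sum>T\<in>\<T>. 3 * (\<Sum>H\<in>\<H>. deg T H))"
    using row_T' by (intro sum_mono) fastforce
  then show False using incidences card3 by simp
qed

end

section \<open>A long cycle with chords is impossible\<close>

text \<open>
  If the length is at least seven, the apices of the triangles over the chords lie outside the
  cycle \<open>c\<close> and form a second cycle \<open>u\<close> of the same length.
\<close>
locale long_chord_walk = hexavalent_graph V \<Gamma> for V :: "'a set" and \<Gamma> +
  fixes c :: "int \<Rightarrow> 'a" and l :: int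
  assumes chord_c: "chord_walk c"
    and period_c: "c i = c j \<longleftrightarrow> l dvd (i - j)"
    and l_ge_7: "7 \<le> l"
begin

lemmas walk_c = chord_walk_far_walk[OF chord_c]

lemma c_neq: "0 < i - j \<Longrightarrow> i - j < l \<Longrightarrow> c i \<noteq> c j"
  using period_c zdvd_not_zless by blast

lemma c_far: "c (k + 1) \<in> far (c k)" "c (k - 1) \<in> far (c k)"
  using far_walkD[OF walk_c] by auto

definition u :: "int \<Rightarrow> 'a" where
  "u k = (SOME z. z \<in> \<Gamma> (c (k - 1)) \<and> z \<in> \<Gamma> (c (k + 1)))"

lemma u: "u k \<in> \<Gamma> (c (k - 1))" "u k \<in> \<Gamma> (c (k + 1))"
proof -
  have "c (k + 1) \<notin> far (c (k - 1))"
    using far_walkD[OF walk_c, of "k - 1"] c_neq[of "k + 1" "k - 1 - 1"] c_neq[of "k + 1" "k - 1 + 1"] l_ge_7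
    by simp
  then obtain z where "z \<in> \<Gamma> (c (k - 1))" "z \<in> \<Gamma> (c (k + 1))"
    using common_nbr far_walk_V[OF walk_c] far_walk_neq[OF walk_c] by metis
  then have "u k \<in> \<Gamma> (c (k - 1)) \<and> u k \<in> \<Gamma> (c (k + 1))" unfolding u_def by (intro someI) blast
  then show "u k \<in> \<Gamma> (c (k - 1))" "u k \<in> \<Gamma> (c (k + 1))" by auto
qed

lemma u_unique: "z \<in> \<Gamma> (c (k - 1)) \<Longrightarrow> z \<in> \<Gamma> (c (k + 1)) \<Longrightarrow> z = u k"
  using C4_free far_walk_neq[OF walk_c] u by metis

lemma u_V: "u k \<in> V"
  using u nbr_in_V by blast

lemma c_nbr_u: "c (k - 1) \<in> \<Gamma> (u k)" "c (k + 1) \<in> \<Gamma> (u k)"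
  using sym[OF u(1)] sym[OF u(2)] by auto

lemma u_not_c: "u k \<noteq> c j"
proof
  assume eq: "u k = c j"
  have "c j \<in> \<Gamma> (c (k - 1))" "c j \<in> \<Gamma> (c (k + 1))" using u[of k] eq by simp_all
  then have "c j = c (k - 1 + 2) \<or> c j = c (k - 1 - 2)" "c j = c (k + 1 + 2) \<or> c j = c (k + 1 - 2)"
    using chord_walk_nbrs[OF chord_c] by blast+
  then show False
    using c_neq[of "k + 1 + 2" "k - 1 + 2"] c_neq[of "k - 1 + 2" "k + 1 - 2"]
      c_neq[of "k + 1 + 2" "k - 1 - 2"] c_neq[of "k + 1 - 2" "k - 1 - 2"] l_ge_7 by auto
qed

lemma u_neq: "u (k - 1) \<noteq> u (k + 1)"
proof
  assume eq: "u (k - 1) = u (k + 1)"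
  have "u (k - 1) \<in> \<Gamma> (c (k - 2))" "u (k - 1) \<in> \<Gamma> (c (k + 2))"
    using u[of "k - 1"] u[of "k + 1"] eq by (simp_all add: algebra_simps)
  moreover have "c k \<in> \<Gamma> (c (k - 2))" "c k \<in> \<Gamma> (c (k + 2))"
    using sym[OF chord_walkD(2)[OF chord_c]] sym[OF chord_walkD(1)[OF chord_c]] by auto
  moreover have "c (k - 2) \<noteq> c (k + 2)" using c_neq[of "k + 2" "k - 2"] l_ge_7 by simp
  ultimately have "u (k - 1) = c k"
    using C4_free[of "c (k - 2)" "c (k + 2)" "u (k - 1)" "c k"] by simp
  then show False using u_not_c by blast
qed

text \<open>
  Exchange for \<open>c k\<close> and \<open>u k\<close> makes both far vertices of \<open>u k\<close> neighbours of \<open>c k\<close>. Exchange for \<open>u k\<close>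
  and \<open>c (k + 2)\<close> makes one of them a neighbour of \<open>c (k + 2)\<close> as well, and this can only be \<open>u (k + 1)\<close>.
\<close>
lemma walk_u: "far_walk u"
  unfolding far_walk_def
proof
  fix k
  have sub: "far (u k) \<subseteq> \<Gamma> (c k)"
  proof -
    have "\<Gamma> (u k) \<inter> far (c k) = {c (k - 1), c (k + 1)}"
      using c_nbr_u far_walkD[OF walk_c] by auto
    then have "card (far (u k) \<inter> \<Gamma> (c k)) = 2"
      using exchange[OF u_V far_walk_V[OF walk_c], of k k] far_walk_neq[OF walk_c, of k] by simp
    then have "far (u k) \<inter> \<Gamma> (c k) = far (u k)"
      using card_far[OF u_V] by (intro card_subset_eq) auto
    then show ?thesis by blast
  qed
  have "u (k + 1) \<in> far (u k)"
  proof -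
    have "c (k + 1) \<in> \<Gamma> (u k)" "c (k + 1) \<in> far (c (k + 2))"
      using c_nbr_u(2)[of k] c_far(2)[of "k + 2"] by (simp_all add: add.commute)
    then obtain y where "y \<in> far (u k)" "y \<in> \<Gamma> (c (k + 2))"
      using exchange_nonempty[OF u_V far_walk_V[OF walk_c]] by metis
    moreover from this have "y = u (k + 1)"
      using u_unique[of y "k + 1"] sub by (auto simp: algebra_simps)
    ultimately show ?thesis by simp
  qed
  moreover have "u (k - 1) \<in> far (u k)"
  proof -
    have "c (k - 1) \<in> \<Gamma> (u k)" "c (k - 1) \<in> far (c (k - 2))"
      using c_nbr_u c_far(1)[of "k - 2"] by simp_all
    then obtain y where "y \<in> far (u k)" "y \<in> \<Gamma> (c (k - 2))"
      using exchange_nonempty[OF u_V far_walk_V[OF walk_c]] by metis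
    moreover from this have "y = u (k - 1)"
      using u_unique[of y "k - 1"] sub by (auto simp: algebra_simps)
    ultimately show ?thesis by simp
  qed
  ultimately have "{u (k - 1), u (k + 1)} \<subseteq> far (u k)" by simp
  then show "far (u k) = {u (k - 1), u (k + 1)}"
    using card_far[OF u_V, of k] u_neq[of k]
    by (intro card_subset_eq[symmetric]) auto
qed

lemma period_u: "u i = u j \<longleftrightarrow> l dvd (i - j)"
proof -
  obtain m where m: "3 \<le> m" "\<And>i j. u i = u j \<longleftrightarrow> m dvd (i - j)"
    using far_walk_period[OF walk_u] by metis
  have "u (0 + l) = u 0"
  proof -
    have "c (l - 1) = c (- 1)" "c (l + 1) = c 1" using period_c by simp_all
    then show ?thesis using u_unique[of "u l" 0] u[of l] by simp
  qed
  then have "m dvd l" using m(2)[of l 0] by simp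
  moreover have "l dvd m"
  proof -
    have "u (m + 0) = u 0" "u (m + 2) = u 2" using m(2) by simp_all
    then have "u 0 \<in> \<Gamma> (c (m + 1))" "u 2 \<in> \<Gamma> (c (m + 1))" "u 0 \<in> \<Gamma> (c 1)" "u 2 \<in> \<Gamma> (c 1)"
      using u[of m] u[of "m + 2"] u[of 0] u[of 2] by (simp_all add: algebra_simps)
    moreover have "u 0 \<noteq> u 2" using u_neq[of 1] by simp
    ultimately have "c (m + 1) = c 1"
      using C4_free[of "u 0" "u 2" "c (m + 1)" "c 1"] sym_iff by metis
    then show ?thesis using period_c by simp
  qed
  ultimately have "m = l" using m(1) l_ge_7 by (intro zdvd_antisym_nonneg) auto
  then show ?thesis using m by simp
qed

lemma u_not_adjacent: "u (k + 1) \<notin> \<Gamma> (u k)"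
proof
  assume "u (k + 1) \<in> \<Gamma> (u k)"
  then have "far (u k) \<subseteq> \<Gamma> (u k)"
    using far_nbrs_subset[of "u (k + 1)" "u k"] far_walkD[OF walk_u] by simp
  then have "u (k - 1) \<in> \<Gamma> (u k)" "u (k + 1) \<in> \<Gamma> (u k)" using far_walkD[OF walk_u] by auto
  moreover have "u (k - 1) \<in> \<Gamma> (c k)" "u (k + 1) \<in> \<Gamma> (c k)"
    using u[of "k - 1"] u[of "k + 1"] by simp_all
  ultimately show False using C4_free[of "u k" "c k"] u_neq u_not_c by metis
qed


abbreviation C where "C \<equiv> range c"
abbreviation U where "U \<equiv> range u"

lemma C_orbit: "C \<in> orbits" and U_orbit: "U \<in> orbits"
  using range_orbit walk_c walk_u by auto

lemma C_neq_U: "C \<noteq> U"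
  using u_not_c by blast

lemma card_C: "card C = nat l" and card_U: "card U = nat l"
  using card_range_periodic(1)[of l c] card_range_periodic(1)[of l u] period_c period_u l_ge_7 by auto

lemma nbrs_C: "\<Gamma> (c k) \<inter> C = {c (k + 2), c (k - 2)}"
  using chord_walkD[OF chord_c] chord_walk_nbrs[OF chord_c] by auto

lemma deg_C_C: "deg C C = 2"
proof -
  have "c (0 + 2) \<noteq> c (0 - 2)" using c_neq[of 2 "-2"] l_ge_7 by simp
  then have "card (\<Gamma> (c 0) \<inter> C) = 2" unfolding nbrs_C by simp
  then show ?thesis using deg_eq[OF C_orbit C_orbit, of "c 0"] by simp
qed

lemma nbrs_U: "u (k - 1) \<in> \<Gamma> (c k)" "u (k + 1) \<in> \<Gamma> (c k)"
  using u[of "k - 1"] u[of "k + 1"] by simp_all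

lemma deg_C_U_ge: "2 \<le> deg C U"
proof -
  have "card {u (0 - 1), u (0 + 1)} \<le> card (\<Gamma> (c 0) \<inter> U)"
    using nbrs_U[of 0] by (intro card_mono) auto
  then show ?thesis using u_neq[of 0] deg_eq[OF C_orbit U_orbit, of "c 0"] by simp
qed

lemma deg_U_C: "deg U C = deg C U"
  using deg_double_count[OF C_orbit U_orbit] card_C card_U l_ge_7 by simp

lemma nbrs_U_exact:
  assumes "deg C U = 2"
  shows "\<Gamma> (c k) \<inter> U = {u (k - 1), u (k + 1)}"
  using nbrs_U u_neq[of k] deg_eq[OF C_orbit U_orbit, of "c k"] assms
  by (intro card_subset_eq[symmetric]) auto

lemma split_C_U:
  "(\<Sum>P\<in>orbits. f P) = f C + f U + (\<Sum>P\<in>orbits - {C, U}. f P)" for f :: "'a set \<Rightarrow> nat"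
proof -
  have "orbits - {C, U} = orbits - {C} - {U}" by auto
  then show ?thesis using C_orbit U_orbit C_neq_U by (simp add: sum.remove)
qed

text \<open>
  What is left for the other cycles: their vertices, their share of the neighbours of a vertex of
  \<open>C\<close>, and their share of the walks of length two that return to \<open>C\<close>.
\<close>
lemma rest_sums:
  "(\<Sum>P\<in>orbits - {C, U}. card P) + 2 * nat l = 33"
  "(\<Sum>P\<in>orbits - {C, U}. deg C P) + deg C U = 4"
  "(\<Sum>P\<in>orbits - {C, U}. deg C P * deg P C) + deg C U * deg C U = nat l - 1"
  using split_C_U[of card] split_C_U[of "deg C"] split_C_U[of "\<lambda>P. deg C P * deg P C"]
    sum_card_orbits deg_row[OF C_orbit] deg_square[OF C_orbit C_orbit] card_C card_U deg_C_C deg_U_C l_ge_7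
  by auto

text \<open>
  The equations force an odd degree inside \<open>U\<close>, but \<open>U\<close> has an odd number of vertices; the lengths 15,
  15, 3 below fail for the same reason.
\<close>
lemma not_three_elevens:
  assumes orb: "orbits = {C, U, P}" and P: "P \<noteq> C" "P \<noteq> U" "card P = 11"
    and l: "nat l = 11" and qs: "deg C U = 3" "deg C P = 1"
  shows False
proof -
  have PO: "P \<in> orbits" using orb by simp
  have sum: "(\<Sum>P\<in>orbits. f P) = f C + f U + f P" for f :: "'a set \<Rightarrow> nat"
    using sum_3[OF orb] P C_neq_U by metis
  have "deg P U = deg U P" using deg_double_count[OF U_orbit PO] card_U l P by simp
  then have "3 + deg U U + deg U P = 6" "6 + 3 * deg U U + deg U P = 11"
    using sum[of "deg U"] deg_row[OF U_orbit] sum[of "\<lambda>P. deg C P * deg P U"] deg_square[OF C_orbit U_orbit]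
      deg_U_C deg_C_C qs card_U l C_neq_U by auto
  then have "deg U U = 1" by linarith
  then show False using even_deg_self[OF U_orbit] card_U l by simp
qed

text \<open>
  The equations for \<open>C\<close> leave a degree of four inside \<open>P\<close>, and this gives too many walks of length two
  that return to \<open>P\<close>.
\<close>
lemma not_12_12_6_3:
  assumes orb: "orbits = {C, U, P, T}" and P: "P \<noteq> C" "P \<noteq> U" "card P = 6"
    and T: "T \<noteq> C" "T \<noteq> U" "T \<noteq> P" "card T = 3"
    and l: "nat l = 12" and qs: "deg C U = 3" "deg C P = 1"
  shows False
proof -
  have PO: "P \<in> orbits" and TO: "T \<in> orbits" using orb by auto
  have sum: "(\<Sum>P\<in>orbits. f P) = f C + f U + f P + f T" for f :: "'a set \<Rightarrow> nat"
    using P T C_neq_U by (intro sum_4[OF orb]) auto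
  have CT: "deg C T = 0" "deg T C = 0"
    using sum[of "deg C"] deg_row[OF C_orbit] qs deg_C_C deg_double_count[OF C_orbit TO] T by auto
  have PC: "deg P C = 2" using deg_double_count[OF C_orbit PO] card_C l P qs by simp
  have PU: "deg P U = 2 * deg U P" using deg_double_count[OF U_orbit PO] card_U l P by simp
  have "6 + 3 * deg U U + deg P U = 12"
    using sum[of "\<lambda>P. deg C P * deg P U"] deg_square[OF C_orbit U_orbit] deg_C_C qs CT card_U l C_neq_U by simp
  moreover have CP: "2 + 3 * deg U P + deg P P = 6"
    using sum[of "\<lambda>R. deg C R * deg R P"] deg_square[OF C_orbit PO] deg_C_C qs CT P by simp
  ultimately have "3 * deg U U + 2 * deg U P = 6" "deg U P \<le> 1" using PU by linarith+
  then have "deg U P = 0" by presburger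
  then have "deg P P = 4" using CP by simp
  then show False
    using sum[of "\<lambda>R. deg P R * deg R P"] deg_square[OF PO PO] P by simp
qed

lemma not_15_15_3:
  assumes orb: "orbits = {C, U, P}" and P: "P \<noteq> C" "P \<noteq> U" "card P = 3"
    and l: "nat l = 15" and qs: "deg C U = 3" "deg C P = 1"
  shows False
proof -
  have PO: "P \<in> orbits" using orb by simp
  have sum: "(\<Sum>P\<in>orbits. f P) = f C + f U + f P" for f :: "'a set \<Rightarrow> nat"
    using sum_3[OF orb] P C_neq_U by metis
  have "deg P U = 5 * deg U P" using deg_double_count[OF U_orbit PO] card_U l P by simp
  then have "3 + deg U U + deg U P = 6" "6 + 3 * deg U U + 5 * deg U P = 15"
    using sum[of "deg U"] deg_row[OF U_orbit] sum[of "\<lambda>P. deg C P * deg P U"] deg_square[OF C_orbit U_orbit]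
      deg_U_C deg_C_C qs card_U l C_neq_U by auto
  then have "deg U U = 3" by linarith
  then show False using even_deg_self[OF U_orbit] card_U l by simp
qed

text \<open>
  The degree from \<open>H\<close> to a cycle of nine vertices is a multiple of three, and no such row satisfies
  the quadratic equation.
\<close>
lemma not_9_9_9_6:
  assumes orb: "orbits = {C, U, W, H}" and W: "W \<noteq> C" "W \<noteq> U" "card W = 9"
    and H: "H \<noteq> C" "H \<noteq> U" "H \<noteq> W" "card H = 6" and l: "nat l = 9"
  shows False
proof -
  have WO: "W \<in> orbits" and HO: "H \<in> orbits" using orb by auto
  have sum: "(\<Sum>P\<in>orbits. f P) = f C + f U + f W + f H" for f :: "'a set \<Rightarrow> nat"
    using W H C_neq_U by (intro sum_4[OF orb]) auto
  have H_edges: "(deg H P = 0 \<and> deg P H = 0) \<or> (deg H P = 3 \<and> deg P H = 2) \<or> (deg H P = 6 \<and> deg P H = 4)"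
    if P: "P \<in> orbits" "card P = 9" for P
  proof -
    have "2 * deg H P = 3 * deg P H" using deg_double_count[OF HO P(1)] P(2) H(4) by simp
    moreover have "deg H P = 0 \<or> deg H P = 1 \<or> deg H P = 2 \<or> deg H P = 3 \<or> deg H P = 4 \<or> deg H P = 5 \<or> deg H P = 6"
      using deg_le_6[OF HO P(1)] by linarith
    ultimately show ?thesis by (elim disjE) (simp, presburger?)+
  qed
  have "deg H C + deg H U + deg H W + deg H H = 6"
    using sum[of "deg H"] deg_row[OF HO] by simp
  moreover have "deg H C * deg C H + deg H U * deg U H + deg H W * deg W H + deg H H * deg H H = 9"
    using sum[of "\<lambda>R. deg H R * deg R H"] deg_square[OF HO HO] H by simp
  moreover have "card C = 9" "card U = 9" using card_C card_U l by auto
  ultimately show False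
    using H_edges[OF C_orbit] H_edges[OF U_orbit] H_edges[OF WO W(3)] by auto
qed

text \<open>
  The quotient equations have a solution here, so adjacencies matter. The unique common neighbours of
  \<open>c k\<close> with \<open>u k\<close> and with \<open>u (k + 2)\<close> can be located; the second one must be \<open>u (k - 1)\<close>, so that \<open>u\<close>
  has chords of length three, which close up to triangles as the length is nine. Every vertex of
  \<open>U\<close> has one neighbour in the 3-cycle \<open>T\<close>, and \<open>u 0\<close>, \<open>u 3\<close> share theirs. Together with \<open>u 6\<close> this
  is a four-cycle.
\<close>
lemma not_9_9_9_3_3_local:
  assumes orb: "orbits = {C, U, W, S, T}" and T: "C \<noteq> T" "U \<noteq> T" "card T = 3" and l: "l = 9"
    and qs: "deg C U = 2" "deg U S = 0" "deg W U = 1" "deg C T = 0" "deg C W = 1" "deg U T = 1"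
  shows False
proof -
  have WO: "W \<in> orbits" and SO: "S \<in> orbits" and TO: "T \<in> orbits" using orb by auto
  have cases: "y \<in> C \<or> y \<in> U \<or> y \<in> W \<or> y \<in> S \<or> y \<in> T" if "y \<in> V" for y
    using Union_orbits that unfolding orb by auto
  have not_T: "y \<notin> T" if "y \<in> \<Gamma> (c k)" for y k
    using deg_eq[OF C_orbit TO, of "c k"] qs that by auto
  have not_S: "y \<notin> S" if "y \<in> \<Gamma> (u k)" for y k
    using deg_eq[OF U_orbit SO, of "u k"] qs that by auto
  have u_neq': "u i \<noteq> u j" if "\<not> 9 dvd i - j" for i j using period_u that l by simp
  have U_of_C: "u i = u (k - 1) \<or> u i = u (k + 1)" if "u i \<in> \<Gamma> (c k)" for i k
    using nbrs_U_exact[OF qs(1), of k] that by auto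
  have common: "\<exists>y. y \<in> \<Gamma> (c k) \<and> y \<in> \<Gamma> (u i)" for k i
  proof -
    have "u i \<notin> far (c k)" using far_walkD[OF walk_c, of k] u_not_c by auto
    then show ?thesis using common_nbr far_walk_V[OF walk_c] u_V u_not_c by metis
  qed
  have via_W: "\<exists>w\<in>W. w \<in> \<Gamma> (c k) \<and> w \<in> \<Gamma> (u k)" for k
  proof -
    obtain y where y: "y \<in> \<Gamma> (c k)" "y \<in> \<Gamma> (u k)" using common by blast
    have "y \<notin> C"
    proof
      assume "y \<in> C"
      then have "y = c (k + 2) \<or> y = c (k - 2)" using y nbrs_C[of k] by auto
      then have "u k \<in> \<Gamma> (c (k + 2)) \<or> u k \<in> \<Gamma> (c (k - 2))" using sym[OF y(2)] by auto
      then show False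
        using U_of_C[of k "k + 2"] U_of_C[of k "k - 2"] u_neq'[of k "k + 2 - 1"] u_neq'[of k "k + 2 + 1"]
          u_neq'[of k "k - 2 - 1"] u_neq'[of k "k - 2 + 1"] by auto
    qed
    moreover have "y \<notin> U"
    proof
      assume "y \<in> U"
      then have "y = u (k - 1) \<or> y = u (k + 1)" using y nbrs_U_exact[OF qs(1), of k] by auto
      then show False using y(2) u_not_adjacent[of k] u_not_adjacent[of "k - 1"] sym[OF y(2)] by auto
    qed
    moreover have "y \<notin> S" "y \<notin> T" using not_S y not_T by blast+
    ultimately have "y \<in> W" using cases[of y] y nbr_in_V by blast
    then show ?thesis using y by blast
  qed
  have u3: "u (k + 3) \<in> \<Gamma> (u k)" for k
  proof -
    let ?k = "k + 1"
    obtain w where w: "w \<in> W" "w \<in> \<Gamma> (c ?k)" "w \<in> \<Gamma> (u ?k)" using via_W by blast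
    obtain y where y: "y \<in> \<Gamma> (c ?k)" "y \<in> \<Gamma> (u (k + 3))" using common by blast
    have "y \<notin> C"
    proof
      assume "y \<in> C"
      then have "y = c (?k + 2) \<or> y = c (?k - 2)" using y nbrs_C[of ?k] by auto
      then have "u (k + 3) \<in> \<Gamma> (c (?k + 2)) \<or> u (k + 3) \<in> \<Gamma> (c (?k - 2))" using sym[OF y(2)] by auto
      then show False
        using U_of_C[of "k + 3" "?k + 2"] U_of_C[of "k + 3" "?k - 2"] u_neq'[of "k + 3" "?k + 2 - 1"]
          u_neq'[of "k + 3" "?k + 2 + 1"] u_neq'[of "k + 3" "?k - 2 - 1"] u_neq'[of "k + 3" "?k - 2 + 1"]
        by auto
    qed
    moreover have "y \<notin> W"
    proof
      assume "y \<in> W"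
      moreover have "card (\<Gamma> (c ?k) \<inter> W) = 1" using deg_eq[OF C_orbit WO, of "c ?k"] qs by simp
      then obtain x where x: "\<Gamma> (c ?k) \<inter> W = {x}" by (auto simp: card_1_singleton_iff)
      ultimately have "y \<in> {x}" "w \<in> {x}" using w y unfolding x[symmetric] by simp_all
      then have "y = w" by simp
      then have "u ?k \<in> \<Gamma> w \<inter> U" "u (k + 3) \<in> \<Gamma> w \<inter> U" using w y sym by auto
      moreover have "card (\<Gamma> w \<inter> U) = 1" using deg_eq[OF WO U_orbit w(1)] qs by simp
      then obtain x where x: "\<Gamma> w \<inter> U = {x}" by (auto simp: card_1_singleton_iff)
      ultimately have "u ?k \<in> {x}" "u (k + 3) \<in> {x}" unfolding x by simp_all
      then have "u ?k = u (k + 3)" by simp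
      then show False using u_neq'[of ?k "k + 3"] by simp
    qed
    moreover have "y \<notin> S" "y \<notin> T" using not_S y not_T by blast+
    ultimately have "y \<in> U" using cases[of y] y nbr_in_V by blast
    then have "y = u (?k - 1) \<or> y = u (?k + 1)" using y nbrs_U_exact[OF qs(1), of ?k] by auto
    moreover have "y \<noteq> u (?k + 1)"
      using y(2) u_not_adjacent[of "k + 2"] sym[OF y(2)] by (auto simp: algebra_simps)
    ultimately have "y = u k" by simp
    then show ?thesis using sym[OF y(2)] by simp
  qed
  have "\<exists>t. t \<in> T \<and> t \<in> \<Gamma> (u k)" for k
  proof -
    have "card (\<Gamma> (u k) \<inter> T) = 1" using deg_eq[OF U_orbit TO, of "u k"] qs by simp
    then show ?thesis by (auto simp: card_1_singleton_iff)
  qed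
  then obtain t where t: "\<And>k. t k \<in> T" "\<And>k. t k \<in> \<Gamma> (u k)" by metis
  have TU: "T \<inter> U = {}" "T \<inter> C = {}" using orbit_disjoint TO U_orbit C_orbit T by auto
  have t1: "t k \<noteq> t (k + 1)" for k
    using farD[of "u (k + 1)" "u k" "t k"] far_walkD[OF walk_u, of k] t[of k] t[of "k + 1"] by auto
  have t2: "t k \<noteq> t (k + 2)" for k
  proof
    assume "t k = t (k + 2)"
    then have "t k \<in> \<Gamma> (u k)" "t k \<in> \<Gamma> (u (k + 2))" using t by metis+
    moreover have "c (k + 1) \<in> \<Gamma> (u k)" "c (k + 1) \<in> \<Gamma> (u (k + 2))"
      using c_nbr_u(2)[of k] c_nbr_u(1)[of "k + 2"] by (simp_all add: add.commute)
    moreover have "u k \<noteq> u (k + 2)" using u_neq' by simp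
    ultimately have "t k = c (k + 1)" using C4_free[of "u k" "u (k + 2)"] by blast
    then show False using t(1)[of k] TU by auto
  qed
  have "t 3 = t 0"
  proof (rule ccontr)
    assume "t 3 \<noteq> t 0"
    moreover have "t 0 \<noteq> t 1" "t 1 \<noteq> t 2" "t 2 \<noteq> t 3" "t 0 \<noteq> t 2" "t 1 \<noteq> t 3"
      using t1[of 0] t1[of 1] t1[of 2] t2[of 0] t2[of 1] by simp_all
    ultimately have "card {t 0, t 1, t 2, t 3} = 4" by auto
    moreover have "card {t 0, t 1, t 2, t 3} \<le> card T"
      using t finite_orbit[OF TO] by (intro card_mono) auto
    ultimately show False using T by simp
  qed
  moreover have "u 6 \<in> \<Gamma> (u 3)" "u 6 \<in> \<Gamma> (u 0)" "u 0 \<noteq> u 3"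
  proof -
    show "u 6 \<in> \<Gamma> (u 3)" using u3[of 3] by simp
    have "u 9 = u 0" using period_u l by simp
    then show "u 6 \<in> \<Gamma> (u 0)" using sym[OF u3[of 6]] by simp
    show "u 0 \<noteq> u 3" using u_neq' by simp
  qed
  moreover have "t 0 \<in> \<Gamma> (u 0)" "t 3 \<in> \<Gamma> (u 3)" using t by auto
  ultimately have "t 0 = u 6" using C4_free[of "u 0" "u 3" "t 0" "u 6"] by simp
  then show False using t(1)[of 0] TU by auto
qed

text \<open>
  The remaining unknown degrees are determined up to the alternative whether \<open>S\<close> is joined to \<open>U\<close> or
  to \<open>W\<close>; the first violates an equation, the second is excluded by \<open>not_9_9_9_3_3_local\<close>.
\<close>
lemma not_9_9_9_3_3_oriented:
  assumes orb: "orbits = {C, U, W, S, T}" and dist: "distinct [C, U, W, S, T]"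
    and cards: "card W = 9" "card S = 3" "card T = 3" and l: "l = 9"
    and qs: "deg C U = 2" "deg C S = 1" "deg C T = 0" "deg C W = 1"
    and S: "deg U S + deg W S = 1" and T: "deg U T = 1" "deg W T = 1"
  shows False
proof -
  have WO: "W \<in> orbits" and SO: "S \<in> orbits" and TO: "T \<in> orbits" using orb by auto
  have sum: "(\<Sum>P\<in>orbits. f P) = f C + f U + f W + f S + f T" for f :: "'a set \<Rightarrow> nat"
    by (rule sum_5[OF orb dist])
  have card9: "card C = 9" "card U = 9" using card_C card_U l by auto
  have ratio: "deg S P = 3 * deg P S" if "P \<in> orbits" "card P = 9" for P
    using deg_double_count[OF SO that(1)] that cards by simp
  have WC: "deg W C = 1" using deg_double_count[OF C_orbit WO] card9 cards qs by simp
  have WU: "deg W U = deg U W" using deg_double_count[OF U_orbit WO] card9 cards by simp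
  have CU: "4 + 2 * deg U U + deg U W + 3 * deg U S = 9"
    using sum[of "\<lambda>R. deg C R * deg R U"] deg_square[OF C_orbit U_orbit] qs deg_C_C WU ratio[OF U_orbit] card9 dist
    by simp
  have U: "2 + deg U U + deg U W + deg U S + 1 = 6"
    using sum[of "deg U"] deg_row[OF U_orbit] deg_U_C qs T by simp
  have CW: "2 + 2 * deg U W + deg W W + 3 * deg W S = 9"
    using sum[of "\<lambda>R. deg C R * deg R W"] deg_square[OF C_orbit WO] qs deg_C_C ratio[OF WO] cards dist by simp
  have W: "1 + deg U W + deg W W + deg W S + 1 = 6"
    using sum[of "deg W"] deg_row[OF WO] WC WU T by simp
  have "deg U S = 0" "deg U W = 1" using CU U CW W S by linarith+
  then show False
    using not_9_9_9_3_3_local[OF orb] dist cards l qs WU T by simp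
qed

lemma not_9_9_9_3_3:
  assumes orb: "orbits = {C, U, W, S, T}" and dist: "distinct [C, U, W, S, T]"
    and cards: "card W = 9" "card S = 3" "card T = 3" and l: "l = 9" and CU: "deg C U = 2"
  shows False
proof -
  have WO: "W \<in> orbits" and SO: "S \<in> orbits" and TO: "T \<in> orbits" using orb by auto
  have sum: "(\<Sum>P\<in>orbits. f P) = f C + f U + f W + f S + f T" for f :: "'a set \<Rightarrow> nat"
    by (rule sum_5[OF orb dist])
  have card9: "card C = 9" "card U = 9" using card_C card_U l by auto
  have ratio: "deg Z P = 3 * deg P Z" if "P \<in> orbits" "card P = 9" "Z \<in> orbits" "card Z = 3" for P Z
    using deg_double_count[OF that(3,1)] that by simp
  note rS = ratio[OF C_orbit card9(1) SO cards(2)] ratio[OF U_orbit card9(2) SO cards(2)]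
    ratio[OF WO cards(1) SO cards(2)]
  note rT = ratio[OF C_orbit card9(1) TO cards(3)] ratio[OF U_orbit card9(2) TO cards(3)]
    ratio[OF WO cards(1) TO cards(3)]
  have ST: "deg S T = deg T S" using deg_double_count[OF SO TO] cards by simp
  have "3 * (deg C S + deg U S + deg W S) + deg S T + deg S S = 6"
    "3 * (deg C S * deg C S + deg U S * deg U S + deg W S * deg W S) + deg S T * deg S T + deg S S * deg S S = 6"
    using sum[of "deg S"] deg_row[OF SO] sum[of "\<lambda>R. deg S R * deg R S"] deg_square[OF SO SO] rS ST cards by auto
  then have S: "deg S S = 0 \<and> deg S T = 0 \<and> deg C S \<le> 1 \<and> deg U S \<le> 1 \<and> deg W S \<le> 1 \<and> deg C S + deg U S + deg W S = 2"
    using even_deg_self[OF SO] cards by (intro small_triangle_row) auto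
  have "3 * (deg C T + deg U T + deg W T) + deg S T + deg T T = 6"
    "3 * (deg C T * deg C T + deg U T * deg U T + deg W T * deg W T) + deg S T * deg S T + deg T T * deg T T = 6"
    using sum[of "deg T"] deg_row[OF TO] sum[of "\<lambda>R. deg T R * deg R T"] deg_square[OF TO TO] rT ST cards by auto
  then have T: "deg T T = 0 \<and> deg S T = 0 \<and> deg C T \<le> 1 \<and> deg U T \<le> 1 \<and> deg W T \<le> 1 \<and> deg C T + deg U T + deg W T = 2"
    using even_deg_self[OF TO] cards by (intro small_triangle_row) auto
  have "3 * (deg C S * deg C T + deg U S * deg U T + deg W S * deg W T) = 3"
    using sum[of "\<lambda>R. deg S R * deg R T"] deg_square[OF SO TO] rS S T dist cards by simp
  then have meet: "deg C S * deg C T + deg U S * deg U T + deg W S * deg W T = 1" by simp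
  have WC: "deg W C = deg C W" using deg_double_count[OF C_orbit WO] card9 cards by simp
  have row: "deg C W + deg C S + deg C T = 2"
    using sum[of "deg C"] deg_row[OF C_orbit] CU deg_C_C by simp
  have square: "deg C W * deg C W + 3 * (deg C S * deg C S) + 3 * (deg C T * deg C T) = 4"
    using sum[of "\<lambda>R. deg C R * deg R C"] deg_square[OF C_orbit C_orbit] CU deg_U_C deg_C_C WC rS rT card9 by simp
  have bits: "deg C S = 0 \<or> deg C S = 1" "deg C T = 0 \<or> deg C T = 1" using S T by linarith+
  consider "deg C S = 0" "deg C T = 0" | "deg C S = 1" "deg C T = 1" | "deg C S = 1" "deg C T = 0" | "deg C S = 0" "deg C T = 1"
 using bits by argo
  then show False
  proof cases
    case 1
    then have "deg U S = 1" "deg W S = 1" "deg U T = 1" "deg W T = 1" using S T by auto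
    then show False using meet by simp
  next
    case 2
    then show False using row square by simp
  next
    case 3
    then have "deg C W = 1" "deg U T = 1" "deg W T = 1" "deg U S + deg W S = 1" using row S T by auto
    then show False using not_9_9_9_3_3_oriented[OF orb dist cards l CU 3] by blast
  next
    case 4
    then have "deg C W = 1" "deg U S = 1" "deg W S = 1" "deg U T + deg W T = 1" using row S T by auto
    moreover have "orbits = {C, U, W, T, S}" using orb by auto
    moreover have "distinct [C, U, W, T, S]" using dist by auto
    ultimately show False using not_9_9_9_3_3_oriented[of W T S] cards l CU 4 by simp
  qed
qed

text \<open>
  A vertex of \<open>C\<close> has two neighbours in \<open>C\<close> and between two and four in \<open>U\<close>; the case distinction is
  how the at most two others are distributed over further cycles.
\<close>
lemma no_long_chord_walk: False
proof -
  define \<R> where "\<R> = orbits - {C, U}"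
  have fin: "finite \<R>" and sub: "\<R> \<subseteq> orbits" by (auto simp: \<R>_def)
  note sums = rest_sums[folded \<R>_def]
  define n where "n = nat l"
  have n: "7 \<le> n" "n \<noteq> 8"
    using chord_walk_period_cases[OF chord_c _ period_c] l_ge_7 by (auto simp: n_def)
  have l_n: "l = int n" using l_ge_7 by (simp add: n_def)
  have ratio: "n * deg C P = card P * deg P C" if "P \<in> \<R>" for P
    using deg_double_count[OF C_orbit, of P] that sub card_C by (auto simp: n_def)
  have le6: "deg P C \<le> 6" if "P \<in> \<R>" for P
    using deg_le_6[OF _ C_orbit] that sub by auto
  have ge3: "3 \<le> card P" if "P \<in> \<R>" for P using that sub card_orbit by auto
  have remove: "(\<Sum>P\<in>\<R>. f P) = f P + (\<Sum>P\<in>\<R> - {P}. f P)" if "P \<in> \<R>" for P and f :: "'a set \<Rightarrow> nat"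
    using fin that by (simp add: sum.remove)
  have orbits_eq: "orbits = {C, U} \<union> \<R>" using C_orbit U_orbit by (auto simp: \<R>_def)
  have not_CU: "P \<noteq> C" "P \<noteq> U" if "P \<in> \<R>" for P using that by (auto simp: \<R>_def)
  have q_U: "2 \<le> deg C U" "deg C U \<le> 4" using deg_C_U_ge sums(2) by linarith+
  consider "deg C U = 4" | "deg C U = 3" | "deg C U = 2" using q_U by linarith
  then show False
  proof cases
    case 1
    then have "(\<Sum>P\<in>\<R>. deg C P) = 0" using sums(2) by simp
    then have "(\<Sum>P\<in>\<R>. deg C P * deg P C) = 0" using fin by simp
    then have "n = 17" using sums(3) 1 by (simp add: n_def)
    then show False using sums(1) by (simp add: n_def)
  next
    case 2
    then have one: "(\<Sum>P\<in>\<R>. deg C P) = 1" using sums(2) by simp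
    obtain P where P: "P \<in> \<R>" "deg C P = 1" and zero: "\<And>R. R \<in> \<R> \<Longrightarrow> R \<noteq> P \<Longrightarrow> deg C R = 0"
      using sum_nat_1[OF fin one] by metis
    have "(\<Sum>R\<in>\<R> - {P}. deg C R * deg R C) = 0" using zero by (intro sum.neutral) auto
    then have h: "n = 10 + deg P C"
      using sums(3) remove[OF P(1), of "\<lambda>R. deg C R * deg R C"] P(2) 2 n by (simp add: n_def)
    have rest: "2 * n + card P + (\<Sum>R\<in>\<R> - {P}. card R) = 33"
      using sums(1) remove[OF P(1), of card] by (simp add: n_def)
    have "n = card P * deg P C" using ratio[OF P(1)] P(2) by simp
    then consider "n = 11" "card P = 11" | "n = 12" "card P = 6" | "n = 15" "card P = 3"
      using sizes_if_degree_3[OF h _ rest le6[OF P(1)]] by blast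
    then show False
    proof cases
      case 1
      then have "\<R> - {P} = {}" using rest sub by (intro orbits_sum_0) auto
      then have "orbits = {C, U, P}" by (rule remove_1[OF orbits_eq P(1)])
      then show False
        using not_three_elevens[of P] not_CU[OF P(1)] 1 2 P(2) by (simp add: n_def \<open>deg C U = 3\<close>)
    next
      case 2
      then have "(\<Sum>R\<in>\<R> - {P}. card R) = 3" using rest by simp
      moreover have "\<R> - {P} \<subseteq> orbits" using sub by blast
      ultimately have "\<exists>Z. \<R> - {P} = {Z} \<and> card Z = 3" by (intro orbits_sum_1) auto
      then obtain T where T: "\<R> - {P} = {T}" "card T = 3" by blast
      have "orbits = {C, U, P, T}" "T \<in> \<R>" "T \<noteq> P" by (rule remove_2[OF orbits_eq P(1) T(1)])+
      then show False
        using not_12_12_6_3[of P T] not_CU[OF P(1)] not_CU[of T] 2 T(2) P(2) \<open>deg C U = 3\<close> by (simp add: n_def)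
    next
      case 3
      then have "\<R> - {P} = {}" using rest sub by (intro orbits_sum_0) auto
      then have "orbits = {C, U, P}" by (rule remove_1[OF orbits_eq P(1)])
      then show False
        using not_15_15_3[of P] not_CU[OF P(1)] 3 P(2) \<open>deg C U = 3\<close> by (simp add: n_def)
    qed
  next
    case 3
    then have sum2: "(\<Sum>P\<in>\<R>. deg C P) = 2" using sums(2) by simp
    then obtain P where P: "P \<in> \<R>" "deg C P \<noteq> 0" by (metis sum.neutral zero_neq_numeral)
    have rem2: "deg C P + (\<Sum>R\<in>\<R> - {P}. deg C R) = 2" using remove[OF P(1), of "deg C"] sum2 by simp
    have rest: "2 * n + card P + (\<Sum>R\<in>\<R> - {P}. card R) = 33"
      using sums(1) remove[OF P(1), of card] by (simp add: n_def)
    have squares: "n = 5 + deg C P * deg P C + (\<Sum>R\<in>\<R> - {P}. deg C R * deg R C)"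
      using sums(3) remove[OF P(1), of "\<lambda>R. deg C R * deg R C"] 3 n by (simp add: n_def)
    consider "deg C P = 2" | "deg C P = 1" using rem2 P(2) by linarith
    then show False
    proof cases
      case double: 1
      then have "\<And>R. R \<in> \<R> - {P} \<Longrightarrow> deg C R = 0" using rem2 fin by simp
      then have "(\<Sum>R\<in>\<R> - {P}. deg C R * deg R C) = 0" by (intro sum.neutral) auto
      then have "n = 5 + 2 * deg P C" "2 * n = card P * deg P C"
        using squares double ratio[OF P(1)] by auto
      then consider "n = 7" "card P = 14" | "n = 9" "card P = 9"
        using sizes_if_degree_2_one_orbit[OF _ _ rest le6[OF P(1)] n(1)] by blast
      then show False
      proof cases
        case n7: 1
        then have "(\<Sum>R\<in>\<R> - {P}. card R) = 5" using rest by simp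
        moreover have "\<R> - {P} \<subseteq> orbits" using sub by blast
        ultimately have "\<exists>Z. \<R> - {P} = {Z} \<and> card Z = 5" by (intro orbits_sum_1) auto
        then obtain Z where Z: "\<R> - {P} = {Z}" "card Z = 5" by blast
        have orb: "orbits = {C, U, P, Z}" by (rule remove_2[OF orbits_eq P(1) Z(1)])+
        have "card R = 7 \<or> card R = 14" if "R \<in> orbits" "R \<noteq> Z" for R
        proof -
          have "R = C \<or> R = U \<or> R = P" by (rule not_last(1)[OF orb that])
          then show ?thesis using n7 card_C card_U unfolding n_def by metis
        qed
        moreover have "Z \<in> orbits" using orb by (rule last_in)
        ultimately show False using no_isolated_pentagon[of Z] Z(2) by blast
      next
        case 2
        then have six: "(\<Sum>R\<in>\<R> - {P}. card R) = 6" using rest by simp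
        have sub_P: "\<R> - {P} \<subseteq> orbits" using sub by blast
        show False
        proof (rule orbits_sum_6[OF sub_P six])
          fix Z assume Z: "\<R> - {P} = {Z}" "card Z = 6"
          have "orbits = {C, U, P, Z}" "Z \<in> \<R>" "Z \<noteq> P" by (rule remove_2[OF orbits_eq P(1) Z(1)])+
          then show False
            using not_9_9_9_6[of P Z] not_CU[OF P(1)] not_CU[of Z] 2 Z(2) by (simp add: n_def)
        next
          fix S T assume ST: "S \<noteq> T" "\<R> - {P} = {S, T}" "card S = 3" "card T = 3"
          have "orbits = {C, U, P, S, T}" "S \<in> \<R>" "T \<in> \<R>" "S \<noteq> P" "T \<noteq> P"
            by (rule remove_3[OF orbits_eq P(1) ST(2)])+
          moreover from this have "distinct [C, U, P, S, T]"
            using P(1) ST(1) by (intro distinct_5 C_neq_U not_CU) auto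
          ultimately show False
            using not_9_9_9_3_3[of P S T] 2 ST 3 l_n by simp
        qed
      qed
    next
      case single: 2
      then have one: "(\<Sum>R\<in>\<R> - {P}. deg C R) = 1" using rem2 by simp
      have fin': "finite (\<R> - {P})" using fin by simp
      obtain P' where P'_rest: "P' \<in> \<R> - {P}" and qP': "deg C P' = 1"
        and zero: "\<And>R. R \<in> \<R> - {P} \<Longrightarrow> R \<noteq> P' \<Longrightarrow> deg C R = 0"
        using sum_nat_1[OF fin' one] by metis
      have P': "P' \<in> \<R>" "P' \<noteq> P" "deg C P' = 1" using P'_rest qP' by simp_all
      have remove': "(\<Sum>R\<in>\<R> - {P}. f R) = f P' + (\<Sum>R\<in>\<R> - {P} - {P'}. f R)" for f :: "'a set \<Rightarrow> nat"
        using fin P' by (simp add: sum.remove)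
      have "(\<Sum>R\<in>\<R> - {P} - {P'}. deg C R * deg R C) = 0" using zero by (intro sum.neutral) auto
      then have h: "n = 5 + deg P C + deg P' C"
        using squares remove'[of "\<lambda>R. deg C R * deg R C"] single P'(3) by simp
      have rest': "2 * n + card P + card P' + (\<Sum>R\<in>\<R> - {P} - {P'}. card R) = 33"
        using rest remove'[of card] by simp
      have div: "n = card P * deg P C" "n = card P' * deg P' C"
        using ratio[OF P(1)] ratio[OF P'(1)] single P'(3) by auto
      consider "n = 7" "card P = 7" "card P' = 7" | "n = 9" "card P = 9" "card P' = 3"
        | "n = 9" "card P = 3" "card P' = 9" | "n = 12" "card P + card P' = 7"
        using sizes_if_degree_2_two_orbits[OF h div rest' le6[OF P(1)] le6[OF P'(1)] n ge3[OF P(1)] ge3[OF P'(1)]] by blast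
      then show False
      proof cases
        case n7: 1
        then have "(\<Sum>R\<in>\<R> - {P} - {P'}. card R) = 5" using rest' by simp
        moreover have "\<R> - {P} - {P'} \<subseteq> orbits" using sub by blast
        ultimately have "\<exists>Z. \<R> - {P} - {P'} = {Z} \<and> card Z = 5" by (intro orbits_sum_1) auto
        then obtain Z where Z: "\<R> - {P} - {P'} = {Z}" "card Z = 5" by blast
        have orb: "orbits = {C, U, P, P', Z}" by (rule remove_4[OF orbits_eq P(1) P'(1) Z(1)])+
        have "card R = 7 \<or> card R = 14" if "R \<in> orbits" "R \<noteq> Z" for R
        proof -
          have "R = C \<or> R = U \<or> R = P \<or> R = P'" by (rule not_last(2)[OF orb that])
          then show ?thesis using n7 card_C card_U unfolding n_def by metis
        qed
        moreover have "Z \<in> orbits" using orb by (rule last_in)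
        ultimately show False using no_isolated_pentagon[of Z] Z(2) by blast
      next
        case 2
        then have "(\<Sum>R\<in>\<R> - {P} - {P'}. card R) = 3" using rest' by simp
        moreover have "\<R> - {P} - {P'} \<subseteq> orbits" using sub by blast
        ultimately have "\<exists>Z. \<R> - {P} - {P'} = {Z} \<and> card Z = 3" by (intro orbits_sum_1) auto
        then obtain T where T: "\<R> - {P} - {P'} = {T}" "card T = 3" by blast
        have "orbits = {C, U, P, P', T}" "T \<in> \<R>" "T \<noteq> P" "T \<noteq> P'"
          by (rule remove_4[OF orbits_eq P(1) P'(1) T(1)])+
        moreover from this have "distinct [C, U, P, P', T]"
          using P(1) P'(1,2) by (intro distinct_5 C_neq_U not_CU) auto
        ultimately show False
          using not_9_9_9_3_3[of P P' T] 2 T(2) 3 l_n by simp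
      next
        case case3: 3
        then have "(\<Sum>R\<in>\<R> - {P} - {P'}. card R) = 3" using rest' by simp
        moreover have "\<R> - {P} - {P'} \<subseteq> orbits" using sub by blast
        ultimately have "\<exists>Z. \<R> - {P} - {P'} = {Z} \<and> card Z = 3" by (intro orbits_sum_1) auto
        then obtain T where T: "\<R> - {P} - {P'} = {T}" "card T = 3" by blast
        have "orbits = {C, U, P', P, T}" "T \<in> \<R>" "T \<noteq> P" "T \<noteq> P'"
          by (rule remove_4[OF orbits_eq P(1) P'(1) T(1)])+
        moreover from this have "distinct [C, U, P', P, T]"
          using P(1) P'(1,2) by (intro distinct_5 C_neq_U not_CU) auto
        ultimately show False
          using not_9_9_9_3_3[of P' P T] case3 T(2) 3 l_n by simp
      next
        case 4
        then have two: "(\<Sum>R\<in>\<R> - {P} - {P'}. card R) = 2" using rest' by simp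
        then have "\<R> - {P} - {P'} = {}" using sub by (intro orbits_sum_0) auto
        then have "(\<Sum>R\<in>\<R> - {P} - {P'}. card R) = 0" by (simp only: sum.empty)
        then show False using two by simp
      qed
    qed
  qed
qed

end

lemma no_6_regular_graph_on_33: assumes "regular_C4_free_graph V \<Gamma> 6 2" shows False
proof -
  interpret hexavalent_graph V \<Gamma> using assms by (simp add: hexavalent_graph_def)
  show False
  proof (rule not_all_hexagons)
    fix c and l :: int
    assume c: "chord_walk c" "3 \<le> l" "\<forall>i j. c i = c j \<longleftrightarrow> l dvd (i - j)"
    show "l = 6"
    proof (rule ccontr)
      assume "l \<noteq> 6"
      then have "7 \<le> l" using chord_walk_period_cases[OF c(1,2)] c(3) by auto
      then interpret long_chord_walk V \<Gamma> c l using c by unfold_locales auto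
      show False by (rule no_long_chord_walk)
    qed
  qed
qed

section \<open>Ramsey numbers in terms of minimum degree\<close>

lemma contains_C4_iff:
  assumes G: "pair_graph G"
  shows "contains_graph G (cycle_graph 4) \<longleftrightarrow>
    (\<exists>x y u v. x \<noteq> y \<and> u \<noteq> v \<and> (x, u) \<in> parcs G \<and> (u, y) \<in> parcs G \<and> (y, v) \<in> parcs G \<and> (v, x) \<in> parcs G)"
    (is "?L \<longleftrightarrow> ?R")
proof
  have less_4: "i = 0 \<or> i = 1 \<or> i = 2 \<or> i = 3" if "i < 4" for i :: nat using that by linarith
  have verts: "pverts (cycle_graph 4) = {0, 1, 2, 3}"
  proof -
    have "{..<4} = {0, 1, 2, 3 :: nat}" by auto
    then show ?thesis by (simp add: cycle_graph_def)
  qed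
  note iff = contains_graph_iff[OF G pair_graph_cycle[of 4]]
  {
    assume ?L
    then obtain f where f: "inj_on f {0, 1, 2, 3}" "\<forall>(u, v)\<in>parcs (cycle_graph 4). (f u, f v) \<in> parcs G"
      using iff verts by auto
    have "f 0 \<noteq> f 2" "f 1 \<noteq> f 3" using f(1) by (auto simp: inj_on_def)
    moreover have "(0, 1) \<in> parcs (cycle_graph 4)" "(1, 2) \<in> parcs (cycle_graph 4)"
      "(2, 3) \<in> parcs (cycle_graph 4)" "(3, 0) \<in> parcs (cycle_graph 4)"
      by (simp_all add: cycle_graph_def)
    then have "(f 0, f 1) \<in> parcs G" "(f 1, f 2) \<in> parcs G" "(f 2, f 3) \<in> parcs G" "(f 3, f 0) \<in> parcs G"
      using f(2) by blast+
    ultimately show ?R by blast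
  }
  assume ?R
  then obtain x y u v where xy: "x \<noteq> y" "u \<noteq> v"
    and e: "(x, u) \<in> parcs G" "(u, y) \<in> parcs G" "(y, v) \<in> parcs G" "(v, x) \<in> parcs G" by blast
  have rev: "(b, a) \<in> parcs G" if "(a, b) \<in> parcs G" for a b
    using G that by (auto simp: pair_graph_iff dest: symD)
  have V: "a \<in> pverts G \<and> b \<in> pverts G \<and> a \<noteq> b" if "(a, b) \<in> parcs G" for a b
    using G that by (auto simp: pair_graph_iff irrefl_def)
  define f where "f = (\<lambda>i :: nat. x)(1 := u, 2 := y, 3 := v)"
  have f: "f 0 = x" "f 1 = u" "f 2 = y" "f 3 = v" by (auto simp: f_def)
  have "inj_on f {0, 1, 2, 3}" using f xy V[OF e(1)] V[OF e(2)] V[OF e(3)] V[OF e(4)] by (auto simp: inj_on_def)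
  moreover have "f ` {0, 1, 2, 3} \<subseteq> pverts G" using f V[OF e(1)] V[OF e(3)] by auto
  moreover have step: "(f i, f (Suc i mod 4)) \<in> parcs G" if "i < 4" for i
  proof -
    have "Suc 0 mod 4 = 1" "Suc 1 mod 4 = 2" "Suc 2 mod 4 = 3" "Suc 3 mod 4 = 0" by simp_all
    then show ?thesis using less_4[OF that] f e by metis
  qed
  have "(f a, f b) \<in> parcs G" if "(a, b) \<in> parcs (cycle_graph 4)" for a b
  proof -
    have "a < 4" "b < 4" "b = Suc a mod 4 \<or> a = Suc b mod 4" using that by (simp_all add: cycle_graph_def)
    then show ?thesis using step[of a] rev[OF step[of b]] by (elim disjE) simp_all
  qed
  then have "\<forall>(a, b)\<in>parcs (cycle_graph 4). (f a, f b) \<in> parcs G" by blast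
  ultimately show ?L using iff unfolding verts by simp blast
qed

lemma contains_complement_star_iff:
  assumes G: "pair_graph G"
  shows "contains_graph (complement_graph G) (star_graph n) \<longleftrightarrow>
    (\<exists>x\<in>pverts G. n \<le> card {y \<in> pverts G. y \<noteq> x \<and> (x, y) \<notin> parcs G})"
    (is "?L \<longleftrightarrow> ?R")
proof
  note iff = contains_graph_iff[OF pair_graph_complement[OF G] pair_graph_star[of n]]
  have sym: "(b, a) \<in> parcs G \<longleftrightarrow> (a, b) \<in> parcs G" for a b
    using G by (auto simp: pair_graph_iff dest: symD)
  have fin: "finite (pverts G)" using G by (simp add: pair_graph_iff)
  {
    assume ?L
    then obtain f where f: "inj_on f {0..n}" "f ` {0..n} \<subseteq> pverts G"
      "\<forall>(u, v)\<in>parcs (star_graph n). (f u, f v) \<in> parcs (complement_graph G)"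
      using iff by (auto simp: star_graph_def complement_graph_def)
    have "f ` {1..n} \<subseteq> {y \<in> pverts G. y \<noteq> f 0 \<and> (f 0, y) \<notin> parcs G}"
      using f(3) by (auto simp: star_graph_def complement_graph_def)
    then have "card (f ` {1..n}) \<le> card {y \<in> pverts G. y \<noteq> f 0 \<and> (f 0, y) \<notin> parcs G}"
      using fin by (intro card_mono) auto
    moreover have "card (f ` {1..n}) = n"
      using inj_on_subset[OF f(1), of "{1..n}"] by (simp add: card_image)
    ultimately show ?R using f(2) by (intro bexI[of _ "f 0"]) auto
  }
  assume ?R
  then obtain x where x: "x \<in> pverts G" "n \<le> card {y \<in> pverts G. y \<noteq> x \<and> (x, y) \<notin> parcs G}" by blast
  then obtain Y where Y: "Y \<subseteq> {y \<in> pverts G. y \<noteq> x \<and> (x, y) \<notin> parcs G}" "card Y = n" "finite Y"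
    by (meson obtain_subset_with_card_n)
  obtain g where g: "bij_betw g {1..n} Y"
    using finite_same_card_bij[of "{1..n}" Y] Y by auto
  define f where "f i = (if i = 0 then x else g i)" for i
  have gY: "g i \<in> Y" if "1 \<le> i" "i \<le> n" for i using g that by (auto simp: bij_betw_def)
  have gx: "g i \<noteq> x" "x \<noteq> g i" if "1 \<le> i" "i \<le> n" for i using gY[OF that] Y(1) by auto
  have "inj_on f {0..n}"
  proof (rule inj_onI)
    fix i j assume "i \<in> {0..n}" "j \<in> {0..n}" "f i = f j"
    then show "i = j"
      using gx[of i] gx[of j] inj_onD[OF bij_betw_imp_inj_on[OF g], of i j]
      by (cases "i = 0"; cases "j = 0") (simp_all add: f_def)
  qed
  moreover have "f i \<in> pverts G" if "i \<in> {0..n}" for i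
    using x(1) gY[of i] Y(1) that by (cases "i = 0") (auto simp: f_def)
  then have "f ` {0..n} \<subseteq> pverts G" by blast
  moreover have "\<forall>(u, v)\<in>parcs (star_graph n). (f u, f v) \<in> parcs (complement_graph G)"
  proof -
    have "(x, g i) \<in> parcs (complement_graph G) \<and> (g i, x) \<in> parcs (complement_graph G)" if "1 \<le> i" "i \<le> n" for i
      using gY[OF that] Y(1) x sym by (auto simp: complement_graph_def)
    then show ?thesis by (auto simp: star_graph_def f_def)
  qed
  ultimately show ?L unfolding iff by (auto simp: star_graph_def complement_graph_def)
qed

lemma ramsey_property_C4_star_iff:
  "ramsey_property (cycle_graph 4) (star_graph n) N \<longleftrightarrow>
    (\<forall>(V :: nat set) \<Gamma>. C4_free_graph V \<Gamma> \<and> card V = N \<longrightarrow> (\<exists>x\<in>V. card (\<Gamma> x) + n < N))"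
proof -
  have non_nbrs: "n \<le> card {y \<in> V. y \<noteq> x \<and> y \<notin> \<Gamma> x} \<longleftrightarrow> card (\<Gamma> x) + n < card V"
    if "simple_graph V \<Gamma>" "x \<in> V" for V :: "nat set" and \<Gamma> x
  proof -
    interpret simple_graph V \<Gamma> by fact
    have "V = insert x (\<Gamma> x \<union> {y \<in> V. y \<noteq> x \<and> y \<notin> \<Gamma> x})" using nbrs_V that(2) by auto
    then have "card V = card (insert x (\<Gamma> x \<union> {y \<in> V. y \<noteq> x \<and> y \<notin> \<Gamma> x}))" by simp
    also have "\<dots> = 1 + (card (\<Gamma> x) + card {y \<in> V. y \<noteq> x \<and> y \<notin> \<Gamma> x})"
      using irrefl finite_V by (subst card_insert_disjoint) (auto intro!: card_Un_disjoint)
    finally show ?thesis by linarith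
  qed
  show ?thesis
  proof (intro iffI allI impI)
    fix V :: "nat set" and \<Gamma>
    assume ramsey: "ramsey_property (cycle_graph 4) (star_graph n) N" and "C4_free_graph V \<Gamma> \<and> card V = N"
    then have free: "C4_free_graph V \<Gamma>" and N: "card V = N" by auto
    interpret C4_free_graph V \<Gamma> by fact
    define G where "G = \<lparr>pverts = V, parcs = {(x, y). y \<in> \<Gamma> x}\<rparr>"
    have G: "pair_graph G"
      using finite_V nbr_in_V irrefl sym by (auto simp: pair_graph_iff G_def sym_def irrefl_def)
    have "\<not> contains_graph G (cycle_graph 4)"
      unfolding contains_C4_iff[OF G] using C4_free sym by (auto simp: G_def)
    then have "contains_graph (complement_graph G) (star_graph n)"
      using ramsey G N unfolding ramsey_property_def by (auto simp: G_def)
    then obtain x where "x \<in> V" "n \<le> card {y \<in> V. y \<noteq> x \<and> y \<notin> \<Gamma> x}"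
      unfolding contains_complement_star_iff[OF G] by (auto simp: G_def)
    then show "\<exists>x\<in>V. card (\<Gamma> x) + n < N"
      using non_nbrs[OF simple_graph_axioms] N by auto
  next
    assume *: "\<forall>(V :: nat set) \<Gamma>. C4_free_graph V \<Gamma> \<and> card V = N \<longrightarrow> (\<exists>x\<in>V. card (\<Gamma> x) + n < N)"
    show "ramsey_property (cycle_graph 4) (star_graph n) N"
      unfolding ramsey_property_def
    proof (intro allI impI)
      fix G :: "nat pair_pre_digraph"
      assume "pair_graph G \<and> card (pverts G) = N"
      then have G: "pair_graph G" and N: "card (pverts G) = N" by auto
      define \<Gamma> where "\<Gamma> x = {y. (x, y) \<in> parcs G}" for x
      have simple: "simple_graph (pverts G) \<Gamma>"
        using G by unfold_locales (auto simp: pair_graph_iff \<Gamma>_def sym_def irrefl_def)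
      show "contains_graph G (cycle_graph 4) \<or> contains_graph (complement_graph G) (star_graph n)"
      proof (cases "contains_graph G (cycle_graph 4)")
        case no_C4: False
        have "C4_free_graph (pverts G) \<Gamma>"
        proof (intro C4_free_graph.intro simple C4_free_graph_axioms.intro)
          fix x y u v
          assume "x \<noteq> y" "u \<in> \<Gamma> x" "u \<in> \<Gamma> y" "v \<in> \<Gamma> x" "v \<in> \<Gamma> y"
          moreover from this have "(u, y) \<in> parcs G" "(v, x) \<in> parcs G"
            using G by (auto simp: \<Gamma>_def pair_graph_iff dest: symD)
          ultimately show "u = v"
            using no_C4 unfolding contains_C4_iff[OF G] by (auto simp: \<Gamma>_def)
        qed
        then obtain x where "x \<in> pverts G" "card (\<Gamma> x) + n < card (pverts G)" using * N by blast
        then have "contains_graph (complement_graph G) (star_graph n)"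
          unfolding contains_complement_star_iff[OF G] using non_nbrs[OF simple] by (auto simp: \<Gamma>_def)
        then show ?thesis ..
      qed simp
    qed
  qed
qed

lemma C4_star_ramsey_le:
  assumes "\<And>(V :: nat set) \<Gamma>. C4_free_graph V \<Gamma> \<Longrightarrow> card V = d + n \<Longrightarrow> (\<And>x. x \<in> V \<Longrightarrow> d \<le> card (\<Gamma> x)) \<Longrightarrow> False"
  shows "C4_star_ramsey n \<le> d + n"
proof -
  have "ramsey_property (cycle_graph 4) (star_graph n) (d + n)"
    unfolding ramsey_property_C4_star_iff
  proof (intro allI impI)
    fix V :: "nat set" and \<Gamma>
    assume "C4_free_graph V \<Gamma> \<and> card V = d + n"
    then show "\<exists>x\<in>V. card (\<Gamma> x) + n < d + n"
      using assms[of V \<Gamma>] by (meson add_less_cancel_right not_le)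
  qed
  then show ?thesis unfolding C4_star_ramsey_def ramsey_number_def by (rule Least_le)
qed

text \<open>
  Deleting a vertex lowers the other degrees by at most one, so a witness yields witnesses of all
  smaller orders.
\<close>
lemma less_C4_star_ramsey:
  fixes V :: "nat set"
  assumes free: "C4_free_graph V \<Gamma>" and deg: "\<And>x. x \<in> V \<Longrightarrow> card V \<le> card (\<Gamma> x) + n"
  shows "card V < C4_star_ramsey n"
proof (rule ccontr)
  interpret C4_free_graph V \<Gamma> by fact
  assume "\<not> card V < C4_star_ramsey n"
  then have "C4_star_ramsey n \<le> card V" by simp
  then obtain W where W: "W \<subseteq> V" "card W = C4_star_ramsey n" "finite W"
    by (meson obtain_subset_with_card_n)
  define \<Delta> where "\<Delta> x = (if x \<in> W then \<Gamma> x \<inter> W else {})" for x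
  have "C4_free_graph W \<Delta>"
    using W(3) irrefl sym C4_free by unfold_locales (auto simp: \<Delta>_def split: if_splits)
  moreover have "ramsey_property (cycle_graph 4) (star_graph n) (card W)"
    unfolding W(2) C4_star_ramsey_def
    by (intro ramsey_property_ramsey_number pair_graph_cycle pair_graph_star) simp
  ultimately obtain x where x: "x \<in> W" "card (\<Delta> x) + n < card W"
    unfolding ramsey_property_C4_star_iff by blast
  have "card (\<Gamma> x) \<le> card (\<Gamma> x \<inter> W) + card (V - W)"
  proof -
    have "card (\<Gamma> x) = card (\<Gamma> x \<inter> W) + card (\<Gamma> x - W)" by (simp add: card_Int_Diff)
    also have "card (\<Gamma> x - W) \<le> card (V - W)" using nbrs_V finite_V by (intro card_mono) auto
    finally show ?thesis by simp
  qed
  moreover have "card (V - W) = card V - card W" "card W \<le> card V"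
    using W finite_V card_mono[OF finite_V W(1)] by (auto simp: card_Diff_subset)
  moreover have "card V \<le> card (\<Gamma> x) + n" using deg x W by auto
  ultimately show False using x by (simp add: \<Delta>_def)
qed

text \<open>
  A vertex of degree \<open>d + 1\<close> would have at least \<open>(d + 1) (d - 1)\<close> second neighbours, and there
  are at most that many vertices altogether.
\<close>
lemma regular_of_min_degree:
  assumes free: "C4_free_graph V \<Gamma>" and card: "card V = d * (d - 1) + 1 + e" and e: "e + 1 < d"
    and deg: "\<And>x. x \<in> V \<Longrightarrow> d \<le> card (\<Gamma> x)"
  shows "regular_C4_free_graph V \<Gamma> d e"
proof -
  interpret C4_free_graph V \<Gamma> by fact
  show ?thesis
  proof
    fix x assume x: "x \<in> V"
    have "(d + 1) * (d - 1) = d * (d - 1) + (d - 1)" by simp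
    then have "card (\<Gamma> x) * (d - 1) < (d + 1) * (d - 1)"
      using degree_bound[OF x deg] card e by linarith
    then have "card (\<Gamma> x) < d + 1" by (metis mult_less_cancel2)
    then show "card (\<Gamma> x) = d" using deg[OF x] by simp
  qed (rule card)
qed

lemma Parsons_bound:
  assumes "d + n \<le> d * (d - 1)" "0 < d"
  shows "C4_star_ramsey n \<le> d + n"
proof (rule C4_star_ramsey_le)
  fix V :: "nat set" and \<Gamma>
  assume free: "C4_free_graph V \<Gamma>" and card: "card V = d + n" and deg: "\<And>x. x \<in> V \<Longrightarrow> d \<le> card (\<Gamma> x)"
  interpret C4_free_graph V \<Gamma> by fact
  have "V \<noteq> {}" using card assms by auto
  then obtain x where x: "x \<in> V" by blast
  have "d * (d - 1) \<le> card (\<Gamma> x) * (d - 1)" using deg[OF x] by simp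
  also have "\<dots> < card V" by (rule degree_bound[OF x deg])
  finally show False using assms card by simp
qed

section \<open>Graphs for the lower bounds\<close>

text \<open>
  Adjacency lists are checked by listing, for each vertex, the ends of its paths of length two;
  by symmetry it is enough to list the ends with a larger number.
\<close>
definition C4_free_lists :: "nat \<Rightarrow> nat list list \<Rightarrow> bool" where
  "C4_free_lists d ns \<longleftrightarrow> list_all (\<lambda>i. let xs = ns ! i in
      d \<le> length xs \<and> distinct xs \<and>
      list_all (\<lambda>j. j < length ns \<and> j \<noteq> i \<and> i \<in> set (ns ! j)) xs \<and>
      distinct (concat (map (\<lambda>j. filter ((<) i) (ns ! j)) xs))) [0..<length ns]"

lemma distinct_concat_map_disjoint:
  "distinct (concat (map f xs)) \<Longrightarrow> u \<in> set xs \<Longrightarrow> v \<in> set xs \<Longrightarrow> y \<in> set (f u) \<Longrightarrow> y \<in> set (f v) \<Longrightarrow> u = v"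
  by (induction xs) auto

lemma less_C4_star_ramsey_lists:
  assumes ns: "C4_free_lists d ns" and d: "length ns \<le> d + n"
  shows "length ns < C4_star_ramsey n"
proof -
  define \<Gamma> where "\<Gamma> i = (if i < length ns then set (ns ! i) else {})" for i
  have rows: "\<forall>i<length ns. d \<le> length (ns ! i) \<and> distinct (ns ! i) \<and>
      (\<forall>j\<in>set (ns ! i). j < length ns \<and> j \<noteq> i \<and> i \<in> set (ns ! j)) \<and>
      distinct (concat (map (\<lambda>j. filter ((<) i) (ns ! j)) (ns ! i)))"
  proof -
    have "i \<in> set [0..<length ns]" if "i < length ns" for i using that by simp
    then show ?thesis using ns unfolding C4_free_lists_def list_all_iff Let_def by blast
  qed
  have \<Gamma>_iff: "j \<in> \<Gamma> i \<longleftrightarrow> i < length ns \<and> j \<in> set (ns ! i)" for i j by (simp add: \<Gamma>_def)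
  have nbr: "j < length ns" "j \<noteq> i" "i \<in> set (ns ! j)" if "j \<in> \<Gamma> i" for i j
    using that rows unfolding \<Gamma>_iff by blast+
  have free: "C4_free_graph {..<length ns} \<Gamma>"
  proof
    show "finite {..<length ns}" by simp
    show "\<Gamma> x \<subseteq> {..<length ns}" for x using nbr(1) by auto
    show "x \<notin> \<Gamma> x" for x using nbr(2) by blast
    show "x \<in> \<Gamma> y" if "y \<in> \<Gamma> x" for x y using nbr(1,3)[OF that] by (simp add: \<Gamma>_iff)
    have eq: "u = v" if xy: "x < y" and uv: "u \<in> \<Gamma> x" "u \<in> \<Gamma> y" "v \<in> \<Gamma> x" "v \<in> \<Gamma> y" for x y u v
    proof -
      have x: "x < length ns" using uv(1) by (simp add: \<Gamma>_iff)
      have "y \<in> set (filter ((<) x) (ns ! u))" "y \<in> set (filter ((<) x) (ns ! v))"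
        using xy nbr(3)[OF uv(2)] nbr(3)[OF uv(4)] by simp_all
      moreover have "u \<in> set (ns ! x)" "v \<in> set (ns ! x)" using uv by (simp_all add: \<Gamma>_iff)
      moreover have "distinct (concat (map (\<lambda>j. filter ((<) x) (ns ! j)) (ns ! x)))" using rows x by blast
      ultimately show ?thesis using distinct_concat_map_disjoint by metis
    qed
    fix x y u v
    assume "x \<noteq> y" "u \<in> \<Gamma> x" "u \<in> \<Gamma> y" "v \<in> \<Gamma> x" "v \<in> \<Gamma> y"
    then show "u = v" using eq[of x y u v] eq[of y x u v] by (meson nat_neq_iff)
  qed
  have "card {..<length ns} \<le> card (\<Gamma> x) + n" if "x \<in> {..<length ns}" for x
  proof -
    have "d \<le> length (ns ! x)" "distinct (ns ! x)" using that rows by blast+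
    then have "d \<le> card (\<Gamma> x)" using that by (simp add: \<Gamma>_def distinct_card)
    then show ?thesis using d by simp
  qed
  then show ?thesis using less_C4_star_ramsey[OF free] by simp
qed

text \<open>
  The graphs on fewer than 75 vertices have a rotational symmetry: consecutive blocks of \<open>m\<close> vertices are
  rotated simultaneously, and the last one or two vertices are fixed if \<open>m\<close> does not divide their number. Here
  \<open>m\<close> is 4, 3, 7, 9, 3, 3, 13 and 7 in the order of the definitions. The graph on 75 vertices is
  an induced subgraph of the polarity graph of the projective plane of order nine.
\<close>
definition graph_32 :: "nat list list" where
  "graph_32 =
   [[7, 10, 17, 22, 24], [4, 11, 18, 23, 25], [5, 8, 19, 20, 26], [6, 9, 16, 21, 27],
    [1, 10, 11, 21, 31], [2, 8, 11, 22, 28], [3, 8, 9, 23, 29], [0, 9, 10, 20, 30],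
    [2, 5, 6, 14, 23], [3, 6, 7, 15, 20], [0, 4, 7, 12, 21], [1, 4, 5, 13, 22],
    [10, 18, 26, 27, 29], [11, 19, 24, 27, 30], [8, 16, 24, 25, 31], [9, 17, 25, 26, 28],
    [3, 14, 21, 25, 30], [0, 15, 22, 26, 31], [1, 12, 23, 27, 28], [2, 13, 20, 24, 29],
    [2, 7, 9, 19, 31], [3, 4, 10, 16, 28], [0, 5, 11, 17, 29], [1, 6, 8, 18, 30],
    [0, 13, 14, 19, 28], [1, 14, 15, 16, 29], [2, 12, 15, 17, 30], [3, 12, 13, 18, 31],
    [5, 15, 18, 21, 24], [6, 12, 19, 22, 25], [7, 13, 16, 23, 26], [4, 14, 17, 20, 27]]"

definition graph_34 :: "nat list list" where
  "graph_34 =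
   [[8, 13, 17, 20, 32, 33], [6, 14, 15, 18, 30, 33], [7, 12, 16, 19, 31, 33],
    [4, 5, 9, 16, 18, 26], [3, 5, 10, 17, 19, 24], [3, 4, 11, 15, 20, 25],
    [1, 12, 15, 17, 21, 26], [2, 13, 15, 16, 22, 24], [0, 14, 16, 17, 23, 25],
    [3, 12, 13, 18, 23, 28], [4, 13, 14, 19, 21, 29], [5, 12, 14, 20, 22, 27],
    [2, 6, 9, 11, 17, 31], [0, 7, 9, 10, 15, 32], [1, 8, 10, 11, 16, 30], [1, 5, 6, 7, 13, 25],
    [2, 3, 7, 8, 14, 26], [0, 4, 6, 8, 12, 24], [1, 3, 9, 22, 29, 33], [2, 4, 10, 23, 27, 33],
    [0, 5, 11, 21, 28, 33], [6, 10, 20, 26, 28, 29], [7, 11, 18, 24, 27, 29],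
    [8, 9, 19, 25, 27, 28], [4, 7, 17, 22, 28, 30], [5, 8, 15, 23, 29, 31],
    [3, 6, 16, 21, 27, 32], [11, 19, 22, 23, 26, 32], [9, 20, 21, 23, 24, 30],
    [10, 18, 21, 22, 25, 31], [1, 14, 24, 28, 31, 32], [2, 12, 25, 29, 30, 32],
    [0, 13, 26, 27, 30, 31], [0, 1, 2, 18, 19, 20]]"

definition graph_35 :: "nat list list" where
  "graph_35 =
   [[3, 4, 10, 16, 18, 28], [4, 5, 11, 17, 19, 29], [5, 6, 12, 18, 20, 30],
    [0, 6, 13, 14, 19, 31], [0, 1, 7, 15, 20, 32], [1, 2, 8, 14, 16, 33], [2, 3, 9, 15, 17, 34],
    [4, 14, 20, 25, 27, 34], [5, 14, 15, 21, 26, 28], [6, 15, 16, 22, 27, 29],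
    [0, 16, 17, 21, 23, 30], [1, 17, 18, 22, 24, 31], [2, 18, 19, 23, 25, 32],
    [3, 19, 20, 24, 26, 33], [3, 5, 7, 8, 27, 31], [4, 6, 8, 9, 21, 32], [0, 5, 9, 10, 22, 33],
    [1, 6, 10, 11, 23, 34], [0, 2, 11, 12, 24, 28], [1, 3, 12, 13, 25, 29], [2, 4, 7, 13, 26, 30],
    [8, 10, 15, 24, 25, 30], [9, 11, 16, 25, 26, 31], [10, 12, 17, 26, 27, 32],
    [11, 13, 18, 21, 27, 33], [7, 12, 19, 21, 22, 34], [8, 13, 20, 22, 23, 28],
    [7, 9, 14, 23, 24, 29], [0, 8, 18, 26, 29, 34], [1, 9, 19, 27, 28, 30],
    [2, 10, 20, 21, 29, 31], [3, 11, 14, 22, 30, 32], [4, 12, 15, 23, 31, 33],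
    [5, 13, 16, 24, 32, 34], [6, 7, 17, 25, 28, 33]]"

definition graph_36 :: "nat list list" where
  "graph_36 =
   [[11, 12, 21, 26, 33, 35], [12, 13, 18, 22, 27, 34], [13, 14, 19, 23, 28, 35],
    [14, 15, 20, 24, 27, 29], [15, 16, 21, 25, 28, 30], [16, 17, 22, 26, 29, 31],
    [9, 17, 18, 23, 30, 32], [9, 10, 19, 24, 31, 33], [10, 11, 20, 25, 32, 34],
    [6, 7, 21, 23, 27, 31], [7, 8, 22, 24, 28, 32], [0, 8, 23, 25, 29, 33],
    [0, 1, 24, 26, 30, 34], [1, 2, 18, 25, 31, 35], [2, 3, 19, 26, 27, 32],
    [3, 4, 18, 20, 28, 33], [4, 5, 19, 21, 29, 34], [5, 6, 20, 22, 30, 35],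
    [1, 6, 13, 15, 32, 33], [2, 7, 14, 16, 33, 34], [3, 8, 15, 17, 34, 35], [0, 4, 9, 16, 27, 35],
    [1, 5, 10, 17, 27, 28], [2, 6, 9, 11, 28, 29], [3, 7, 10, 12, 29, 30], [4, 8, 11, 13, 30, 31],
    [0, 5, 12, 14, 31, 32], [1, 3, 9, 14, 21, 22], [2, 4, 10, 15, 22, 23], [3, 5, 11, 16, 23, 24],
    [4, 6, 12, 17, 24, 25], [5, 7, 9, 13, 25, 26], [6, 8, 10, 14, 18, 26], [0, 7, 11, 15, 18, 19],
    [1, 8, 12, 16, 19, 20], [0, 2, 13, 17, 20, 21]]"

definition graph_37 :: "nat list list" where
  "graph_37 =
   [[3, 6, 16, 20, 25, 36], [4, 7, 17, 18, 26, 36], [5, 8, 15, 19, 24, 36],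
    [0, 11, 14, 16, 23, 31], [1, 9, 12, 17, 21, 32], [2, 10, 13, 15, 22, 30],
    [0, 20, 21, 29, 30, 34], [1, 18, 22, 27, 31, 35], [2, 19, 23, 28, 32, 33],
    [4, 13, 16, 21, 24, 35], [5, 14, 17, 22, 25, 33], [3, 12, 15, 23, 26, 34],
    [4, 11, 15, 25, 27, 32], [5, 9, 16, 26, 28, 30], [3, 10, 17, 24, 29, 31],
    [2, 5, 11, 12, 18, 20], [0, 3, 9, 13, 18, 19], [1, 4, 10, 14, 19, 20], [1, 7, 15, 16, 29, 33],
    [2, 8, 16, 17, 27, 34], [0, 6, 15, 17, 28, 35], [4, 6, 9, 31, 33, 34], [5, 7, 10, 32, 34, 35],
    [3, 8, 11, 30, 33, 35], [2, 9, 14, 29, 35, 36], [0, 10, 12, 27, 33, 36],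
    [1, 11, 13, 28, 34, 36], [7, 12, 19, 25, 30, 31], [8, 13, 20, 26, 31, 32],
    [6, 14, 18, 24, 30, 32], [5, 6, 13, 23, 27, 29], [3, 7, 14, 21, 27, 28],
    [4, 8, 12, 22, 28, 29], [8, 10, 18, 21, 23, 25], [6, 11, 19, 21, 22, 26],
    [7, 9, 20, 22, 23, 24], [0, 1, 2, 24, 25, 26]]"

definition graph_38 :: "nat list list" where
  "graph_38 =
   [[4, 6, 15, 18, 23, 31], [5, 7, 16, 19, 21, 32], [3, 8, 17, 20, 22, 30],
    [2, 12, 16, 25, 29, 36], [0, 13, 17, 26, 27, 36], [1, 14, 15, 24, 28, 36],
    [0, 7, 8, 18, 24, 34], [1, 6, 8, 19, 25, 35], [2, 6, 7, 20, 26, 33], [10, 11, 12, 17, 19, 24],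
    [9, 11, 13, 15, 20, 25], [9, 10, 14, 16, 18, 26], [3, 9, 19, 23, 33, 36],
    [4, 10, 20, 21, 34, 36], [5, 11, 18, 22, 35, 36], [0, 5, 10, 23, 25, 30],
    [1, 3, 11, 21, 26, 31], [2, 4, 9, 22, 24, 32], [0, 6, 11, 14, 29, 32], [1, 7, 9, 12, 27, 30],
    [2, 8, 10, 13, 28, 31], [1, 13, 16, 22, 23, 34], [2, 14, 17, 21, 23, 35],
    [0, 12, 15, 21, 22, 33], [5, 6, 9, 17, 28, 34], [3, 7, 10, 15, 29, 35],
    [4, 8, 11, 16, 27, 33], [4, 19, 26, 28, 29, 30], [5, 20, 24, 27, 29, 31],
    [3, 18, 25, 27, 28, 32], [2, 15, 19, 27, 34, 37], [0, 16, 20, 28, 35, 37],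
    [1, 17, 18, 29, 33, 37], [8, 12, 23, 26, 32, 37], [6, 13, 21, 24, 30, 37],
    [7, 14, 22, 25, 31, 37], [3, 4, 5, 12, 13, 14], [30, 31, 32, 33, 34, 35]]"

definition graph_39 :: "nat list list" where
  "graph_39 =
   [[6, 7, 16, 19, 26, 30], [7, 8, 17, 20, 27, 31], [8, 9, 18, 21, 28, 32],
    [9, 10, 19, 22, 29, 33], [10, 11, 20, 23, 30, 34], [11, 12, 21, 24, 31, 35],
    [0, 12, 22, 25, 32, 36], [0, 1, 13, 23, 33, 37], [1, 2, 14, 24, 34, 38],
    [2, 3, 15, 25, 26, 35], [3, 4, 13, 16, 27, 36], [4, 5, 14, 17, 28, 37],
    [5, 6, 15, 18, 29, 38], [7, 10, 15, 24, 36, 37], [8, 11, 16, 25, 37, 38],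
    [9, 12, 13, 17, 26, 38], [0, 10, 14, 18, 26, 27], [1, 11, 15, 19, 27, 28],
    [2, 12, 16, 20, 28, 29], [0, 3, 17, 21, 29, 30], [1, 4, 18, 22, 30, 31],
    [2, 5, 19, 23, 31, 32], [3, 6, 20, 24, 32, 33], [4, 7, 21, 25, 33, 34],
    [5, 8, 13, 22, 34, 35], [6, 9, 14, 23, 35, 36], [0, 9, 15, 16, 31, 34],
    [1, 10, 16, 17, 32, 35], [2, 11, 17, 18, 33, 36], [3, 12, 18, 19, 34, 37],
    [0, 4, 19, 20, 35, 38], [1, 5, 20, 21, 26, 36], [2, 6, 21, 22, 27, 37],
    [3, 7, 22, 23, 28, 38], [4, 8, 23, 24, 26, 29], [5, 9, 24, 25, 27, 30],
    [6, 10, 13, 25, 28, 31], [7, 11, 13, 14, 29, 32], [8, 12, 14, 15, 30, 33]]"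

definition graph_43 :: "nat list list" where
  "graph_43 =
   [[2, 5, 12, 19, 27, 33, 34], [3, 6, 13, 20, 21, 28, 34], [0, 4, 7, 14, 22, 28, 29],
    [1, 5, 8, 15, 23, 29, 30], [2, 6, 9, 16, 24, 30, 31], [0, 3, 10, 17, 25, 31, 32],
    [1, 4, 11, 18, 26, 32, 33], [2, 15, 21, 32, 37, 42], [3, 16, 22, 33, 38, 42],
    [4, 17, 23, 34, 39, 42], [5, 18, 24, 28, 40, 42], [6, 19, 25, 29, 41, 42],
    [0, 20, 26, 30, 35, 42], [1, 14, 27, 31, 36, 42], [2, 13, 17, 18, 29, 35],
    [3, 7, 18, 19, 30, 36], [4, 8, 19, 20, 31, 37], [5, 9, 14, 20, 32, 38],
    [6, 10, 14, 15, 33, 39], [0, 11, 15, 16, 34, 40], [1, 12, 16, 17, 28, 41],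
    [1, 7, 24, 25, 34, 38], [2, 8, 25, 26, 28, 39], [3, 9, 26, 27, 29, 40],
    [4, 10, 21, 27, 30, 41], [5, 11, 21, 22, 31, 35], [6, 12, 22, 23, 32, 36],
    [0, 13, 23, 24, 33, 37], [1, 2, 10, 20, 22, 40], [2, 3, 11, 14, 23, 41],
    [3, 4, 12, 15, 24, 35], [4, 5, 13, 16, 25, 36], [5, 6, 7, 17, 26, 37], [0, 6, 8, 18, 27, 38],
    [0, 1, 9, 19, 21, 39], [12, 14, 25, 30, 37, 40], [13, 15, 26, 31, 38, 41],
    [7, 16, 27, 32, 35, 39], [8, 17, 21, 33, 36, 40], [9, 18, 22, 34, 37, 41],
    [10, 19, 23, 28, 35, 38], [11, 20, 24, 29, 36, 39], [7, 8, 9, 10, 11, 12, 13]]"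

definition graph_75 :: "nat list list" where
  "graph_75 =
   [[66, 67, 68, 69, 70, 71, 72, 73, 74], [2, 10, 17, 23, 36, 43, 51, 66],
    [1, 9, 16, 22, 30, 50, 59, 66], [6, 13, 21, 27, 33, 40, 48, 56, 64, 66],
    [7, 14, 28, 34, 41, 49, 57, 65, 66], [20, 26, 32, 39, 47, 55, 63, 66],
    [3, 12, 24, 38, 45, 53, 61, 66], [4, 19, 25, 31, 46, 54, 62, 66],
    [15, 16, 17, 18, 19, 20, 21, 74], [2, 15, 28, 33, 39, 46, 53, 60],
    [1, 15, 24, 31, 37, 48, 57, 63, 67], [15, 25, 34, 36, 45, 56, 59, 68],
    [6, 15, 23, 32, 38, 44, 50, 65, 72], [3, 14, 15, 26, 30, 43, 52, 64, 69],
    [4, 13, 15, 22, 41, 47, 51, 61, 70], [8, 9, 10, 11, 12, 13, 14, 74],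
    [2, 8, 25, 38, 49, 55, 64, 67], [1, 8, 27, 32, 41, 45, 52, 62],
    [8, 20, 24, 30, 40, 46, 51, 65, 71], [7, 8, 22, 31, 39, 44, 56, 69],
    [5, 8, 18, 28, 48, 50, 61, 68], [3, 8, 23, 33, 37, 47, 54, 59, 73],
    [2, 14, 19, 32, 37, 56, 61, 71], [1, 12, 21, 39, 43, 54, 65, 68],
    [6, 10, 18, 41, 46, 55, 59, 69], [7, 11, 16, 33, 45, 51, 63, 72],
    [5, 13, 30, 36, 44, 53, 62, 67], [3, 17, 31, 40, 49, 50, 60, 70],
    [4, 9, 20, 34, 38, 48, 52, 73], [50, 51, 52, 53, 54, 55, 56, 57, 74],
    [2, 13, 18, 26, 31, 45, 65, 73], [7, 10, 19, 27, 30, 38, 47, 60, 68],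
    [5, 12, 17, 22, 34, 37, 46, 64, 72], [3, 9, 21, 25, 41, 44, 63, 71],
    [4, 11, 28, 32, 40, 43, 59, 67], [58, 59, 60, 61, 62, 63, 64, 65, 74],
    [1, 11, 26, 38, 46, 56, 58, 70], [10, 21, 22, 32, 49, 53, 58, 73],
    [6, 12, 16, 28, 31, 36, 47, 52, 58, 71], [5, 9, 19, 23, 40, 45, 57, 58, 69],
    [3, 18, 27, 34, 39, 51, 58, 67], [4, 14, 17, 24, 33, 44, 55, 58, 68],
    [43, 44, 45, 46, 47, 48, 49, 74], [1, 13, 23, 34, 42, 55, 60, 71],
    [12, 19, 26, 33, 41, 42, 50, 67], [6, 11, 17, 25, 30, 39, 42, 57, 61, 73],
    [7, 9, 18, 24, 32, 36, 42, 54, 64, 70], [5, 14, 21, 31, 38, 42, 51, 59],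
    [3, 10, 20, 28, 42, 56, 62, 72], [4, 16, 27, 37, 42, 53, 65, 69],
    [2, 12, 20, 27, 29, 44, 57, 59, 70], [1, 14, 18, 25, 29, 40, 47, 53, 72],
    [13, 17, 28, 29, 38, 54, 63, 69], [6, 9, 26, 29, 37, 49, 51, 62, 68],
    [7, 21, 23, 29, 46, 52, 61, 67], [5, 16, 24, 29, 41, 43, 56, 60, 73],
    [3, 11, 19, 22, 29, 36, 48, 55, 65], [4, 10, 29, 39, 45, 50, 64, 71],
    [35, 36, 37, 38, 39, 40, 41, 74], [2, 11, 21, 24, 34, 35, 47, 50, 62, 69],
    [9, 27, 31, 35, 43, 55, 61, 72], [6, 14, 20, 22, 35, 45, 54, 60, 67],
    [7, 17, 26, 35, 48, 53, 59, 71], [5, 10, 25, 33, 35, 52, 65, 70],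
    [3, 13, 16, 32, 35, 46, 57, 68], [4, 12, 18, 23, 30, 35, 49, 56, 63],
    [0, 1, 2, 3, 4, 5, 6, 7, 74], [0, 10, 16, 26, 34, 40, 44, 54, 61],
    [0, 11, 20, 23, 31, 41, 53, 64], [0, 13, 19, 24, 39, 49, 52, 59, 72],
    [0, 14, 27, 36, 46, 50, 63, 73], [0, 18, 22, 33, 38, 43, 57, 62],
    [0, 12, 25, 32, 48, 51, 60, 69], [0, 21, 28, 30, 37, 45, 55, 70],
    [0, 8, 15, 29, 35, 42, 58, 66]]"

lemma C4_free_graph_32: "C4_free_lists 5 graph_32" "length graph_32 = 32"
  by code_simp+

lemma C4_free_graph_34: "C4_free_lists 6 graph_34" "length graph_34 = 34"
  by code_simp+

lemma C4_free_graph_35: "C4_free_lists 6 graph_35" "length graph_35 = 35"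
  by code_simp+

lemma C4_free_graph_36: "C4_free_lists 6 graph_36" "length graph_36 = 36"
  by code_simp+

lemma C4_free_graph_37: "C4_free_lists 6 graph_37" "length graph_37 = 37"
  by code_simp+

lemma C4_free_graph_38: "C4_free_lists 6 graph_38" "length graph_38 = 38"
  by code_simp+

lemma C4_free_graph_39: "C4_free_lists 6 graph_39" "length graph_39 = 39"
  by code_simp+

lemma C4_free_graph_43: "C4_free_lists 6 graph_43" "length graph_43 = 43"
  by code_simp+

lemma C4_free_graph_75: "C4_free_lists 8 graph_75" "length graph_75 = 75"
  by code_simp+

section \<open>The nine values\<close>

theorem theorem10:
  shows "C4_star_ramsey 27 = 33 \<and> C4_star_ramsey 28 = 35 \<and> C4_star_ramsey 29 = 36 \<and>
    C4_star_ramsey 30 = 37 \<and> C4_star_ramsey 31 = 38 \<and> C4_star_ramsey 32 = 39 \<and>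
    C4_star_ramsey 33 = 40 \<and> C4_star_ramsey 37 = 44 \<and> C4_star_ramsey 67 = 76"
proof -
  have "C4_star_ramsey 27 \<le> 6 + 27"
    by (rule C4_star_ramsey_le, rule no_6_regular_graph_on_33, rule regular_of_min_degree) auto
  moreover have "C4_star_ramsey 37 \<le> 7 + 37"
    by (rule C4_star_ramsey_le, rule no_7_regular_graph_on_44, rule regular_of_min_degree) auto
  moreover have "C4_star_ramsey 67 \<le> 9 + 67"
    by (rule C4_star_ramsey_le, rule no_9_regular_graph_on_76, rule regular_of_min_degree) auto
  moreover have "C4_star_ramsey 28 \<le> 7 + 28" "C4_star_ramsey 29 \<le> 7 + 29" "C4_star_ramsey 30 \<le> 7 + 30"
    "C4_star_ramsey 31 \<le> 7 + 31" "C4_star_ramsey 32 \<le> 7 + 32" "C4_star_ramsey 33 \<le> 7 + 33"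
    by (rule Parsons_bound; simp)+
  moreover have "32 < C4_star_ramsey 27" "34 < C4_star_ramsey 28" "35 < C4_star_ramsey 29"
    "36 < C4_star_ramsey 30" "37 < C4_star_ramsey 31" "38 < C4_star_ramsey 32" "39 < C4_star_ramsey 33"
    "43 < C4_star_ramsey 37" "75 < C4_star_ramsey 67"
    using less_C4_star_ramsey_lists[OF C4_free_graph_32(1), of 27]
      less_C4_star_ramsey_lists[OF C4_free_graph_34(1), of 28]
      less_C4_star_ramsey_lists[OF C4_free_graph_35(1), of 29]
      less_C4_star_ramsey_lists[OF C4_free_graph_36(1), of 30]
      less_C4_star_ramsey_lists[OF C4_free_graph_37(1), of 31]
      less_C4_star_ramsey_lists[OF C4_free_graph_38(1), of 32]
      less_C4_star_ramsey_lists[OF C4_free_graph_39(1), of 33]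
      less_C4_star_ramsey_lists[OF C4_free_graph_43(1), of 37]
      less_C4_star_ramsey_lists[OF C4_free_graph_75(1), of 67]
    by (simp_all add: C4_free_graph_32(2) C4_free_graph_34(2) C4_free_graph_35(2) C4_free_graph_36(2)
        C4_free_graph_37(2) C4_free_graph_38(2) C4_free_graph_39(2) C4_free_graph_43(2) C4_free_graph_75(2))
  ultimately show ?thesis by simp
qed

end
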